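(* Let $Z_1, Z_2 \subset \mathbb{P}V$ be two nondegenerate Euler-symmetric projective varieties of equal dimension. Let $x_1 \in Z_1$ and $x_2 \in Z_2$ be general points. If the systems of fundamental forms $\mathbf{F}_{x_1}$ of $Z_1$ at $x_1$ and $\mathbf{F}_{x_2}$ of $Z_2$ at $x_2$ are isomorphic, then $Z_1$ and $Z_2$ are isomorphic by a projective transformation of $\mathbb{P}V$.
   Context: Everything is over $\mathbb{C}$; $V$ is a finite-dimensional complex vector space, $\mathbb{P}V$ is the projective space of one-dimensional subspaces of $V$, and varieties are irreducible. A subvariety of $\mathbb{P}V$ is nondegenerate if it is not contained in a hyperplane. "General point" means any point in some nonempty Zariski-open subset. Euler-symmetric varieties. For a nonsingular point $x$ of a projective variety $Z\subset \mathbb{P}V$, a $\mathbb{C}^{\times}$-action on $Z$ coming from a multiplicative subgroup of $\mathbf{GL}(V)$ is of Euler type at $x$ if $x$ is an isolated fixed point of the induced action on $Z$ and the isotropic action on $T_xZ$ is by scalar multiplication (i.e., the induced action on $\mathbb{P}T_xZ$ is trivial). $Z \subset \mathbb{P}V$ is Euler-symmetric if for a general point $x \in Z$ there exists a $\mathbb{C}^{\times}$-action on $Z$ of Euler type at $x$. Fundamental forms. Let $x \in Z \subset \mathbb{P}V$ be a nonsingular point of a nondegenerate projective variety, and let $L$ be the restriction to $Z$ of the hyperplane line bundle. For $s\in H^0(Z,L)$ let $j^k_x(s)$ be the $k$-jet of $s$ at $x$, with $j^0_x(s)=s_x\in L_x$. View $V^* \subset H^0(Z,L)$. The natural homomorphism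 $$(V^* \cap \mathrm{Ker}(j_x^{k-1}))/(V^* \cap \mathrm{Ker}(j_x^{k})) \to L_x \otimes \mathrm{Sym}^k T_x^*Z$$ is injective. For $k\ge 2$, the subspace $F^k_x \subset \mathrm{Sym}^k T^*_xZ$ defined by its image is the $k$-th fundamental form of $Z$ at $x$. Set $F^0_x=\mathrm{Sym}^0T_x^*Z=\mathbb{C}$ and $F^1_x=T^*_xZ$. The system of fundamental forms of $Z$ at $x$ is $\mathbf{F}_x=\bigoplus_{k\ge 0}F^k_x \subset \bigoplus_{k\ge0}\mathrm{Sym}^kT^*_xZ$. Isomorphism. $\mathbf{F}_{x_1}$ and $\mathbf{F}_{x_2}$ are isomorphic if there is a linear isomorphism $\varphi: T^*_{x_1}Z_1 \to T^*_{x_2}Z_2$ such that the induced isomorphism $\bigoplus_{k\ge0}\mathrm{Sym}^kT^*_{x_1}Z_1 \to \bigoplus_{k\ge0}\mathrm{Sym}^kT^*_{x_2}Z_2$ sends $\mathbf{F}_{x_1}$ isomorphically to $\mathbf{F}_{x_2}$. *)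

theory Defs
  imports "HOL-Analysis.Analysis" "HOL-Library.Function_Algebras"
begin

section \<open>Projective space and its Zariski topology\<close>

text \<open>The vector space \<open>V\<close> is \<^typ>\<open>complex ^ 'n\<close>; a point of \<open>\<PP>V\<close> is
  a one-dimensional linear subspace, regarded as a set of vectors.\<close>

type_synonym 'n ppoint = "(complex, 'n) vec set"

definition proj_space :: "('n::finite) ppoint set" where
  "proj_space = {p. vec.subspace p \<and> vec.dim p = 1}"

text \<open>Homogeneous polynomials of degree \<open>d\<close> on \<open>V\<close>, as functions (no information is lost, the
  field being infinite). The zero polynomial has every degree.\<close>

inductive homog_poly :: "nat \<Rightarrow> (complex ^ 'n \<Rightarrow> complex) \<Rightarrow> bool" where
  const: "homog_poly 0 (\<lambda>_. c)"
| coord: "homog_poly 1 (\<lambda>v. v $ i)"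
| add: "homog_poly d f \<Longrightarrow> homog_poly d g \<Longrightarrow> homog_poly d (\<lambda>v. f v + g v)"
| mult: "homog_poly d f \<Longrightarrow> homog_poly e g \<Longrightarrow> homog_poly (d + e) (\<lambda>v. f v * g v)"

definition proj_zeros :: "(complex ^ 'n \<Rightarrow> complex) set \<Rightarrow> ('n::finite) ppoint set" where
  "proj_zeros S = {p \<in> proj_space. \<forall>f\<in>S. \<forall>v\<in>p. f v = 0}"

definition zariski :: "('n::finite) ppoint topology" where
  "zariski = topology (\<lambda>U. \<exists>S. (\<forall>f\<in>S. \<exists>d. homog_poly d f) \<and> U = proj_space - proj_zeros S)"

lemma homog_poly_scale:
  fixes f :: "complex ^ 'n \<Rightarrow> complex"
  shows "homog_poly d f \<Longrightarrow> f (c *s v) = c ^ d * f v"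
  by (induction rule: homog_poly.induct) (simp_all add: algebra_simps power_add)

lemma proj_space_generator:
  fixes p :: "('n::finite) ppoint"
  assumes "p \<in> proj_space"
  obtains v where "v \<in> p" "v \<noteq> 0" "p = range (\<lambda>c. c *s v)"
proof -
  have sub: "vec.subspace p" and dim: "vec.dim p = 1"
    using assms by (auto simp: proj_space_def)
  obtain B where B: "B \<subseteq> p" "vec.independent B" "p \<subseteq> vec.span B" "card B = vec.dim p"
    using vec.basis_exists by blast
  obtain v where v: "B = {v}"
    using B(4) dim by (auto simp: card_1_singleton_iff)
  have "v \<noteq> 0" using B(2) v vec.dependent_zero by blast
  moreover have "p = vec.span {v}"
    using B v sub vec.span_subspace by blast
  ultimately show ?thesis
    using that[of v] B(1) v by (simp add: vec.span_singleton)
qed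

lemma openin_zariski:
  "openin (zariski :: ('n::finite) ppoint topology) U \<longleftrightarrow>
     (\<exists>S. (\<forall>f\<in>S. \<exists>d. homog_poly d f) \<and> U = proj_space - proj_zeros S)"
proof -
  let ?H = "\<lambda>S :: (complex ^ 'n \<Rightarrow> complex) set. \<forall>f\<in>S. \<exists>d. homog_poly d f"
  let ?O = "\<lambda>U :: 'n ppoint set. \<exists>S. ?H S \<and> U = proj_space - proj_zeros S"
  have "istopology ?O"
    unfolding istopology_def
  proof (intro conjI allI impI)
    fix U W :: "'n ppoint set"
    assume "?O U" "?O W"
    then obtain S T where S: "?H S" "U = proj_space - proj_zeros S"
      and T: "?H T" "W = proj_space - proj_zeros T" by blast
    let ?R = "{(\<lambda>v. f v * g v) | f g. f \<in> S \<and> g \<in> T}"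
    have "?H ?R" using S(1) T(1) homog_poly.mult by blast
    moreover have "U \<inter> W = proj_space - proj_zeros ?R"
    proof -
      have "p \<in> U \<inter> W \<longleftrightarrow> p \<notin> proj_zeros ?R" if p: "p \<in> proj_space" for p
      proof -
        obtain w where w: "w \<in> p" "p = range (\<lambda>c. c *s w)"
          using proj_space_generator[OF p] by metis
        have van: "(\<forall>v\<in>p. f v = 0) \<longleftrightarrow> f w = 0" if "homog_poly d f" for d f
          using w homog_poly_scale[OF that] by auto
        have R: "p \<in> proj_zeros ?R \<longleftrightarrow> (\<forall>f\<in>S. \<forall>g\<in>T. f w * g w = 0)"
        proof -
          have "(\<forall>v\<in>p. f v * g v = 0) \<longleftrightarrow> f w * g w = 0" if "f \<in> S" "g \<in> T" for f g
            using that S(1) T(1) van homog_poly.mult by blast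
          then show ?thesis
            using p unfolding proj_zeros_def by fastforce
        qed
        have "p \<in> proj_zeros S \<longleftrightarrow> (\<forall>f\<in>S. f w = 0)"
          using p S(1) van unfolding proj_zeros_def by blast
        moreover have "p \<in> proj_zeros T \<longleftrightarrow> (\<forall>g\<in>T. g w = 0)"
          using p T(1) van unfolding proj_zeros_def by blast
        ultimately show ?thesis
          using R p S(2) T(2) by auto
      qed
      then show ?thesis using S(2) T(2) by blast
    qed
    ultimately show "?O (U \<inter> W)" by blast
  next
    fix K :: "'n ppoint set set"
    assume "\<forall>U\<in>K. ?O U"
    then obtain S where S: "\<forall>U\<in>K. ?H (S U) \<and> U = proj_space - proj_zeros (S U)"
      by metis
    have "?H (\<Union>U\<in>K. S U)" using S by blast
    moreover have "\<Union>K = proj_space - proj_zeros (\<Union>U\<in>K. S U)"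
    proof -
      have "proj_space - proj_zeros (\<Union>U\<in>K. S U) = (\<Union>U\<in>K. proj_space - proj_zeros (S U))"
        unfolding proj_zeros_def by blast
      also have "\<dots> = \<Union>K" using S by auto
      finally show ?thesis by simp
    qed
    ultimately show "?O (\<Union>K)" by blast
  qed
  then show ?thesis
    unfolding zariski_def by (simp add: topology_inverse')
qed

lemma topspace_zariski [simp]: "topspace zariski = (proj_space :: ('n::finite) ppoint set)"
proof -
  have "proj_zeros {\<lambda>_::complex ^ 'n. 1} = {}"
    using proj_space_generator by (force simp: proj_zeros_def)
  then have "openin zariski (proj_space :: 'n ppoint set)"
    unfolding openin_zariski
    by (intro exI[of _ "{\<lambda>_. 1}"]) (auto intro: homog_poly.const)
  moreover have "U \<subseteq> proj_space" if "openin zariski U" for U :: "'n ppoint set"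
    using that unfolding openin_zariski by blast
  ultimately show ?thesis
    by (meson openin_subset openin_topspace subset_antisym)
qed

abbreviation zariski_on :: "('n::finite) ppoint set \<Rightarrow> 'n ppoint topology" where
  "zariski_on Z \<equiv> subtopology zariski Z"

definition projective_variety :: "('n::finite) ppoint set \<Rightarrow> bool" where
  "projective_variety Z \<longleftrightarrow> closedin zariski Z \<and> Z \<noteq> {} \<and>
     (\<forall>A B. closedin zariski A \<and> closedin zariski B \<and> Z = A \<union> B \<longrightarrow> Z = A \<or> Z = B)"

definition variety_dim :: "('n::finite) ppoint set \<Rightarrow> enat" where
  "variety_dim Z = (SUP m \<in> {m. \<exists>C. (\<forall>i\<le>m. projective_variety (C i) \<and> C i \<subseteq> Z) \<and>
                                    (\<forall>i<m. C i \<subset> C (Suc i))}. enat m)"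

text \<open>A property of points holds at a general point of \<open>Z\<close> if it holds on a nonempty Zariski-open
  subset.\<close>

definition general_set :: "('n::finite) ppoint set \<Rightarrow> 'n ppoint set \<Rightarrow> bool" where
  "general_set Z U \<longleftrightarrow> openin (zariski_on Z) U \<and> U \<noteq> {}"

definition dual_V :: "(complex ^ 'n \<Rightarrow> complex) set" where
  "dual_V = {l. Vector_Spaces.linear (*s) (*) l}"

definition nondegenerate :: "('n::finite) ppoint set \<Rightarrow> bool" where
  "nondegenerate Z \<longleftrightarrow>
     \<not> (\<exists>l\<in>dual_V. l \<noteq> 0 \<and> Z \<subseteq> {p \<in> proj_space. \<forall>v\<in>p. l v = 0})"

definition proj_map :: "complex ^ 'n ^ 'n \<Rightarrow> ('n::finite) ppoint \<Rightarrow> 'n ppoint" where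
  "proj_map A p = (\<lambda>v. A *v v) ` p"

definition projectively_isomorphic ::
    "('n::finite) ppoint set \<Rightarrow> 'n ppoint set \<Rightarrow> bool" where
  "projectively_isomorphic Z1 Z2 \<longleftrightarrow>
     (\<exists>A :: complex ^ 'n ^ 'n. invertible A \<and> proj_map A ` Z1 = Z2)"


section \<open>Local rings, tangent and cotangent spaces\<close>

interpretation fun_space: vector_space "\<lambda>(c::complex) (f :: 'a \<Rightarrow> complex). (\<lambda>x. c * f x)"
  by unfold_locales (auto simp: fun_eq_iff algebra_simps)

text \<open>The value at \<open>p\<close> of \<open>f / g\<close>. It does not depend on the chosen \<open>v\<close> if \<open>f\<close> and
  \<open>g\<close> are homogeneous of the same degree.\<close>

definition ratio :: "(complex ^ 'n \<Rightarrow> complex) \<Rightarrow> (complex ^ 'n \<Rightarrow> complex) \<Rightarrow>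
    ('n::finite) ppoint \<Rightarrow> complex" where
  "ratio f g p = (let v = (SOME v. v \<in> p \<and> v \<noteq> 0) in f v / g v)"

definition nonvanishing :: "(complex ^ 'n \<Rightarrow> complex) \<Rightarrow> ('n::finite) ppoint \<Rightarrow> bool" where
  "nonvanishing g p \<longleftrightarrow> (\<forall>v\<in>p. v \<noteq> 0 \<longrightarrow> g v \<noteq> 0)"

text \<open>Elements of the local ring \<open>O\<^sub>Z\<^sub>,\<^sub>x\<close> are represented by functions on all points, of which only the
  germ along \<open>Z\<close> at \<open>x\<close> matters; \<open>germ_eq\<close> is equality of germs.\<close>

definition germ_eq :: "('n::finite) ppoint set \<Rightarrow> 'n ppoint \<Rightarrow>
    ('n ppoint \<Rightarrow> complex) \<Rightarrow> ('n ppoint \<Rightarrow> complex) \<Rightarrow> bool" where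
  "germ_eq Z x \<phi> \<psi> \<longleftrightarrow> (\<forall>\<^sub>F p in nhdsin (zariski_on Z) x. \<phi> p = \<psi> p)"

definition local_ring :: "('n::finite) ppoint set \<Rightarrow> 'n ppoint \<Rightarrow> ('n ppoint \<Rightarrow> complex) set" where
  "local_ring Z x = {\<phi>. \<exists>d f g. homog_poly d f \<and> homog_poly d g \<and>
     (\<forall>\<^sub>F p in nhdsin (zariski_on Z) x. nonvanishing g p \<and> \<phi> p = ratio f g p)}"

definition max_ideal :: "('n::finite) ppoint set \<Rightarrow> 'n ppoint \<Rightarrow> ('n ppoint \<Rightarrow> complex) set" where
  "max_ideal Z x = {\<phi> \<in> local_ring Z x. \<phi> x = 0}"

text \<open>The Zariski tangent space, as the space of point derivations of \<open>O\<^sub>Z\<^sub>,\<^sub>x\<close> at \<open>x\<close>. A derivation is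
  extended by zero to functions that are not regular at \<open>x\<close>, so that equal derivations are equal
  functions.\<close>

definition tangent_space :: "('n::finite) ppoint set \<Rightarrow> 'n ppoint \<Rightarrow>
    (('n ppoint \<Rightarrow> complex) \<Rightarrow> complex) set" where
  "tangent_space Z x = {D.
     (\<forall>\<phi>. \<phi> \<notin> local_ring Z x \<longrightarrow> D \<phi> = 0) \<and>
     (\<forall>\<phi>\<in>local_ring Z x. \<forall>\<psi>\<in>local_ring Z x. germ_eq Z x \<phi> \<psi> \<longrightarrow> D \<phi> = D \<psi>) \<and>
     (\<forall>\<phi>\<in>local_ring Z x. \<forall>\<psi>\<in>local_ring Z x. D (\<lambda>p. \<phi> p + \<psi> p) = D \<phi> + D \<psi>) \<and>
     (\<forall>c. \<forall>\<phi>\<in>local_ring Z x. D (\<lambda>p. c * \<phi> p) = c * D \<phi>) \<and>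
     (\<forall>\<phi>\<in>local_ring Z x. \<forall>\<psi>\<in>local_ring Z x.
        D (\<lambda>p. \<phi> p * \<psi> p) = \<phi> x * D \<psi> + \<psi> x * D \<phi>)}"

definition nonsingular_at :: "('n::finite) ppoint set \<Rightarrow> 'n ppoint \<Rightarrow> bool" where
  "nonsingular_at Z x \<longleftrightarrow>
     x \<in> Z \<and> enat (fun_space.dim (tangent_space Z x)) = variety_dim Z"

text \<open>Linear functionals on the tangent space, extended by zero.\<close>

definition cotangent_space :: "('n::finite) ppoint set \<Rightarrow> 'n ppoint \<Rightarrow>
    ((('n ppoint \<Rightarrow> complex) \<Rightarrow> complex) \<Rightarrow> complex) set" where
  "cotangent_space Z x = {\<xi>.
     (\<forall>D. D \<notin> tangent_space Z x \<longrightarrow> \<xi> D = 0) \<and>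
     (\<forall>D\<in>tangent_space Z x. \<forall>E\<in>tangent_space Z x. \<xi> (D + E) = \<xi> D + \<xi> E) \<and>
     (\<forall>c. \<forall>D\<in>tangent_space Z x. \<xi> (\<lambda>\<phi>. c * D \<phi>) = c * \<xi> D)}"

definition germ_differential :: "('n::finite) ppoint set \<Rightarrow> 'n ppoint \<Rightarrow>
    ('n ppoint \<Rightarrow> complex) \<Rightarrow> ((('n ppoint \<Rightarrow> complex) \<Rightarrow> complex) \<Rightarrow> complex)" where
  "germ_differential Z x u = (\<lambda>D. if D \<in> tangent_space Z x then D u else 0)"

definition tangent_map :: "('n::finite ppoint \<Rightarrow> 'n ppoint) \<Rightarrow>
    (('n ppoint \<Rightarrow> complex) \<Rightarrow> complex) \<Rightarrow> (('n ppoint \<Rightarrow> complex) \<Rightarrow> complex)" where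
  "tangent_map h D = (\<lambda>\<phi>. D (\<phi> \<circ> h))"


section \<open>Euler-symmetric varieties\<close>

text \<open>A multiplicative subgroup of \<open>GL(V)\<close>, given with its parametrization by \<open>\<complex>\<^sup>\<times>\<close>: an
  injective homomorphism of algebraic groups, so the matrix entries are Laurent polynomials. The
  value at \<open>0\<close> is irrelevant.\<close>

definition multiplicative_subgroup :: "(complex \<Rightarrow> complex ^ 'n ^ 'n) \<Rightarrow> bool" where
  "multiplicative_subgroup \<rho> \<longleftrightarrow>
     \<rho> 1 = mat 1 \<and>
     (\<forall>s t. s \<noteq> 0 \<and> t \<noteq> 0 \<longrightarrow> \<rho> (s * t) = \<rho> s ** \<rho> t) \<and>
     inj_on \<rho> (- {0}) \<and>
     (\<forall>i j. \<exists>q N. \<forall>t. t \<noteq> 0 \<longrightarrow> \<rho> t $ i $ j = poly q t / t ^ N)"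

definition euler_type_at ::
    "('n::finite) ppoint set \<Rightarrow> 'n ppoint \<Rightarrow> (complex \<Rightarrow> complex ^ 'n ^ 'n) \<Rightarrow> bool" where
  "euler_type_at Z x \<rho> \<longleftrightarrow>
     nonsingular_at Z x \<and>
     multiplicative_subgroup \<rho> \<and>
     (\<forall>t. t \<noteq> 0 \<longrightarrow> proj_map (\<rho> t) ` Z = Z) \<and>
     (\<exists>U. openin (zariski_on Z) U \<and>
          U \<inter> {z \<in> Z. \<forall>t. t \<noteq> 0 \<longrightarrow> proj_map (\<rho> t) z = z} = {x}) \<and>
     (\<forall>t. t \<noteq> 0 \<longrightarrow> (\<exists>c. \<forall>D\<in>tangent_space Z x.
          tangent_map (proj_map (\<rho> t)) D = (\<lambda>\<phi>. c * D \<phi>)))"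

definition euler_symmetric :: "('n::finite) ppoint set \<Rightarrow> bool" where
  "euler_symmetric Z \<longleftrightarrow> (\<exists>U. general_set Z U \<and> (\<forall>x\<in>U. \<exists>\<rho>. euler_type_at Z x \<rho>))"


section \<open>Symmetric powers and fundamental forms\<close>

text \<open>\<open>Sym\<^sup>k T\<^sup>*\<^sub>xZ\<close> is realized as the space of homogeneous polynomial functions of degree \<open>k\<close>
  on \<open>T\<^sub>xZ\<close>, again extended by zero. A list of pairs of a scalar \<open>c\<close> and a list of covectors
  \<open>\<xi>\<^sub>1, \<dots>, \<xi>\<^sub>k\<close> stands for the sum of the products \<open>c \<xi>\<^sub>1 \<cdots> \<xi>\<^sub>k\<close>.\<close>

type_synonym 'n form = "(('n ppoint \<Rightarrow> complex) \<Rightarrow> complex) \<Rightarrow> complex"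

definition sym_terms :: "('n::finite) ppoint set \<Rightarrow> 'n ppoint \<Rightarrow> nat \<Rightarrow>
    (complex \<times> 'n form list) list set" where
  "sym_terms Z x k = {ts. \<forall>(c, \<xi>s) \<in> set ts. length \<xi>s = k \<and> set \<xi>s \<subseteq> cotangent_space Z x}"

definition sym_value :: "('n::finite) ppoint set \<Rightarrow> 'n ppoint \<Rightarrow>
    (complex \<times> 'n form list) list \<Rightarrow> 'n form" where
  "sym_value Z x ts =
     (\<lambda>D. if D \<in> tangent_space Z x then \<Sum>(c, \<xi>s)\<leftarrow>ts. c * (\<Prod>\<xi>\<leftarrow>\<xi>s. \<xi> D) else 0)"

definition sym_power :: "('n::finite) ppoint set \<Rightarrow> 'n ppoint \<Rightarrow> nat \<Rightarrow> 'n form set" where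
  "sym_power Z x k = sym_value Z x ` sym_terms Z x k"

text \<open>The power \<open>\<mm>\<^sub>x\<^sup>k\<close> of the maximal ideal: finite sums of products \<open>a u\<^sub>1 \<cdots> u\<^sub>k\<close>, where
  \<open>a\<close> is in the local ring and the \<open>u\<^sub>i\<close> are in \<open>\<mm>\<^sub>x\<close>.\<close>

definition ideal_terms :: "('n::finite) ppoint set \<Rightarrow> 'n ppoint \<Rightarrow> nat \<Rightarrow>
    (('n ppoint \<Rightarrow> complex) \<times> ('n ppoint \<Rightarrow> complex) list) list set" where
  "ideal_terms Z x k =
     {ts. \<forall>(a, us) \<in> set ts. a \<in> local_ring Z x \<and> length us = k \<and> set us \<subseteq> max_ideal Z x}"

definition ideal_value ::
    "(('n::finite ppoint \<Rightarrow> complex) \<times> ('n ppoint \<Rightarrow> complex) list) list \<Rightarrow> 'n ppoint \<Rightarrow> complex"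
  where "ideal_value ts p = (\<Sum>(a, us)\<leftarrow>ts. a p * (\<Prod>u\<leftarrow>us. u p))"

definition max_ideal_power ::
    "('n::finite) ppoint set \<Rightarrow> 'n ppoint \<Rightarrow> nat \<Rightarrow> ('n ppoint \<Rightarrow> complex) set" where
  "max_ideal_power Z x k = {\<phi>. \<exists>ts\<in>ideal_terms Z x k. germ_eq Z x \<phi> (ideal_value ts)}"

text \<open>\<open>V\<^sup>* \<inter> Ker(j\<^sup>k\<^sub>x)\<close>: the linear forms whose restriction to \<open>Z\<close>, as a section of the hyperplane
  bundle \<open>L\<close>, lies in \<open>\<mm>\<^sub>x\<^sup>k\<^sup>+\<^sup>1 L\<close>. A linear form \<open>l0\<close> with \<open>l0(x) \<noteq> 0\<close> trivializes \<open>L\<close> near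
  \<open>x\<close>.\<close>

definition jet_kernel ::
    "('n::finite) ppoint set \<Rightarrow> 'n ppoint \<Rightarrow> nat \<Rightarrow> (complex ^ 'n \<Rightarrow> complex) set" where
  "jet_kernel Z x k = {l \<in> dual_V. \<forall>l0\<in>dual_V. nonvanishing l0 x \<longrightarrow>
     ratio l l0 \<in> max_ideal_power Z x (Suc k)}"

text \<open>The symbol of an element of \<open>\<mm>\<^sub>x\<^sup>k\<close>, i.e. its class under
  \<open>\<mm>\<^sub>x\<^sup>k / \<mm>\<^sub>x\<^sup>k\<^sup>+\<^sup>1 \<cong> Sym\<^sup>k T\<^sup>*\<^sub>xZ\<close>, which sends \<open>a u\<^sub>1 \<cdots> u\<^sub>k\<close> to \<open>a(x) du\<^sub>1 \<cdots> du\<^sub>k\<close>. It does not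
  depend on the chosen expression because \<open>x\<close> is nonsingular.\<close>

definition has_symbol ::
    "('n::finite) ppoint set \<Rightarrow> 'n ppoint \<Rightarrow> nat \<Rightarrow> ('n ppoint \<Rightarrow> complex) \<Rightarrow> 'n form \<Rightarrow> bool" where
  "has_symbol Z x k \<phi> P \<longleftrightarrow> (\<exists>ts\<in>ideal_terms Z x k. germ_eq Z x \<phi> (ideal_value ts) \<and>
     P = sym_value Z x (map (\<lambda>(a, us). (a x, map (germ_differential Z x) us)) ts))"

text \<open>The image of \<open>V\<^sup>* \<inter> Ker(j\<^sub>x\<^sup>k\<^sup>-\<^sup>1)\<close> in \<open>L\<^sub>x \<otimes> Sym\<^sup>k T\<^sup>*\<^sub>xZ\<close>, transported to
  \<open>Sym\<^sup>k T\<^sup>*\<^sub>xZ\<close> by trivializations of the line \<open>L\<^sub>x\<close>; changing \<open>l0\<close> rescales the symbol by a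
  nonzero constant, so this is the image subspace for any single choice of \<open>l0\<close>.\<close>

definition fundamental_form :: "('n::finite) ppoint set \<Rightarrow> 'n ppoint \<Rightarrow> nat \<Rightarrow> 'n form set" where
  "fundamental_form Z x k =
     (if k < 2 then sym_power Z x k
      else {P. \<exists>l\<in>jet_kernel Z x (k - 1). \<exists>l0\<in>dual_V.
                 nonvanishing l0 x \<and> has_symbol Z x k (ratio l l0) P})"

text \<open>An element of a direct sum over all degrees is the finitely supported sequence of its
  components.\<close>

definition fundamental_system :: "('n::finite) ppoint set \<Rightarrow> 'n ppoint \<Rightarrow> (nat \<Rightarrow> 'n form) set" where
  "fundamental_system Z x =
     {P. (\<forall>k. P k \<in> fundamental_form Z x k) \<and> finite {k. P k \<noteq> 0}}"

definition cotangent_iso :: "('n::finite) ppoint set \<Rightarrow> 'n ppoint \<Rightarrow> 'n ppoint set \<Rightarrow> 'n ppoint \<Rightarrow>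
    ('n form \<Rightarrow> 'n form) \<Rightarrow> bool" where
  "cotangent_iso Z1 x1 Z2 x2 \<phi> \<longleftrightarrow>
     bij_betw \<phi> (cotangent_space Z1 x1) (cotangent_space Z2 x2) \<and>
     (\<forall>\<xi>\<in>cotangent_space Z1 x1. \<forall>\<eta>\<in>cotangent_space Z1 x1. \<phi> (\<xi> + \<eta>) = \<phi> \<xi> + \<phi> \<eta>) \<and>
     (\<forall>c. \<forall>\<xi>\<in>cotangent_space Z1 x1. \<phi> (\<lambda>D. c * \<xi> D) = (\<lambda>D. c * \<phi> \<xi> D))"

text \<open>Graph of the isomorphism \<open>Sym\<^sup>k \<phi>\<close>, which sends \<open>\<xi>\<^sub>1 \<cdots> \<xi>\<^sub>k\<close> to \<open>\<phi>(\<xi>\<^sub>1) \<cdots> \<phi>(\<xi>\<^sub>k)\<close>.\<close>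

definition sym_power_map :: "('n::finite) ppoint set \<Rightarrow> 'n ppoint \<Rightarrow> 'n ppoint set \<Rightarrow> 'n ppoint \<Rightarrow>
    ('n form \<Rightarrow> 'n form) \<Rightarrow> nat \<Rightarrow> ('n form \<times> 'n form) set" where
  "sym_power_map Z1 x1 Z2 x2 \<phi> k =
     (\<lambda>ts. (sym_value Z1 x1 ts, sym_value Z2 x2 (map (\<lambda>(c, \<xi>s). (c, map \<phi> \<xi>s)) ts)))
       ` sym_terms Z1 x1 k"

definition sym_algebra_map :: "('n::finite) ppoint set \<Rightarrow> 'n ppoint \<Rightarrow> 'n ppoint set \<Rightarrow> 'n ppoint \<Rightarrow>
    ('n form \<Rightarrow> 'n form) \<Rightarrow> ((nat \<Rightarrow> 'n form) \<times> (nat \<Rightarrow> 'n form)) set" where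
  "sym_algebra_map Z1 x1 Z2 x2 \<phi> =
     {(P, Q). finite {k. P k \<noteq> 0} \<and> (\<forall>k. (P k, Q k) \<in> sym_power_map Z1 x1 Z2 x2 \<phi> k)}"

definition fundamental_systems_isomorphic ::
    "('n::finite) ppoint set \<Rightarrow> 'n ppoint \<Rightarrow> 'n ppoint set \<Rightarrow> 'n ppoint \<Rightarrow> bool" where
  "fundamental_systems_isomorphic Z1 x1 Z2 x2 \<longleftrightarrow>
     (\<exists>\<phi>. cotangent_iso Z1 x1 Z2 x2 \<phi> \<and>
          sym_algebra_map Z1 x1 Z2 x2 \<phi> `` fundamental_system Z1 x1 = fundamental_system Z2 x2)"

end

theory Submission
  imports Defs "HOL-Computational_Algebra.Polynomial"
begin

text \<open>Let \<open>x\<close> be a point with an action of Euler type and let \<open>h\<close> be the action of \<open>t = 2\<close>. If \<open>c\<close> is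
  the scalar by which \<open>h\<close> acts on the cotangent space, then \<open>h\<close> acts on \<open>m\<^sup>k / m\<^sup>k\<^sup>+\<^sup>1\<close> by \<open>c\<^sup>k\<close>, so an
  eigenvector in \<open>m\<^sup>k\<close> whose eigenvalue is none of \<open>c\<^sup>k, c\<^sup>k\<^sup>+\<^sup>1, \<dots>\<close> lies in every power of \<open>m\<close> and vanishes
  by Krull's intersection theorem. Hence \<open>V\<^sup>*\<close> is graded with weight \<open>k\<close> part isomorphic to \<open>F\<^sup>k\<^sub>x\<close>: the
  weight 0 part is a line, the weight 1 part is the cotangent space, and on the chart around \<open>x\<close> a
  linear form of weight \<open>k\<close> equals its symbol, a homogeneous polynomial of degree \<open>k\<close> in the forms of
  weight 1. So the chart lies in the graph of a polynomial map on the tangent space, and it is the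
  whole graph because the tangent space at the nonsingular point \<open>x\<close> has the dimension of \<open>Z\<close>. Under
  the identification of the chart with the tangent space, linear forms on \<open>V\<close> become the elements of
  the system of fundamental forms; an isomorphism of these systems therefore turns the linear
  coordinates of one chart into those of the other.\<close>

subsection \<open>Homogeneous polynomials and points\<close>

text \<open>One element of the group is enough because 2 is not a root of unity: its powers separate
  all weights. The weights of \<open>\<rho>\<close> are arbitrary integers; counting by order of
  vanishing comes from reindexing them as \<open>a + i * (b - a)\<close>, with \<open>a\<close> the
  weight of the line \<open>x\<close> and \<open>b\<close> that of a linear coordinate with nonzero
  derivative at \<open>x\<close>. That \<open>x\<close> is isolated among the fixed points excludes
  \<open>b = a\<close>: otherwise \<open>a\<close> would be the only weight, the action on
  \<open>Z\<close> trivial and \<open>x\<close> an isolated point. If the tangent space is zero,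
  every scalar is admissible and one different from 1 is chosen. A symbol is given by an expression
  that is not unique. Each expression is matched with a polynomial on \<open>V\<close> that factors
  through the weight 1 part, and the eigenvalue argument identifies this polynomial with a linear
  form on the chart. Dimension is the supremum of lengths of chains of subvarieties, so comparing
  the chart with the graph rests on a count: independent forms of growing degree along a chain
  against monomials on the tangent space.\<close>

definition line :: "complex ^ 'n \<Rightarrow> ('n::finite) ppoint" where
  "line v = range (\<lambda>c. c *s v)"

text \<open>The punctured affine cone. Forms have values at vectors and not at points, so vanishing
  statements are made here.\<close>

definition cone :: "('n::finite) ppoint set \<Rightarrow> (complex ^ 'n) set" where
  "cone Z = {v. v \<noteq> 0 \<and> line v \<in> Z}"

lemma line_in_proj_space:
  fixes v :: "complex ^ 'n::finite"
  assumes "v \<noteq> 0" shows "line v \<in> proj_space"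
proof -
  have "line v = vec.span {v}" by (simp add: line_def vec.span_singleton)
  moreover have "vec.dim (vec.span {v}) = 1"
    using assms by (simp add: vec.dim_span vec.dim_eq_card_independent)
  ultimately show ?thesis by (simp add: proj_space_def vec.subspace_span)
qed

lemma proj_space_line:
  assumes "p \<in> proj_space" obtains v where "v \<noteq> 0" "p = line v"
  using proj_space_generator[OF assms] unfolding line_def by metis

lemma mem_line: "v \<in> line (v :: complex ^ 'n::finite)"
  unfolding line_def by (rule range_eqI[of _ _ 1]) simp

lemma line_eq_line:
  fixes v w :: "complex ^ 'n::finite"
  assumes "v \<in> line w" "v \<noteq> 0" shows "line v = line w"
proof -
  obtain c where c: "v = c *s w" using assms by (auto simp: line_def)
  then have "c \<noteq> 0" using assms by auto
  show ?thesis
  proof (intro equalityI subsetI)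
    fix u assume "u \<in> line w"
    then obtain d where "u = d *s w" by (auto simp: line_def)
    then have "u = (d / c) *s v" using c \<open>c \<noteq> 0\<close> by (simp add: vector_smult_assoc)
    then show "u \<in> line v" by (auto simp: line_def)
  qed (auto simp: line_def c vector_smult_assoc)
qed

lemma line_scale:
  fixes v :: "complex ^ 'n::finite"
  assumes "c \<noteq> 0" shows "line (c *s v) = line v"
proof (cases "v = 0")
  case False
  then show ?thesis using assms by (intro line_eq_line) (auto simp: line_def)
qed (simp add: line_def)

lemma cone_scale: "c \<noteq> 0 \<Longrightarrow> c *s v \<in> cone Z \<longleftrightarrow> v \<in> cone Z"
  by (simp add: cone_def line_scale)

lemma zeros_line:
  assumes "homog_poly d f"
  shows "(\<forall>u\<in>line v. f u = 0) \<longleftrightarrow> f v = 0"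
  using homog_poly_scale[OF assms] mem_line[of v] by (auto simp: line_def)

lemma nonvanishing_line:
  assumes "homog_poly d f" "v \<noteq> 0"
  shows "nonvanishing f (line v) \<longleftrightarrow> f v \<noteq> 0"
  using homog_poly_scale[OF assms(1)] mem_line[of v] assms(2)
  by (auto simp: nonvanishing_def line_def)

text \<open>The vector picked by \<open>SOME\<close> is a nonzero multiple of \<open>v\<close>, and
  the scalar cancels because numerator and denominator have the same degree.\<close>

lemma ratio_line:
  assumes "homog_poly d f" "homog_poly d g" "v \<noteq> 0"
  shows "ratio f g (line v) = f v / g v"
proof -
  define u where "u = (SOME u. u \<in> line v \<and> u \<noteq> 0)"
  have u: "u \<in> line v \<and> u \<noteq> 0"
    unfolding u_def using mem_line[of v] assms(3) by (rule_tac someI) auto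
  then obtain c where "u = c *s v" "c \<noteq> 0" by (auto simp: line_def)
  then show ?thesis
    unfolding ratio_def Let_def u_def[symmetric]
    using homog_poly_scale[OF assms(1)] homog_poly_scale[OF assms(2)] by simp
qed

lemma homog_poly_cmult: "homog_poly d f \<Longrightarrow> homog_poly d (\<lambda>v. c * f v)"
  using homog_poly.mult[OF homog_poly.const[of c], of d f] by simp

lemma homog_poly_power: "homog_poly d f \<Longrightarrow> homog_poly (d * k) (\<lambda>v. f v ^ k)"
proof (induction k)
  case (Suc k)
  then show ?case using homog_poly.mult[of d f "d * k" "\<lambda>v. f v ^ k"] by simp
qed (simp add: homog_poly.const)

text \<open>Constants are introduced in degree 0 alone; degree \<open>d\<close> is reached by
  multiplying the \<open>d\<close>-th power of some coordinate by 0.\<close>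

lemma homog_poly_zero: "homog_poly d (\<lambda>_ :: complex ^ 'n::finite. 0)"
  using homog_poly_cmult[OF homog_poly_power[OF homog_poly.coord[of undefined], of d], of 0] by simp

lemma homog_poly_diff:
  "homog_poly d f \<Longrightarrow> homog_poly d g \<Longrightarrow> homog_poly d (\<lambda>v. f v - g v)"
  using homog_poly.add[of d f "\<lambda>v. - 1 * g v"] homog_poly_cmult[of d g "- 1"] by simp

lemma homog_poly_sum:
  fixes f :: "'a \<Rightarrow> complex ^ 'n::finite \<Rightarrow> complex"
  shows "(\<And>i. i \<in> I \<Longrightarrow> homog_poly d (f i)) \<Longrightarrow> homog_poly d (\<lambda>v. \<Sum>i\<in>I. f i v)"
  by (induction I rule: infinite_finite_induct) (auto intro: homog_poly.add homog_poly_zero)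

lemma dual_V_D:
  assumes "l \<in> dual_V"
  shows "l (u + v) = l u + l v" "l (u - v) = l u - l v" "l (c *s v) = c * l v" "l 0 = 0" "l (- v) = - l v"
    and "l (sum f I) = (\<Sum>i\<in>I. l (f i))"
proof -
  interpret Vector_Spaces.linear "(*s)" "(*)" l using assms by (simp add: dual_V_def)
  show "l (u + v) = l u + l v" "l (u - v) = l u - l v" "l (c *s v) = c * l v" "l 0 = 0" "l (- v) = - l v"
    and "l (sum f I) = (\<Sum>i\<in>I. l (f i))"
    by (auto simp: add diff scale zero neg sum)
qed

lemma dual_V_I:
  assumes "\<And>u v. l (u + v) = l u + l v" "\<And>c v. l (c *s v) = c * l v"
  shows "l \<in> dual_V"
  unfolding dual_V_def mem_Collect_eq
  by unfold_locales (auto simp: assms algebra_simps)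

lemma vec_expand: "(v :: complex ^ 'n::finite) = (\<Sum>i\<in>UNIV. (v $ i) *s axis i 1)"
  by (simp add: basis_expansion)

lemma dual_V_expand:
  fixes v :: "complex ^ 'n::finite"
  assumes "l \<in> dual_V" shows "l v = (\<Sum>i\<in>UNIV. l (axis i 1) * v $ i)"
proof -
  have "l v = l (\<Sum>i\<in>UNIV. (v $ i) *s axis i 1)" using vec_expand[of v] by metis
  then show ?thesis by (simp add: dual_V_D[OF assms] mult.commute)
qed

lemma dual_V_homog:
  fixes l :: "complex ^ 'n::finite \<Rightarrow> complex"
  assumes "l \<in> dual_V" shows "homog_poly 1 l"
proof -
  have "homog_poly 1 (\<lambda>v :: complex ^ 'n. \<Sum>i\<in>UNIV. l (axis i 1) * v $ i)"
    by (intro homog_poly_sum homog_poly_cmult homog_poly.coord)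
  moreover have "(\<lambda>v. \<Sum>i\<in>UNIV. l (axis i 1) * v $ i) = l"
    by (rule ext) (rule dual_V_expand[OF assms, symmetric])
  ultimately show ?thesis by simp
qed

lemma dual_V_comp_matrix: "l \<in> dual_V \<Longrightarrow> (\<lambda>v. l (A *v v)) \<in> dual_V"
  by (rule dual_V_I) (simp_all add: dual_V_D matrix_vector_right_distrib vec.scale)

lemma dual_V_coord: "(\<lambda>v. v $ i) \<in> dual_V"
  by (rule dual_V_I) auto

lemma dual_V_cmult: "l \<in> dual_V \<Longrightarrow> (\<lambda>v. c * l v) \<in> dual_V"
  by (rule dual_V_I) (auto simp: dual_V_D algebra_simps)

lemma dual_V_add: "l \<in> dual_V \<Longrightarrow> l' \<in> dual_V \<Longrightarrow> (\<lambda>v. l v + l' v) \<in> dual_V"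
  by (rule dual_V_I) (auto simp: dual_V_D algebra_simps)

lemma dual_V_zero: "(\<lambda>v. 0) \<in> dual_V"
  by (rule dual_V_I) auto

lemma dual_V_sum: "(\<And>i. i \<in> I \<Longrightarrow> l i \<in> dual_V) \<Longrightarrow> (\<lambda>v. \<Sum>i\<in>I. l i v) \<in> dual_V"
  by (induction I rule: infinite_finite_induct) (auto intro: dual_V_add dual_V_zero)

lemma homog_poly_comp_matrix:
  fixes A :: "complex ^ 'n::finite ^ 'n"
  shows "homog_poly d f \<Longrightarrow> homog_poly d (\<lambda>v. f (A *v v))"
proof (induction rule: homog_poly.induct)
  case (coord i)
  then show ?case using dual_V_homog[OF dual_V_comp_matrix[OF dual_V_coord]] by simp
qed (auto intro: homog_poly.intros)

subsection \<open>Zariski topology in coordinates\<close>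

lemma closedin_zariski:
  "closedin zariski C \<longleftrightarrow> (\<exists>S. (\<forall>f\<in>S. \<exists>d. homog_poly d f) \<and> C = proj_zeros S)"
proof
  assume "closedin zariski C"
  then have C: "C \<subseteq> proj_space" "openin zariski (proj_space - C)"
    by (auto simp: closedin_def)
  then obtain S where "\<forall>f\<in>S. \<exists>d. homog_poly d f" "proj_space - C = proj_space - proj_zeros S"
    by (auto simp: openin_zariski)
  moreover have "proj_zeros S \<subseteq> proj_space" by (auto simp: proj_zeros_def)
  ultimately show "\<exists>S. (\<forall>f\<in>S. \<exists>d. homog_poly d f) \<and> C = proj_zeros S"
    using C(1) by blast
next
  assume "\<exists>S. (\<forall>f\<in>S. \<exists>d. homog_poly d f) \<and> C = proj_zeros S"
  then show "closedin zariski C"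
    by (auto simp: closedin_def openin_zariski proj_zeros_def)
qed

lemma line_in_proj_zeros:
  assumes "\<forall>f\<in>S. \<exists>d. homog_poly d f" "v \<noteq> 0"
  shows "line v \<in> proj_zeros S \<longleftrightarrow> (\<forall>f\<in>S. f v = 0)"
proof -
  have "(\<forall>u\<in>line v. f u = 0) \<longleftrightarrow> f v = 0" if "f \<in> S" for f
    using assms(1) that zeros_line by blast
  then show ?thesis
    using line_in_proj_space[OF assms(2)] by (simp add: proj_zeros_def)
qed

lemma eqI_line:
  assumes "A \<subseteq> proj_space" "B \<subseteq> proj_space" "\<And>v. v \<noteq> 0 \<Longrightarrow> line v \<in> A \<longleftrightarrow> line v \<in> B"
  shows "A = B"
proof -
  have "p \<in> A \<longleftrightarrow> p \<in> B" if "p \<in> proj_space" for p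
    using proj_space_line[OF that] assms(3) by metis
  then show ?thesis using assms(1,2) by blast
qed

lemma variety_subset: "projective_variety Z \<Longrightarrow> Z \<subseteq> proj_space"
  unfolding projective_variety_def using closedin_subset[of zariski Z] by simp

text \<open>\<open>Z\<close> is the union of its closed subsets where \<open>f\<close> vanishes and
  where \<open>g\<close> vanishes. This primality of the homogeneous ideal is the form in which
  irreducibility of \<open>Z\<close> is used.\<close>

lemma variety_domain:
  assumes Z: "projective_variety Z" and f: "homog_poly d f" and g: "homog_poly e g"
    and fg: "\<And>v. v \<in> cone Z \<Longrightarrow> f v * g v = 0"
  shows "(\<forall>v\<in>cone Z. f v = 0) \<or> (\<forall>v\<in>cone Z. g v = 0)"
proof -
  obtain S where S: "\<forall>f\<in>S. \<exists>d. homog_poly d f" "Z = proj_zeros S"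
    using Z by (auto simp: projective_variety_def closedin_zariski)
  let ?A = "proj_zeros (insert f S)" and ?B = "proj_zeros (insert g S)"
  have Sf: "\<forall>h\<in>insert f S. \<exists>d. homog_poly d h" and Sg: "\<forall>h\<in>insert g S. \<exists>d. homog_poly d h"
    using S f g by auto
  have "Z = ?A \<union> ?B"
  proof (rule eqI_line)
    fix v :: "complex ^ 'a" assume "v \<noteq> 0"
    then show "line v \<in> Z \<longleftrightarrow> line v \<in> ?A \<union> ?B"
      using line_in_proj_zeros[OF S(1)] line_in_proj_zeros[OF Sf] line_in_proj_zeros[OF Sg] fg[of v]
      by (auto simp: S(2) cone_def)
  qed (auto simp: S(2) proj_zeros_def)
  moreover have "closedin zariski ?A" "closedin zariski ?B"
    using Sf Sg closedin_zariski by blast+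
  ultimately have "Z = ?A \<or> Z = ?B"
    using Z by (simp add: projective_variety_def)
  then show ?thesis
    using line_in_proj_zeros[OF Sf] line_in_proj_zeros[OF Sg] by (auto simp: cone_def)
qed

text \<open>Cancellation: a form that is nonzero somewhere on the cone may be dropped from an
  identity. Identities on a chart or a neighbourhood spread to the whole cone in this way.\<close>

lemma variety_power_domain:
  assumes Z: "projective_variety Z" and f: "homog_poly d f" and g: "homog_poly e g"
    and fg: "\<And>v. v \<in> cone Z \<Longrightarrow> f v ^ k * g v = 0" and nz: "w \<in> cone Z" "f w \<noteq> 0"
  shows "\<forall>v\<in>cone Z. g v = 0"
  using variety_domain[OF Z homog_poly_power[OF f] g fg] nz by auto

lemma variety_separate:
  assumes "projective_variety X" "projective_variety Y" "X \<subset> Y"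
  obtains d f w where "homog_poly d f" "\<And>v. v \<in> cone X \<Longrightarrow> f v = 0" "w \<in> cone Y" "f w \<noteq> 0"
proof -
  obtain S where S: "\<forall>f\<in>S. \<exists>d. homog_poly d f" "X = proj_zeros S"
    using assms(1) by (auto simp: projective_variety_def closedin_zariski)
  obtain p where p: "p \<in> Y" "p \<notin> X" using assms(3) by blast
  then obtain w where w: "w \<noteq> 0" "p = line w"
    using variety_subset[OF assms(2)] proj_space_line by blast
  then obtain f where f: "f \<in> S" "f w \<noteq> 0"
    using p S line_in_proj_zeros[OF S(1)] by auto
  obtain d where "homog_poly d f" using f S by blast
  moreover have "f v = 0" if "v \<in> cone X" for v
    using that f(1) line_in_proj_zeros[OF S(1)] by (auto simp: S(2) cone_def)
  ultimately show ?thesis using that f w p by (auto simp: cone_def)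
qed

lemma cone_nonempty:
  assumes "projective_variety Z" obtains v where "v \<in> cone Z"
proof -
  obtain p where "p \<in> Z" using assms by (auto simp: projective_variety_def)
  moreover obtain v where "v \<noteq> 0" "p = line v"
    using variety_subset[OF assms] \<open>p \<in> Z\<close> proj_space_line by blast
  ultimately show ?thesis using that[of v] by (simp add: cone_def)
qed

text \<open>Among the equations of the complement of an open neighbourhood, one does not vanish at
  \<open>v0\<close>, and its nonvanishing locus is already a neighbourhood. Germs can therefore be
  handled with a single form \<open>g\<close>.\<close>

lemma eventually_zariski:
  fixes Z :: "('n::finite) ppoint set"
  assumes Z: "Z \<subseteq> proj_space" and x: "line v0 \<in> Z" "v0 \<noteq> 0"
  shows "eventually P (nhdsin (zariski_on Z) (line v0)) \<longleftrightarrow>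
    (\<exists>d g. homog_poly d g \<and> g v0 \<noteq> 0 \<and> (\<forall>v\<in>cone Z. g v \<noteq> 0 \<longrightarrow> P (line v)))" (is "?L \<longleftrightarrow> ?R")
proof -
  have "topspace (zariski_on Z) = Z" using Z by (auto simp: topspace_subtopology)
  then have top: "line v0 \<in> topspace (zariski_on Z)" using x(1) by simp
  show ?thesis
proof
  assume ?L
  then obtain U where U: "openin (zariski_on Z) U" "line v0 \<in> U" "\<forall>p\<in>U. P p"
    unfolding eventually_nhdsin using top by blast
  obtain T where T: "openin zariski T" "U = T \<inter> Z" using U(1) unfolding openin_subtopology by blast
  then obtain S where S: "\<forall>f\<in>S. \<exists>d. homog_poly d f" "T = proj_space - proj_zeros S"
    unfolding openin_zariski by blast
  have "line v0 \<notin> proj_zeros S" using U(2) T(2) S(2) by blast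
  then obtain g where g: "g \<in> S" "g v0 \<noteq> 0"
    unfolding line_in_proj_zeros[OF S(1) x(2)] by blast
  obtain d where d: "homog_poly d g" using S g by blast
  have "P (line v)" if "v \<in> cone Z" "g v \<noteq> 0" for v
  proof -
    have v: "v \<noteq> 0" "line v \<in> Z" using that(1) by (simp_all add: cone_def)
    have "line v \<notin> proj_zeros S"
      unfolding line_in_proj_zeros[OF S(1) v(1)] using g(1) that(2) by blast
    then show ?thesis using U(3) T(2) S(2) v(2) line_in_proj_space[OF v(1)] by blast
  qed
  then show ?R using d g by blast
next
  assume ?R
  then obtain d g where g: "homog_poly d g" "g v0 \<noteq> 0" "\<forall>v\<in>cone Z. g v \<noteq> 0 \<longrightarrow> P (line v)" by blast
  have G: "\<forall>f\<in>{g}. \<exists>d. homog_poly d f" using g(1) by blast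
  let ?U = "(proj_space - proj_zeros {g}) \<inter> Z"
  have "openin (zariski_on Z) ?U"
    unfolding openin_subtopology openin_zariski using G by blast
  moreover have "line v0 \<in> ?U" using x(1) g(2) line_in_proj_zeros[OF G x(2)] line_in_proj_space[OF x(2)] by blast
  moreover have "P p" if p: "p \<in> ?U" for p
  proof -
    obtain v where v: "v \<noteq> 0" "p = line v" using p proj_space_line by blast
    have "v \<in> cone Z" using v p by (simp add: cone_def)
    moreover have "g v \<noteq> 0" using p line_in_proj_zeros[OF G v(1)] v(2) by simp
    ultimately show ?thesis using g(3) v(2) by blast
  qed
  ultimately show ?L unfolding eventually_nhdsin by blast
qed
qed

text \<open>A basis of \<open>U\<close> together with \<open>w\<close> extends to a basis of the
  space, and the functional is the coordinate at \<open>w\<close>. Infinite dimension is allowed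
  since one use is on the space of all functions of a point.\<close>

lemma (in vector_space) separating_functional:
  assumes U: "subspace U" and w: "w \<notin> U"
  obtains l where "\<And>u v. l (u + v) = l u + l v" "\<And>a v. l (scale a v) = a * l v"
    "\<And>u. u \<in> U \<Longrightarrow> l u = 0" "l w = 1"
proof -
  obtain B where B0: "B \<subseteq> U" "independent B" "U \<subseteq> span B" "card B = dim U"
    using basis_exists by blast
  then have B: "independent B" "span B = U" using span_subspace[OF B0(1,3) U] by auto
  have ind: "independent (insert w B)" using B w by (auto simp: independent_insert)
  define C where "C = extend_basis (insert w B)"
  have C: "insert w B \<subseteq> C" "independent C" "span C = UNIV"
    using extend_basis_superset[OF ind] independent_extend_basis[OF ind]
      span_extend_basis[OF ind] by (simp_all add: C_def)
  have inC: "v \<in> span C" for v using C by simp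
  have "w \<notin> B" using B w span_base by blast
  have "representation C u w = 0" if "u \<in> U" for u
  proof -
    have "representation C u = representation B u"
      using C(1) B that by (intro representation_extend[OF C(2)]) auto
    then show ?thesis using representation_ne_zero[of B u w] \<open>w \<notin> B\<close> by metis
  qed
  moreover have "representation C w w = 1"
    using representation_basis[OF C(2), of w] C(1) by simp
  ultimately show ?thesis
    using that[of "\<lambda>v. representation C v w"]
    by (simp add: representation_add[OF C(2) inC inC] representation_scale[OF C(2) inC])
qed

lemma tangent_space_add:
  "D \<in> tangent_space Z x \<Longrightarrow> D' \<in> tangent_space Z x \<Longrightarrow> D + D' \<in> tangent_space Z x"
  unfolding tangent_space_def by (simp add: distrib_left)

lemma tangent_space_cmult: "D \<in> tangent_space Z x \<Longrightarrow> (\<lambda>\<phi>. a * D \<phi>) \<in> tangent_space Z x"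
  unfolding tangent_space_def by (simp add: distrib_left mult.left_commute)

lemma cotangent_space_add:
  "\<xi> \<in> cotangent_space Z x \<Longrightarrow> \<eta> \<in> cotangent_space Z x \<Longrightarrow> \<xi> + \<eta> \<in> cotangent_space Z x"
  unfolding cotangent_space_def by (auto simp: distrib_left)

lemma cotangent_space_cmult:
  "\<xi> \<in> cotangent_space Z x \<Longrightarrow> (\<lambda>D. a * \<xi> D) \<in> cotangent_space Z x"
  unfolding cotangent_space_def by (auto simp: distrib_left)

section \<open>The local ring at a point and the powers of its maximal ideal\<close>

locale pointed_variety =
  fixes Z :: "('n::finite) ppoint set" and v0 :: "complex ^ 'n"
  assumes variety: "projective_variety Z" and base_in_cone: "v0 \<in> cone Z"
begin

abbreviation "x \<equiv> line v0"
abbreviation "O\<^sub>x \<equiv> local_ring Z x"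
abbreviation "M \<equiv> max_ideal_power Z x"
abbreviation near :: "('n ppoint \<Rightarrow> bool) \<Rightarrow> bool" where
  "near P \<equiv> eventually P (nhdsin (zariski_on Z) x)"

lemma base: "x \<in> Z" "v0 \<noteq> 0" and Z_sub: "Z \<subseteq> proj_space"
  using base_in_cone variety_subset[OF variety] by (auto simp: cone_def)

lemma near_iff:
  "near P \<longleftrightarrow> (\<exists>d g. homog_poly d g \<and> g v0 \<noteq> 0 \<and> (\<forall>v\<in>cone Z. g v \<noteq> 0 \<longrightarrow> P (line v)))"
  by (rule eventually_zariski[OF Z_sub base])

lemma near_x: "near P \<Longrightarrow> P x"
  using base_in_cone by (auto simp: near_iff)

lemma germ_eq_refl: "germ_eq Z x \<phi> \<phi>"
  by (simp add: germ_eq_def)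

lemma germ_eq_sym: "germ_eq Z x \<phi> \<psi> \<Longrightarrow> germ_eq Z x \<psi> \<phi>"
  by (simp add: germ_eq_def eq_commute)

lemma germ_eq_trans: "germ_eq Z x \<phi> \<psi> \<Longrightarrow> germ_eq Z x \<psi> \<theta> \<Longrightarrow> germ_eq Z x \<phi> \<theta>"
  unfolding germ_eq_def by (auto elim: eventually_elim2)

lemma germ_eq_add:
  "germ_eq Z x \<phi> \<phi>' \<Longrightarrow> germ_eq Z x \<psi> \<psi>' \<Longrightarrow> germ_eq Z x (\<lambda>p. \<phi> p + \<psi> p) (\<lambda>p. \<phi>' p + \<psi>' p)"
  unfolding germ_eq_def by (auto elim: eventually_elim2)

lemma germ_eq_mult:
  "germ_eq Z x \<phi> \<phi>' \<Longrightarrow> germ_eq Z x \<psi> \<psi>' \<Longrightarrow> germ_eq Z x (\<lambda>p. \<phi> p * \<psi> p) (\<lambda>p. \<phi>' p * \<psi>' p)"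
  unfolding germ_eq_def by (auto elim: eventually_elim2)

lemma germ_eq_x: "germ_eq Z x \<phi> \<psi> \<Longrightarrow> \<phi> x = \<psi> x"
  unfolding germ_eq_def by (rule near_x)

text \<open>Multiplying numerator and denominator by the form that cuts out the neighbourhood lets
  the denominator alone describe both the fraction and its domain.\<close>

lemma local_ring_iff:
  "\<phi> \<in> O\<^sub>x \<longleftrightarrow> (\<exists>d f g. homog_poly d f \<and> homog_poly d g \<and> g v0 \<noteq> 0 \<and>
     (\<forall>v\<in>cone Z. g v \<noteq> 0 \<longrightarrow> \<phi> (line v) = f v / g v))" (is "_ \<longleftrightarrow> ?R")
proof
  assume "\<phi> \<in> O\<^sub>x"
  then obtain d f g where fg: "homog_poly d f" "homog_poly d g"
    "near (\<lambda>p. nonvanishing g p \<and> \<phi> p = ratio f g p)" by (auto simp: local_ring_def)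
  from fg(3) obtain e s where s: "homog_poly e s" "s v0 \<noteq> 0"
    "\<forall>v\<in>cone Z. s v \<noteq> 0 \<longrightarrow> nonvanishing g (line v) \<and> \<phi> (line v) = ratio f g (line v)"
    unfolding near_iff by blast
  have *: "g v \<noteq> 0 \<and> \<phi> (line v) = f v / g v" if "v \<in> cone Z" "s v \<noteq> 0" for v
    using s(3) that nonvanishing_line[OF fg(2), of v] ratio_line[OF fg(1,2), of v] by (auto simp: cone_def)
  show ?R
  proof (intro exI conjI ballI impI)
    show "homog_poly (d + e) (\<lambda>v. f v * s v)" "homog_poly (d + e) (\<lambda>v. g v * s v)"
      using fg s by (auto intro: homog_poly.mult)
    show "g v0 * s v0 \<noteq> 0" using *[OF base_in_cone] s by simp
    show "\<phi> (line v) = f v * s v / (g v * s v)" if "v \<in> cone Z" "g v * s v \<noteq> 0" for v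
      using *[of v] that by simp
  qed
next
  assume ?R
  then obtain d f g where fg: "homog_poly d f" "homog_poly d g" "g v0 \<noteq> 0"
     "\<forall>v\<in>cone Z. g v \<noteq> 0 \<longrightarrow> \<phi> (line v) = f v / g v" by blast
  have "nonvanishing g (line v) \<and> \<phi> (line v) = ratio f g (line v)" if "v \<in> cone Z" "g v \<noteq> 0" for v
    using fg(4) that nonvanishing_line[OF fg(2), of v] ratio_line[OF fg(1,2), of v] by (auto simp: cone_def)
  then have "near (\<lambda>p. nonvanishing g p \<and> \<phi> p = ratio f g p)"
    unfolding near_iff using fg(2,3) by blast
  then show "\<phi> \<in> O\<^sub>x" unfolding local_ring_def using fg(1,2) by blast
qed

lemma local_ring_ratio:
  assumes "homog_poly d f" "homog_poly d g" "g v0 \<noteq> 0"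
  shows "ratio f g \<in> O\<^sub>x"
proof -
  have "\<forall>v\<in>cone Z. g v \<noteq> 0 \<longrightarrow> ratio f g (line v) = f v / g v"
    using ratio_line[OF assms(1,2)] by (auto simp: cone_def)
  then show ?thesis unfolding local_ring_iff using assms by blast
qed

lemma local_ring_const: "(\<lambda>_. c) \<in> O\<^sub>x"
  unfolding local_ring_iff
  by (rule exI[of _ 0], rule exI[of _ "\<lambda>_. c"], rule exI[of _ "\<lambda>_. 1"]) (auto intro: homog_poly.const)

lemma local_ring_mult:
  assumes "\<phi> \<in> O\<^sub>x" "\<psi> \<in> O\<^sub>x" shows "(\<lambda>p. \<phi> p * \<psi> p) \<in> O\<^sub>x"
proof -
  obtain d f g where 1: "homog_poly d f" "homog_poly d g" "g v0 \<noteq> 0"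
     "\<forall>v\<in>cone Z. g v \<noteq> 0 \<longrightarrow> \<phi> (line v) = f v / g v" using assms(1) unfolding local_ring_iff by blast
  obtain e f' g' where 2: "homog_poly e f'" "homog_poly e g'" "g' v0 \<noteq> 0"
     "\<forall>v\<in>cone Z. g' v \<noteq> 0 \<longrightarrow> \<psi> (line v) = f' v / g' v" using assms(2) unfolding local_ring_iff by blast
  show ?thesis unfolding local_ring_iff
  proof (intro exI conjI ballI impI)
    show "homog_poly (d + e) (\<lambda>v. f v * f' v)" "homog_poly (d + e) (\<lambda>v. g v * g' v)"
      using 1 2 by (auto intro: homog_poly.mult)
  qed (use 1 2 in auto)
qed

lemma local_ring_add:
  assumes "\<phi> \<in> O\<^sub>x" "\<psi> \<in> O\<^sub>x" shows "(\<lambda>p. \<phi> p + \<psi> p) \<in> O\<^sub>x"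
proof -
  obtain d f g where 1: "homog_poly d f" "homog_poly d g" "g v0 \<noteq> 0"
     "\<forall>v\<in>cone Z. g v \<noteq> 0 \<longrightarrow> \<phi> (line v) = f v / g v" using assms(1) unfolding local_ring_iff by blast
  obtain e f' g' where 2: "homog_poly e f'" "homog_poly e g'" "g' v0 \<noteq> 0"
     "\<forall>v\<in>cone Z. g' v \<noteq> 0 \<longrightarrow> \<psi> (line v) = f' v / g' v" using assms(2) unfolding local_ring_iff by blast
  show ?thesis unfolding local_ring_iff
  proof (intro exI conjI ballI impI)
    show "homog_poly (d + e) (\<lambda>v. f v * g' v + g v * f' v)" "homog_poly (d + e) (\<lambda>v. g v * g' v)"
      using 1 2 by (auto intro: homog_poly.mult homog_poly.add)
  qed (use 1 2 in \<open>auto simp: field_simps\<close>)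
qed

lemma local_ring_cmult: "\<phi> \<in> O\<^sub>x \<Longrightarrow> (\<lambda>p. c * \<phi> p) \<in> O\<^sub>x"
  using local_ring_mult[OF local_ring_const] .

lemma local_ring_diff: "\<phi> \<in> O\<^sub>x \<Longrightarrow> \<psi> \<in> O\<^sub>x \<Longrightarrow> (\<lambda>p. \<phi> p - \<psi> p) \<in> O\<^sub>x"
  using local_ring_add[OF _ local_ring_cmult[of \<psi> "- 1"], of \<phi>] by simp

lemma local_ring_inverse:
  assumes "\<phi> \<in> O\<^sub>x" "\<phi> x \<noteq> 0" shows "(\<lambda>p. 1 / \<phi> p) \<in> O\<^sub>x"
proof -
  obtain d f g where 1: "homog_poly d f" "homog_poly d g" "g v0 \<noteq> 0"
     "\<forall>v\<in>cone Z. g v \<noteq> 0 \<longrightarrow> \<phi> (line v) = f v / g v" using assms(1) unfolding local_ring_iff by blast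
  have "f v0 \<noteq> 0" using 1 base_in_cone assms(2) by auto
  show ?thesis unfolding local_ring_iff
  proof (intro exI conjI ballI impI)
    show "homog_poly (d + d) (\<lambda>v. g v * g v)" "homog_poly (d + d) (\<lambda>v. f v * g v)"
      using 1 by (auto intro: homog_poly.mult)
  qed (use 1 \<open>f v0 \<noteq> 0\<close> in auto)
qed

lemma local_ring_unit_near:
  assumes "\<phi> \<in> O\<^sub>x" "\<phi> x \<noteq> 0" shows "near (\<lambda>p. \<phi> p \<noteq> 0)"
proof -
  obtain d f g where 1: "homog_poly d f" "homog_poly d g" "g v0 \<noteq> 0"
     "\<forall>v\<in>cone Z. g v \<noteq> 0 \<longrightarrow> \<phi> (line v) = f v / g v" using assms(1) unfolding local_ring_iff by blast
  have "f v0 \<noteq> 0" using 1 base_in_cone assms(2) by auto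
  then have "\<forall>v\<in>cone Z. f v * g v \<noteq> 0 \<longrightarrow> \<phi> (line v) \<noteq> 0" "f v0 * g v0 \<noteq> 0"
    using 1 by auto
  then show ?thesis unfolding near_iff using homog_poly.mult[OF 1(1,2)] by blast
qed

lemma local_ring_germ: 
  assumes "\<phi> \<in> O\<^sub>x" "germ_eq Z x \<phi> \<psi>" shows "\<psi> \<in> O\<^sub>x"
proof -
  obtain d f g where "homog_poly d f" "homog_poly d g"
    "near (\<lambda>p. nonvanishing g p \<and> \<phi> p = ratio f g p)" using assms(1) by (auto simp: local_ring_def)
  moreover from this(3) assms(2) have "near (\<lambda>p. nonvanishing g p \<and> \<psi> p = ratio f g p)"
    unfolding germ_eq_def by eventually_elim auto
  ultimately show ?thesis unfolding local_ring_def by blast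
qed

lemma local_ring_prod_list: "(\<And>u. u \<in> set us \<Longrightarrow> u \<in> O\<^sub>x) \<Longrightarrow> (\<lambda>p. \<Prod>u\<leftarrow>us. u p) \<in> O\<^sub>x"
  by (induction us) (auto intro: local_ring_const local_ring_mult)

lemma max_ideal_iff: "u \<in> max_ideal Z x \<longleftrightarrow> u \<in> O\<^sub>x \<and> u x = 0"
  by (simp add: max_ideal_def)

lemma ideal_power_zero: "(\<lambda>_. 0) \<in> M k"
  unfolding max_ideal_power_def ideal_terms_def mem_Collect_eq
  by (rule bexI[of _ "[]"]) (simp_all add: ideal_value_def[abs_def] germ_eq_refl)

lemma ideal_power_germ: "\<phi> \<in> M k \<Longrightarrow> germ_eq Z x \<phi> \<psi> \<Longrightarrow> \<psi> \<in> M k"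
  unfolding max_ideal_power_def using germ_eq_trans germ_eq_sym by blast

lemma ideal_power_add:
  assumes "\<phi> \<in> M k" "\<psi> \<in> M k" shows "(\<lambda>p. \<phi> p + \<psi> p) \<in> M k"
proof -
  obtain ts where ts: "ts \<in> ideal_terms Z x k" "germ_eq Z x \<phi> (ideal_value ts)"
    using assms by (auto simp: max_ideal_power_def)
  obtain ts' where ts': "ts' \<in> ideal_terms Z x k" "germ_eq Z x \<psi> (ideal_value ts')"
    using assms by (auto simp: max_ideal_power_def)
  have "ts @ ts' \<in> ideal_terms Z x k" using ts ts' by (auto simp: ideal_terms_def)
  moreover have "germ_eq Z x (\<lambda>p. \<phi> p + \<psi> p) (ideal_value (ts @ ts'))"
    using germ_eq_add[OF ts(2) ts'(2)] unfolding ideal_value_def by simp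
  ultimately show ?thesis by (auto simp: max_ideal_power_def)
qed

lemma ideal_power_gen:
  assumes "a \<in> O\<^sub>x" "set us \<subseteq> max_ideal Z x"
  shows "(\<lambda>p. a p * (\<Prod>u\<leftarrow>us. u p)) \<in> M (length us)"
  unfolding max_ideal_power_def mem_Collect_eq
  by (rule bexI[of _ "[(a, us)]"])
    (use assms in \<open>simp_all add: ideal_value_def[abs_def] ideal_terms_def germ_eq_refl\<close>)

text \<open>Lists of terms and equality of germs are dealt with once, here; afterwards facts about
  powers of the maximal ideal go by induction on the number of products.\<close>

lemma ideal_power_induct [consumes 1, case_names germ zero add]:
  assumes "\<phi> \<in> M k"
    and germ: "\<And>\<phi> \<psi>. P \<phi> \<Longrightarrow> germ_eq Z x \<phi> \<psi> \<Longrightarrow> P \<psi>"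
    and zero: "P (\<lambda>_. 0)"
    and add: "\<And>a us \<phi>. a \<in> O\<^sub>x \<Longrightarrow> set us \<subseteq> max_ideal Z x \<Longrightarrow> length us = k \<Longrightarrow> \<phi> \<in> M k \<Longrightarrow> P \<phi> \<Longrightarrow>
       P (\<lambda>p. a p * (\<Prod>u\<leftarrow>us. u p) + \<phi> p)"
  shows "P \<phi>"
proof -
  obtain ts where ts: "ts \<in> ideal_terms Z x k" "germ_eq Z x \<phi> (ideal_value ts)"
    using assms(1) by (auto simp: max_ideal_power_def)
  have "P (ideal_value ts) \<and> ideal_value ts \<in> M k" using ts(1)
  proof (induction ts)
    case Nil
    then show ?case using zero ideal_power_zero by (simp add: ideal_value_def[abs_def])
  next
    case (Cons t ts)
    obtain a us where t: "t = (a, us)" by (cases t)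
    have *: "a \<in> O\<^sub>x" "set us \<subseteq> max_ideal Z x" "length us = k" "ts \<in> ideal_terms Z x k"
      using Cons.prems by (auto simp: ideal_terms_def t)
    have "ideal_value (t # ts) = (\<lambda>p. a p * (\<Prod>u\<leftarrow>us. u p) + ideal_value ts p)"
      by (simp add: ideal_value_def t fun_eq_iff)
    then show ?case
      using add[OF *(1,2,3)] Cons.IH[OF *(4)] ideal_power_add[of _ k "ideal_value ts"] ideal_power_gen[OF *(1,2)] *(3)
      by auto
  qed
  then show ?thesis using germ germ_eq_sym[OF ts(2)] by blast
qed

lemma ideal_power_mult_local:
  assumes "b \<in> O\<^sub>x" "\<phi> \<in> M k" shows "(\<lambda>p. b p * \<phi> p) \<in> M k"
  using assms(2)
proof (induction rule: ideal_power_induct)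
  case (germ \<phi> \<psi>)
  then show ?case using ideal_power_germ germ_eq_mult[OF germ_eq_refl] by blast
next
  case (add a us \<phi>)
  have "(\<lambda>p. (b p * a p) * (\<Prod>u\<leftarrow>us. u p)) \<in> M k"
    using ideal_power_gen[OF local_ring_mult[OF assms(1) add(1)] add(2)] add(3) by simp
  from ideal_power_add[OF this add(5)] show ?case by (simp add: algebra_simps)
qed (simp add: ideal_power_zero)

lemma ideal_power_local: "\<phi> \<in> M k \<Longrightarrow> \<phi> \<in> O\<^sub>x"
proof (induction rule: ideal_power_induct)
  case (add a us \<phi>)
  then have "(\<lambda>p. \<Prod>u\<leftarrow>us. u p) \<in> O\<^sub>x" by (intro local_ring_prod_list) (auto simp: max_ideal_iff)
  then show ?case using add by (intro local_ring_add local_ring_mult)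
qed (auto intro: local_ring_germ local_ring_const)

lemma ideal_power_0: "M 0 = O\<^sub>x"
  using ideal_power_local ideal_power_gen[of _ "[]"] by auto

lemma max_ideal_power_1: "u \<in> max_ideal Z x \<Longrightarrow> u \<in> M 1"
  using ideal_power_gen[of "\<lambda>_. 1" "[u]"] local_ring_const by simp

lemma ideal_power_cmult: "\<phi> \<in> M k \<Longrightarrow> (\<lambda>p. c * \<phi> p) \<in> M k"
  by (rule ideal_power_mult_local[OF local_ring_const])

lemma ideal_power_diff: "\<phi> \<in> M k \<Longrightarrow> \<psi> \<in> M k \<Longrightarrow> (\<lambda>p. \<phi> p - \<psi> p) \<in> M k"
  using ideal_power_add[OF _ ideal_power_cmult[of \<psi> k "- 1"], of \<phi>] by simp

lemma ideal_power_mult: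
  assumes "\<phi> \<in> M j" "\<psi> \<in> M k" shows "(\<lambda>p. \<phi> p * \<psi> p) \<in> M (j + k)"
  using assms(1)
proof (induction rule: ideal_power_induct)
  case (germ \<phi> \<theta>)
  then show ?case using ideal_power_germ germ_eq_mult[OF _ germ_eq_refl] by blast
next
  case (add a us \<phi>)
  have "(\<lambda>p. (a p * (\<Prod>u\<leftarrow>us. u p)) * \<psi> p) \<in> M (j + k)"
    using assms(2)
  proof (induction rule: ideal_power_induct)
    case (germ \<phi> \<theta>)
    show ?case by (rule ideal_power_germ[OF germ(1) germ_eq_mult[OF germ_eq_refl germ(2)]])
  next
    case (add b ws \<psi>')
    have "(\<lambda>p. (a p * b p) * (\<Prod>u\<leftarrow>us @ ws. u p)) \<in> M (j + k)"
      using ideal_power_gen[OF local_ring_mult, of a b "us @ ws"] add \<open>a \<in> O\<^sub>x\<close> \<open>set us \<subseteq> _\<close> \<open>length us = j\<close> by simp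
    from ideal_power_add[OF this add(5)] show ?case by (simp add: algebra_simps)
  qed (simp add: ideal_power_zero)
  from ideal_power_add[OF this add(5)] show ?case by (simp add: algebra_simps)
qed (simp add: ideal_power_zero)

lemma ideal_power_Suc_sub: "\<phi> \<in> M (Suc k) \<Longrightarrow> \<phi> \<in> M k"
proof (induction rule: ideal_power_induct)
  case (add a us \<phi>)
  obtain u ws where us: "us = u # ws" using add(3) by (cases us) auto
  have "(\<lambda>p. (a p * u p) * (\<Prod>u\<leftarrow>ws. u p)) \<in> M (length ws)"
    by (rule ideal_power_gen[OF local_ring_mult]) (use add us in \<open>auto simp: max_ideal_iff\<close>)
  then have "(\<lambda>p. a p * (\<Prod>u\<leftarrow>us. u p)) \<in> M k" using add(3) us by (simp add: mult.assoc)
  from ideal_power_add[OF this add(5)] show ?case .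
qed (auto intro: ideal_power_germ ideal_power_zero)

lemma ideal_power_mono: "j \<le> k \<Longrightarrow> \<phi> \<in> M k \<Longrightarrow> \<phi> \<in> M j"
  by (induction k rule: dec_induct) (auto dest: ideal_power_Suc_sub)

lemma max_ideal_mult: "u \<in> max_ideal Z x \<Longrightarrow> w \<in> max_ideal Z x \<Longrightarrow> (\<lambda>p. u p * w p) \<in> M 2"
  using ideal_power_mult[OF max_ideal_power_1 max_ideal_power_1] by (simp add: numeral_2_eq_2)

lemma local_ring_minus_value: "\<phi> \<in> O\<^sub>x \<Longrightarrow> (\<lambda>p. \<phi> p - \<phi> x) \<in> max_ideal Z x"
  using local_ring_diff[OF _ local_ring_const] by (simp add: max_ideal_iff)

lemma ideal_power_sum: "(\<And>i. i \<in> I \<Longrightarrow> f i \<in> M k) \<Longrightarrow> (\<lambda>p. \<Sum>i\<in>I. f i p) \<in> M k"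
  by (induction I rule: infinite_finite_induct) (auto intro: ideal_power_add ideal_power_zero)

lemma local_ring_sum: "(\<And>i. i \<in> I \<Longrightarrow> f i \<in> O\<^sub>x) \<Longrightarrow> (\<lambda>p. \<Sum>i\<in>I. f i p) \<in> O\<^sub>x"
  using ideal_power_sum[of I f 0] by (simp add: ideal_power_0)

subsection \<open>Tangent vectors and the square of the maximal ideal\<close>

abbreviation "T \<equiv> tangent_space Z x"

lemma tangent_D:
  assumes "D \<in> T" "\<phi> \<in> O\<^sub>x" "\<psi> \<in> O\<^sub>x"
  shows "germ_eq Z x \<phi> \<psi> \<Longrightarrow> D \<phi> = D \<psi>"
    "D (\<lambda>p. \<phi> p + \<psi> p) = D \<phi> + D \<psi>"
    "D (\<lambda>p. c * \<phi> p) = c * D \<phi>"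
    "D (\<lambda>p. \<phi> p * \<psi> p) = \<phi> x * D \<psi> + \<psi> x * D \<phi>"
    "D (\<lambda>p. \<phi> p - \<psi> p) = D \<phi> - D \<psi>"
proof -
  have D: "\<forall>\<phi>\<in>O\<^sub>x. \<forall>\<psi>\<in>O\<^sub>x. germ_eq Z x \<phi> \<psi> \<longrightarrow> D \<phi> = D \<psi>"
    "\<forall>\<phi>\<in>O\<^sub>x. \<forall>\<psi>\<in>O\<^sub>x. D (\<lambda>p. \<phi> p + \<psi> p) = D \<phi> + D \<psi>"
    "\<forall>c. \<forall>\<phi>\<in>O\<^sub>x. D (\<lambda>p. c * \<phi> p) = c * D \<phi>"
    "\<forall>\<phi>\<in>O\<^sub>x. \<forall>\<psi>\<in>O\<^sub>x. D (\<lambda>p. \<phi> p * \<psi> p) = \<phi> x * D \<psi> + \<psi> x * D \<phi>"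
    using assms(1) unfolding tangent_space_def by blast+
  show "germ_eq Z x \<phi> \<psi> \<Longrightarrow> D \<phi> = D \<psi>"
    "D (\<lambda>p. \<phi> p + \<psi> p) = D \<phi> + D \<psi>"
    "D (\<lambda>p. c * \<phi> p) = c * D \<phi>"
    "D (\<lambda>p. \<phi> p * \<psi> p) = \<phi> x * D \<psi> + \<psi> x * D \<phi>"
    using D assms(2,3) by blast+
  have "D (\<lambda>p. \<phi> p + (- 1) * \<psi> p) = D \<phi> + (- 1) * D \<psi>"
    using D(2,3) assms(2,3) local_ring_cmult[OF assms(3), of "- 1"] by metis
  then show "D (\<lambda>p. \<phi> p - \<psi> p) = D \<phi> - D \<psi>" by simp
qed

lemma tangent_const: "D \<in> T \<Longrightarrow> D (\<lambda>_. c) = 0"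
  using tangent_D(4)[of D "\<lambda>_. 1" "\<lambda>_. 1"] tangent_D(3)[of D "\<lambda>_. 1" "\<lambda>_. 1" c]
  by (simp add: local_ring_const)

lemma tangent_outside: "D \<in> T \<Longrightarrow> \<phi> \<notin> O\<^sub>x \<Longrightarrow> D \<phi> = 0"
  unfolding tangent_space_def by blast

text \<open>A linear functional on germs that kills \<open>M 2\<close> but not \<open>u\<close> yields a derivation, because
  \<open>\<phi> \<psi> - \<phi>(x) \<psi>(x)\<close> agrees with \<open>\<phi>(x) (\<psi> - \<psi>(x)) + \<psi>(x) (\<phi> - \<phi>(x))\<close> modulo \<open>M 2\<close>.\<close>

lemma tangent_kernel:
  assumes u: "u \<in> max_ideal Z x" and D: "\<And>D. D \<in> T \<Longrightarrow> D u = 0"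
  shows "u \<in> M 2"
proof (rule ccontr)
  assume nu: "u \<notin> M 2"
  have sub: "fun_space.subspace (M 2)"
    unfolding fun_space.subspace_def
    using ideal_power_zero ideal_power_add ideal_power_cmult by (auto simp: zero_fun_def plus_fun_def)
  obtain lam where lam: "\<And>\<phi> \<psi>. lam (\<phi> + \<psi>) = lam \<phi> + lam \<psi>"
    and scale: "\<And>c \<phi>. lam (\<lambda>p. c * \<phi> p) = c * lam \<phi>"
    and M2: "\<And>\<phi>. \<phi> \<in> M 2 \<Longrightarrow> lam \<phi> = 0" and u1: "lam u = 1"
    using fun_space.separating_functional[OF sub nu] by blast
  have add: "lam (\<lambda>p. \<phi> p + \<psi> p) = lam \<phi> + lam \<psi>" for \<phi> \<psi>
    using lam[of \<phi> \<psi>] by (simp add: plus_fun_def)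
  have M2_eq: "lam \<phi> = lam \<psi>" if "(\<lambda>p. \<phi> p - \<psi> p) \<in> M 2" for \<phi> \<psi>
    using add[of "\<lambda>p. \<phi> p - \<psi> p" \<psi>] M2[OF that] by simp
  define D where "D = (\<lambda>\<phi>. if \<phi> \<in> O\<^sub>x then lam (\<lambda>p. \<phi> p - \<phi> x) else 0)"
  have "D \<in> T"
    unfolding tangent_space_def mem_Collect_eq
  proof (intro conjI ballI allI impI)
    fix \<phi> \<psi> assume O: "\<phi> \<in> O\<^sub>x" "\<psi> \<in> O\<^sub>x"
    show "D (\<lambda>p. \<phi> p + \<psi> p) = D \<phi> + D \<psi>"
      using add[of "\<lambda>p. \<phi> p - \<phi> x" "\<lambda>p. \<psi> p - \<psi> x"] O local_ring_add[OF O]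
      by (simp add: D_def algebra_simps)
    show "D \<phi> = D \<psi>" if g: "germ_eq Z x \<phi> \<psi>"
    proof -
      have "germ_eq Z x (\<lambda>_. 0) (\<lambda>p. (\<phi> p - \<phi> x) - (\<psi> p - \<psi> x))"
        using g germ_eq_x[OF g] unfolding germ_eq_def by (auto elim: eventually_mono)
      then have "(\<lambda>p. (\<phi> p - \<phi> x) - (\<psi> p - \<psi> x)) \<in> M 2" by (rule ideal_power_germ[OF ideal_power_zero])
      from M2_eq[OF this] show ?thesis using O by (simp add: D_def)
    qed
    show "D (\<lambda>p. \<phi> p * \<psi> p) = \<phi> x * D \<psi> + \<psi> x * D \<phi>"
    proof -
      have eq: "(\<lambda>p. (\<phi> p * \<psi> p - \<phi> x * \<psi> x) - (\<phi> x * (\<psi> p - \<psi> x) + \<psi> x * (\<phi> p - \<phi> x)))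
        = (\<lambda>p. (\<phi> p - \<phi> x) * (\<psi> p - \<psi> x))"
        by (auto simp: algebra_simps)
      have "(\<lambda>p. (\<phi> p * \<psi> p - \<phi> x * \<psi> x) - (\<phi> x * (\<psi> p - \<psi> x) + \<psi> x * (\<phi> p - \<phi> x))) \<in> M 2"
        unfolding eq by (intro max_ideal_mult local_ring_minus_value O)
      from M2_eq[OF this] show ?thesis
        using O local_ring_mult[OF O] add[of "\<lambda>p. \<phi> x * (\<psi> p - \<psi> x)" "\<lambda>p. \<psi> x * (\<phi> p - \<phi> x)"]
          scale[of "\<phi> x"  "\<lambda>p. \<psi> p - \<psi> x"] scale[of "\<psi> x"  "\<lambda>p. \<phi> p - \<phi> x"]
        by (simp add: D_def)
    qed
  next
    fix c \<phi> assume O: "\<phi> \<in> O\<^sub>x"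
    show "D (\<lambda>p. c * \<phi> p) = c * D \<phi>"
      using O local_ring_cmult[OF O, of c] scale[of c "\<lambda>p. \<phi> p - \<phi> x"]
      by (simp add: D_def right_diff_distrib)
  qed (simp add: D_def)
  then have "D u = 0" by (rule assms(2))
  moreover have "D u = 1" using u u1 by (simp add: D_def max_ideal_iff)
  ultimately show False by simp
qed

end

subsection \<open>Noetherian subrings\<close>

text \<open>Rings are subsets of one ambient ring rather than types, so that the affine coordinates
  can be adjoined one at a time inside the functions on points.\<close>

definition is_subring :: "'a::comm_ring_1 set \<Rightarrow> bool" where
  "is_subring R \<longleftrightarrow> 0 \<in> R \<and> 1 \<in> R \<and> (\<forall>a\<in>R. \<forall>b\<in>R. a + b \<in> R \<and> a - b \<in> R \<and> a * b \<in> R)"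

definition ring_ideal :: "'a::comm_ring_1 set \<Rightarrow> 'a set \<Rightarrow> bool" where
  "ring_ideal R I \<longleftrightarrow> I \<subseteq> R \<and> 0 \<in> I \<and> (\<forall>a\<in>I. \<forall>b\<in>I. a + b \<in> I) \<and> (\<forall>r\<in>R. \<forall>a\<in>I. r * a \<in> I)"

inductive_set ideal_gen :: "'a::comm_ring_1 set \<Rightarrow> 'a set \<Rightarrow> 'a set" for R F where
  zero: "0 \<in> ideal_gen R F"
| step: "r \<in> R \<Longrightarrow> f \<in> F \<Longrightarrow> g \<in> ideal_gen R F \<Longrightarrow> r * f + g \<in> ideal_gen R F"

definition noetherian :: "'a::comm_ring_1 set \<Rightarrow> bool" where
  "noetherian R \<longleftrightarrow> (\<forall>I. ring_ideal R I \<longrightarrow> (\<exists>F. finite F \<and> F \<subseteq> I \<and> I = ideal_gen R F))"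

lemma noetherianE:
  assumes "noetherian R" "ring_ideal R I"
  obtains F where "finite F" "F \<subseteq> I" "I = ideal_gen R F"
  using assms(1)[unfolded noetherian_def, rule_format, OF assms(2)] by (elim exE conjE)

lemma is_subringD:
  assumes "is_subring R"
  shows "0 \<in> R" "1 \<in> R" "a \<in> R \<Longrightarrow> b \<in> R \<Longrightarrow> a + b \<in> R"
    "a \<in> R \<Longrightarrow> b \<in> R \<Longrightarrow> a - b \<in> R" "a \<in> R \<Longrightarrow> b \<in> R \<Longrightarrow> a * b \<in> R" "a \<in> R \<Longrightarrow> - a \<in> R"
proof -
  show *: "0 \<in> R" "1 \<in> R" "a \<in> R \<Longrightarrow> b \<in> R \<Longrightarrow> a + b \<in> R"
    "\<And>a b. a \<in> R \<Longrightarrow> b \<in> R \<Longrightarrow> a - b \<in> R" "a \<in> R \<Longrightarrow> b \<in> R \<Longrightarrow> a * b \<in> R"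
    using assms by (auto simp: is_subring_def)
  show "a \<in> R \<Longrightarrow> - a \<in> R" using *(4)[of 0 a] *(1) by simp
qed

lemma is_subringI:
  "0 \<in> R \<Longrightarrow> 1 \<in> R \<Longrightarrow> (\<And>a b. a \<in> R \<Longrightarrow> b \<in> R \<Longrightarrow> a + b \<in> R) \<Longrightarrow>
    (\<And>a b. a \<in> R \<Longrightarrow> b \<in> R \<Longrightarrow> a - b \<in> R) \<Longrightarrow> (\<And>a b. a \<in> R \<Longrightarrow> b \<in> R \<Longrightarrow> a * b \<in> R) \<Longrightarrow> is_subring R"
  by (auto simp: is_subring_def)

lemma ideal_gen_subset: "ring_ideal R I \<Longrightarrow> F \<subseteq> I \<Longrightarrow> ideal_gen R F \<subseteq> I"
proof
  fix g assume "ring_ideal R I" "F \<subseteq> I" "g \<in> ideal_gen R F"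
  from this(3,1,2) show "g \<in> I"
    by (induction rule: ideal_gen.induct) (auto simp: ring_ideal_def)
qed

lemma ideal_gen_add: "a \<in> ideal_gen R F \<Longrightarrow> b \<in> ideal_gen R F \<Longrightarrow> a + b \<in> ideal_gen R F"
  by (induction rule: ideal_gen.induct) (auto simp: add.assoc intro: ideal_gen.step)

lemma ideal_gen_mult:
  assumes R: "is_subring R" and r: "r \<in> R" 
  shows "a \<in> ideal_gen R F \<Longrightarrow> r * a \<in> ideal_gen R F"
proof (induction rule: ideal_gen.induct)
  case (step s f g)
  then show ?case
    using ideal_gen.step[OF is_subringD(5)[OF R r step(1)] step(2) step(4)]
    by (simp add: algebra_simps)
qed (auto intro: ideal_gen.zero)

lemma ideal_gen_base:
  assumes "is_subring R" "f \<in> F" shows "f \<in> ideal_gen R F"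
  using ideal_gen.step[OF is_subringD(2)[OF assms(1)] assms(2) ideal_gen.zero] by simp

lemma ideal_gen_mono: "F \<subseteq> G \<Longrightarrow> ideal_gen R F \<subseteq> ideal_gen R G"
proof
  fix g assume "F \<subseteq> G" "g \<in> ideal_gen R F"
  from this(2,1) show "g \<in> ideal_gen R G"
    by (induction rule: ideal_gen.induct) (auto intro: ideal_gen.intros)
qed

lemma ideal_gen_ring_ideal:
  assumes "is_subring R" "F \<subseteq> R" shows "ring_ideal R (ideal_gen R F)"
proof -
  have "g \<in> R" if "g \<in> ideal_gen R F" for g
    using that by (induction rule: ideal_gen.induct) (use assms in \<open>auto simp: is_subringD\<close>)
  then show ?thesis
    unfolding ring_ideal_def using ideal_gen_add ideal_gen_mult[OF assms(1)] ideal_gen.zero by blast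
qed

text \<open>An element involves finitely many of the generators; in the basis theorem this bounds
  how many leading coefficients are needed.\<close>

lemma ideal_gen_range:
  fixes a :: "nat \<Rightarrow> 'a::comm_ring_1"
  shows "b \<in> ideal_gen R (range a) \<Longrightarrow> \<exists>N. b \<in> ideal_gen R (a ` {..<N})"
proof (induction rule: ideal_gen.induct)
  case (step r f g)
  then obtain N i where N: "g \<in> ideal_gen R (a ` {..<N})" "f = a i" by auto
  have "g \<in> ideal_gen R (a ` {..<max N (Suc i)})"
    by (rule subsetD[OF ideal_gen_mono N(1)]) auto
  then have "r * f + g \<in> ideal_gen R (a ` {..<max N (Suc i)})"
    using step(1) N(2) by (intro ideal_gen.step) auto
  then show ?case ..
qed (auto intro: ideal_gen.zero)

definition poly_over :: "'a::comm_ring_1 set \<Rightarrow> 'a poly set" where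
  "poly_over R = {p. \<forall>i. coeff p i \<in> R}"

lemma is_subring_sum: "is_subring R \<Longrightarrow> (\<And>i. i \<in> I \<Longrightarrow> f i \<in> R) \<Longrightarrow> sum f I \<in> R"
  by (induction I rule: infinite_finite_induct) (auto simp: is_subringD)

lemma poly_over_subring: "is_subring R \<Longrightarrow> is_subring (poly_over R)"
  unfolding poly_over_def
  by (rule is_subringI) (auto simp: is_subringD coeff_mult intro!: is_subring_sum)

lemma coeff_monom_mult_shift:
  "degree p \<le> d \<Longrightarrow> coeff (monom r (d - degree p) * p) d = r * lead_coeff p"
  using coeff_monom_mult[of r "d - degree p" p d] by auto

text \<open>Hilbert's basis theorem. A sequence of elements of least degree outside the ideal generated
  by the previous ones has leading coefficients that generate an ideal not finitely generated.\<close>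

lemma noetherian_poly_over:
  assumes R: "is_subring R" and noeth: "noetherian R"
  shows "noetherian (poly_over R)"
  unfolding noetherian_def
proof (intro allI impI)
  let ?P = "poly_over R"
  note P = poly_over_subring[OF R]
  fix I assume I: "ring_ideal ?P I"
  show "\<exists>F. finite F \<and> F \<subseteq> I \<and> I = ideal_gen ?P F"
  proof (rule ccontr)
    assume "\<not> ?thesis"
    then have "\<exists>p. p \<in> I \<and> p \<notin> ideal_gen ?P F" if "finite F" "F \<subseteq> I" for F
      using that ideal_gen_subset[OF I that(2)] by blast
    then have ex: "\<exists>p. (p \<in> I \<and> p \<notin> ideal_gen ?P F) \<and>
        (\<forall>q. q \<in> I \<and> q \<notin> ideal_gen ?P F \<longrightarrow> degree p \<le> degree q)" if "finite F" "F \<subseteq> I" for F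
      using that exists_least_iff[of "\<lambda>n. \<exists>p. p \<in> I \<and> p \<notin> ideal_gen ?P F \<and> degree p = n"]
      by (metis (no_types, lifting) leI)
    define pick where "pick F = (SOME p. (p \<in> I \<and> p \<notin> ideal_gen ?P F) \<and>
        (\<forall>q. q \<in> I \<and> q \<notin> ideal_gen ?P F \<longrightarrow> degree p \<le> degree q))" for F
    have pick: "pick F \<in> I" "pick F \<notin> ideal_gen ?P F"
      "\<And>q. q \<in> I \<Longrightarrow> q \<notin> ideal_gen ?P F \<Longrightarrow> degree (pick F) \<le> degree q" if "finite F" "F \<subseteq> I" for F
      using someI_ex[OF ex[OF that]] unfolding pick_def[symmetric] by auto
    define S where "S = rec_nat {} (\<lambda>_ F. insert (pick F) F)"
    have S_simps: "S 0 = {}" "S (Suc n) = insert (pick (S n)) (S n)" for n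
      by (simp_all add: S_def)
    have S: "finite (S n)" "S n \<subseteq> I" for n
      by (induction n) (auto simp: S_simps intro: pick(1))
    define g where "g n = pick (S n)" for n
    have S_eq: "S n = g ` {..<n}" for n
      by (induction n) (auto simp: S_simps g_def lessThan_Suc)
    have g: "g n \<in> I" "g n \<notin> ideal_gen ?P (S n)"
      "\<And>q. q \<in> I \<Longrightarrow> q \<notin> ideal_gen ?P (S n) \<Longrightarrow> degree (g n) \<le> degree q" for n
      using pick[OF S] unfolding g_def by blast+
    have mono: "degree (g m) \<le> degree (g n)" if "m \<le> n" for m n
    proof -
      have "ideal_gen ?P (S m) \<subseteq> ideal_gen ?P (S n)" using that by (intro ideal_gen_mono) (auto simp: S_eq)
      then show ?thesis using g(1,2)[of n] g(3)[of "g n" m] by blast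
    qed
    define a where "a n = lead_coeff (g n)" for n
    have "g n \<in> ?P" for n using g(1) I by (auto simp: ring_ideal_def)
    then have "range a \<subseteq> R" unfolding a_def poly_over_def by auto
    then have "ring_ideal R (ideal_gen R (range a))" by (rule ideal_gen_ring_ideal[OF R])
    then obtain F where F: "finite F" "F \<subseteq> ideal_gen R (range a)" "ideal_gen R (range a) = ideal_gen R F"
      by (rule noetherianE[OF noeth])
    have "\<forall>f\<in>F. \<exists>N. f \<in> ideal_gen R (a ` {..<N})" using F(2) ideal_gen_range by blast
    then obtain N' where N': "\<And>f. f \<in> F \<Longrightarrow> f \<in> ideal_gen R (a ` {..<N' f})" by metis
    define N where "N = (\<Sum>f\<in>F. N' f)"
    have "F \<subseteq> ideal_gen R (a ` {..<N})"
    proof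
      fix f assume f: "f \<in> F"
      then have "N' f \<le> N" unfolding N_def using F(1) by (intro member_le_sum) auto
      then have "ideal_gen R (a ` {..<N' f}) \<subseteq> ideal_gen R (a ` {..<N})" by (intro ideal_gen_mono) auto
      then show "f \<in> ideal_gen R (a ` {..<N})" using N'[OF f] by blast
    qed
    moreover have "ring_ideal R (ideal_gen R (a ` {..<N}))"
      using \<open>range a \<subseteq> R\<close> by (intro ideal_gen_ring_ideal[OF R]) auto
    ultimately have "ideal_gen R F \<subseteq> ideal_gen R (a ` {..<N})" by (metis ideal_gen_subset)
    then have aN: "a N \<in> ideal_gen R (a ` {..<N})"
      using F(3) ideal_gen_base[OF R, of "a N" "range a"] by auto
    define d where "d = degree (g N)"
    \<comment> \<open>Multiplying each \<open>g i\<close> by a monomial of degree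
      \<open>d - degree (g i)\<close> realizes every combination of the earlier leading coefficients
      as a coefficient in degree \<open>d\<close>. For \<open>b = a N\<close> the difference
      \<open>g N - h\<close> loses its term of degree \<open>d\<close>, against the minimality of
      the degree of \<open>g N\<close>.\<close>
    have "\<exists>h\<in>ideal_gen ?P (S N). coeff h d = b \<and> degree h \<le> d"
      if "b \<in> ideal_gen R (a ` {..<N})" for b
      using that
    proof (induction rule: ideal_gen.induct)
      case (step r f b)
      then obtain h i where h: "h \<in> ideal_gen ?P (S N)" "coeff h d = b" "degree h \<le> d"
        and i: "i < N" "f = a i" by auto
      have di: "degree (g i) \<le> d" using mono i(1) by (simp add: d_def)
      let ?h = "monom r (d - degree (g i)) * g i + h"
      have "monom r (d - degree (g i)) \<in> ?P"
        using step(1) R by (auto simp: poly_over_def is_subringD)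
      then have "?h \<in> ideal_gen ?P (S N)" using h(1) i by (intro ideal_gen.step) (auto simp: S_eq)
      moreover have "coeff ?h d = r * f + b"
        using coeff_monom_mult_shift[OF di, of r] h(2) i by (simp add: a_def)
      moreover have "degree (monom r (d - degree (g i)) * g i) \<le> d"
        using degree_mult_le[of "monom r (d - degree (g i))" "g i"] degree_monom_le[of r "d - degree (g i)"] di
        by linarith
      then have "degree ?h \<le> d" using h(3) by (intro degree_add_le)
      ultimately show ?case by blast
    next
      case zero
      show ?case by (intro bexI[of _ 0]) (auto intro: ideal_gen.zero)
    qed
    from this[OF aN] obtain h where h: "h \<in> ideal_gen ?P (S N)" "coeff h d = a N" "degree h \<le> d" by blast
    have hI: "h \<in> I" using h(1) ideal_gen_subset[OF I S(2)] by blast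
    have q1: "g N - h \<in> I"
    proof -
      have "- 1 \<in> ?P" using P by (simp add: is_subringD)
      then have "g N + (- 1) * h \<in> I" using I g(1) hI unfolding ring_ideal_def by blast
      then show ?thesis by simp
    qed
    have q2: "g N - h \<notin> ideal_gen ?P (S N)"
      using ideal_gen_add[OF _ h(1), of "g N - h"] g(2)[of N] by auto
    have "degree (g N) \<le> degree (g N - h)" by (rule g(3)[OF q1 q2])
    moreover have "degree (g N - h) \<le> d" using h(3) by (intro degree_diff_le) (simp_all add: d_def)
    ultimately have "degree (g N - h) = d" by (simp add: d_def)
    then have "lead_coeff (g N - h) = 0" using h(2) by (simp add: a_def d_def)
    then have "g N - h = 0" by (simp only: leading_coeff_0_iff)
    then show False using q2 ideal_gen.zero by metis
  qed
qed

definition adjoin :: "'a::comm_ring_1 set \<Rightarrow> 'a \<Rightarrow> 'a set" where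
  "adjoin R a = (\<lambda>p. poly p a) ` poly_over R"

lemma adjoin_subring: assumes "is_subring R" shows "is_subring (adjoin R a)"
proof -
  note P = is_subringD[OF poly_over_subring[OF assms]]
  have "poly p a + poly q a \<in> adjoin R a \<and> poly p a - poly q a \<in> adjoin R a \<and> poly p a * poly q a \<in> adjoin R a"
    if "p \<in> poly_over R" "q \<in> poly_over R" for p q
    using P(3-5)[OF that] unfolding adjoin_def poly_add[symmetric] poly_diff[symmetric] poly_mult[symmetric]
    by (intro conjI imageI)
  moreover have "0 \<in> adjoin R a" "1 \<in> adjoin R a"
    using imageI[OF P(1), of "\<lambda>p. poly p a"] imageI[OF P(2), of "\<lambda>p. poly p a"] by (simp_all add: adjoin_def)
  ultimately show ?thesis unfolding is_subring_def by (auto simp: adjoin_def)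
qed

lemma adjoin_superset: "is_subring R \<Longrightarrow> R \<subseteq> adjoin R a"
proof
  fix r assume "is_subring R" "r \<in> R"
  then have "[:r:] \<in> poly_over R" by (auto simp: poly_over_def coeff_pCons is_subringD split: nat.split)
  then show "r \<in> adjoin R a" unfolding adjoin_def by (rule rev_image_eqI) simp
qed

lemma adjoin_mem: "is_subring R \<Longrightarrow> a \<in> adjoin R a"
proof -
  assume "is_subring R"
  then have "[:0, 1:] \<in> poly_over R" by (auto simp: poly_over_def coeff_pCons is_subringD split: nat.split)
  then show ?thesis unfolding adjoin_def by (rule rev_image_eqI) simp
qed

text \<open>An ideal is pulled back along evaluation at \<open>a\<close>; the values at
  \<open>a\<close> of finitely many generators of the pullback generate it.\<close>

lemma noetherian_adjoin:
  assumes R: "is_subring R" and noeth: "noetherian R"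
  shows "noetherian (adjoin R a)"
  unfolding noetherian_def
proof (intro allI impI)
  let ?P = "poly_over R" and ?A = "adjoin R a"
  note P = is_subringD[OF poly_over_subring[OF R]]
  fix I assume I: "ring_ideal ?A I"
  define I' where "I' = {p \<in> ?P. poly p a \<in> I}"
  have "ring_ideal ?P I'"
    unfolding ring_ideal_def
  proof (intro conjI ballI)
    show "0 \<in> I'" using I P(1) by (simp add: I'_def ring_ideal_def)
    show "p + q \<in> I'" if "p \<in> I'" "q \<in> I'" for p q
      using that I P(3) by (simp add: I'_def ring_ideal_def)
    show "r * p \<in> I'" if "r \<in> ?P" "p \<in> I'" for r p
    proof -
      have "poly r a \<in> ?A" using that(1) by (simp add: adjoin_def)
      then show ?thesis using that I P(5) by (simp add: I'_def ring_ideal_def)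
    qed
  qed (auto simp: I'_def)
  then obtain F where F: "finite F" "F \<subseteq> I'" "I' = ideal_gen ?P F"
    by (rule noetherianE[OF noetherian_poly_over[OF R noeth]])
  let ?F = "(\<lambda>p. poly p a) ` F"
  have *: "poly p a \<in> ideal_gen ?A ?F" if "p \<in> ideal_gen ?P F" for p
    using that
  proof (induction rule: ideal_gen.induct)
    case (step r f g)
    have "poly r a * poly f a + poly g a \<in> ideal_gen ?A ?F"
      using step by (intro ideal_gen.step) (auto simp: adjoin_def)
    then show ?case by simp
  qed (simp add: ideal_gen.zero)
  have "I \<subseteq> ideal_gen ?A ?F"
  proof
    fix y assume y: "y \<in> I"
    have "y \<in> ?A" using I y unfolding ring_ideal_def by blast
    then obtain p where p: "p \<in> ?P" "y = poly p a" unfolding adjoin_def by blast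
    then have "p \<in> I'" using y by (simp add: I'_def)
    then have "p \<in> ideal_gen ?P F" using F(3) by simp
    from *[OF this] show "y \<in> ideal_gen ?A ?F" using p(2) by simp
  qed
  moreover have "?F \<subseteq> I" using F(2) unfolding I'_def by blast
  ultimately have "finite ?F \<and> ?F \<subseteq> I \<and> I = ideal_gen ?A ?F"
    using F(1) ideal_gen_subset[OF I, of ?F] by (intro conjI equalityI) simp_all
  then show "\<exists>F. finite F \<and> F \<subseteq> I \<and> I = ideal_gen ?A F" by (rule exI)
qed

text \<open>The union of a chain is an ideal, and its finitely many generators already lie in one
  member. So the union belongs to the family and Zorn's lemma applies.\<close>

lemma noetherian_maximal:
  assumes R: "is_subring R" and noeth: "noetherian R"
    and J: "\<J> \<noteq> {}" "\<And>J. J \<in> \<J> \<Longrightarrow> ring_ideal R J"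
  shows "\<exists>J\<in>\<J>. \<forall>J'\<in>\<J>. J \<subseteq> J' \<longrightarrow> J' = J"
proof (rule subset_Zorn_nonempty[OF J(1)])
  fix C assume C: "C \<noteq> {}" "subset.chain \<J> C"
  have CJ: "C \<subseteq> \<J>" and lin: "\<And>I I'. I \<in> C \<Longrightarrow> I' \<in> C \<Longrightarrow> I \<subseteq> I' \<or> I' \<subseteq> I"
    using C(2) by (auto simp: subset_chain_def)
  have id: "ring_ideal R I" if "I \<in> C" for I using that CJ J(2) by blast
  have "ring_ideal R (\<Union>C)"
    unfolding ring_ideal_def
  proof (intro conjI ballI)
    show "\<Union>C \<subseteq> R" "0 \<in> \<Union>C" using id C(1) unfolding ring_ideal_def by blast+
    show "r * a \<in> \<Union>C" if "r \<in> R" "a \<in> \<Union>C" for r a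
      using that id unfolding ring_ideal_def by blast
    fix a b assume "a \<in> \<Union>C" "b \<in> \<Union>C"
    then obtain I I' where "I \<in> C" "I' \<in> C" "a \<in> I" "b \<in> I'" by blast
    then show "a + b \<in> \<Union>C" using lin[of I I'] id unfolding ring_ideal_def by blast
  qed
  then obtain F where F: "finite F" "F \<subseteq> \<Union>C" "\<Union>C = ideal_gen R F"
    by (rule noetherianE[OF noeth])
  obtain I where I: "I \<in> C" "F \<subseteq> I"
    using finite_subset_Union_chain[OF F(1,2) C] by blast
  have "\<Union>C \<subseteq> I" unfolding F(3) by (rule ideal_gen_subset[OF id[OF I(1)] I(2)])
  then have "\<Union>C = I" using I(1) by blast
  then show "\<Union>C \<in> \<J>" using I(1) CJ by blast
qed

text \<open>A copy of the field, with no ideals except 0 and itself; the coordinates are adjoined to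
  it.\<close>

lemma noetherian_constants:
  "is_subring (range (\<lambda>c (_::'b). c :: complex))" "noetherian (range (\<lambda>c (_::'b). c :: complex))"
proof -
  let ?R = "range (\<lambda>c (_::'b). c :: complex)"
  show R: "is_subring ?R" 
    by (auto simp: is_subring_def zero_fun_def one_fun_def plus_fun_def fun_diff_def times_fun_def)
  show "noetherian ?R"
    unfolding noetherian_def
  proof (intro allI impI)
    fix I assume I: "ring_ideal ?R I"
    show "\<exists>F. finite F \<and> F \<subseteq> I \<and> I = ideal_gen ?R F"
    proof (cases "I = {0}")
      case True
      have "ideal_gen ?R {} \<subseteq> {0}"
        using ideal_gen_subset[OF I, of "{}"] True by simp
      then show ?thesis using True ideal_gen.zero by (intro exI[of _ "{}"]) auto
    next
      case False
      then obtain f where f: "f \<in> I" "f \<noteq> 0" using I by (auto simp: ring_ideal_def)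
      then obtain d where d: "f = (\<lambda>_. d)" using I by (auto simp: ring_ideal_def)
      then have "d \<noteq> 0" using f(2) by (auto simp: zero_fun_def)
      have "I \<subseteq> ideal_gen ?R {f}"
      proof
        fix y assume "y \<in> I"
        then obtain c where "y = (\<lambda>_. c)" using I by (auto simp: ring_ideal_def)
        then have "y = (\<lambda>_. c / d) * f + 0" using d \<open>d \<noteq> 0\<close> by (auto simp: times_fun_def)
        then show "y \<in> ideal_gen ?R {f}" by (metis ideal_gen.intros rangeI singletonI)
      qed
      then show ?thesis using f(1) ideal_gen_subset[OF I, of "{f}"] by (intro exI[of _ "{f}"]) auto
    qed
  qed
qed

text \<open>The form \<open>l0\<close> trivializes the hyperplane bundle near the point: dividing by
  its powers turns forms into functions on the chart, and the normalization makes their values at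
  the point the values of the forms at \<open>v0\<close>.\<close>

locale charted_variety = pointed_variety Z v0 
  for Z :: "('n::finite) ppoint set" and v0 :: "complex ^ 'n" +
  fixes l0 :: "complex ^ 'n \<Rightarrow> complex"
  assumes l0_dual: "l0 \<in> dual_V" and l0_base: "l0 v0 = 1"
begin

lemma l0_power: "homog_poly d (\<lambda>v. l0 v ^ d)"
  using homog_poly_power[OF dual_V_homog[OF l0_dual], of d] by simp

abbreviation dehom :: "nat \<Rightarrow> (complex ^ 'n \<Rightarrow> complex) \<Rightarrow> 'n ppoint \<Rightarrow> complex" where
  "dehom d f \<equiv> ratio f (\<lambda>v. l0 v ^ d)"

lemma dehom_line: "homog_poly d f \<Longrightarrow> v \<noteq> 0 \<Longrightarrow> dehom d f (line v) = f v / l0 v ^ d"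
  by (rule ratio_line[OF _ l0_power])

lemma ratio_l0_line: "l \<in> dual_V \<Longrightarrow> v \<noteq> 0 \<Longrightarrow> ratio l l0 (line v) = l v / l0 v"
  by (rule ratio_line[OF dual_V_homog dual_V_homog[OF l0_dual]])

lemma dehom_local: "homog_poly d f \<Longrightarrow> dehom d f \<in> O\<^sub>x"
  by (rule local_ring_ratio[OF _ l0_power]) (auto simp: l0_base)

lemma ratio_l0_local: "l \<in> dual_V \<Longrightarrow> ratio l l0 \<in> O\<^sub>x"
  by (rule local_ring_ratio[OF dual_V_homog dual_V_homog[OF l0_dual]]) (auto simp: l0_base)

lemma nearI_l0: "(\<And>v. v \<in> cone Z \<Longrightarrow> l0 v \<noteq> 0 \<Longrightarrow> P (line v)) \<Longrightarrow> near P"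
  unfolding near_iff using dual_V_homog[OF l0_dual] l0_base by fastforce

lemma germ_eqI_l0:
  "(\<And>v. v \<in> cone Z \<Longrightarrow> l0 v \<noteq> 0 \<Longrightarrow> \<phi> (line v) = \<psi> (line v)) \<Longrightarrow> germ_eq Z x \<phi> \<psi>"
  unfolding germ_eq_def by (rule nearI_l0)

text \<open>Multiplied by \<open>l0\<close> and by the form cutting out the neighbourhood,
  \<open>f\<close> vanishes on the whole cone; this factor is nonzero at \<open>v0\<close> and
  cancels.\<close>

lemma dehom_germ_zero:
  assumes "homog_poly d f" "germ_eq Z x (dehom d f) (\<lambda>_. 0)" "v \<in> cone Z"
  shows "f v = 0"
proof -
  obtain e g where g: "homog_poly e g" "g v0 \<noteq> 0" "\<And>v. v \<in> cone Z \<Longrightarrow> g v \<noteq> 0 \<Longrightarrow> dehom d f (line v) = 0"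
    using assms(2) unfolding germ_eq_def near_iff by blast
  have "(l0 v * g v) ^ 1 * f v = 0" if "v \<in> cone Z" for v
    using g(3)[OF that] dehom_line[OF assms(1), of v] that by (auto simp: cone_def)
  from variety_power_domain[OF variety homog_poly.mult[OF dual_V_homog[OF l0_dual] g(1)] assms(1) this base_in_cone]
  show ?thesis using assms(3) l0_base g(2) by simp
qed

subsection \<open>The local ring is noetherian\<close>

text \<open>Elements of the local ring have arbitrary values away from the point, so finite
  generation is to be expected only up to equality of germs. The ring \<open>R\<close> generated by
  the coordinates divided by \<open>l0\<close> stands in: every germ is a fraction
  \<open>r / s\<close> of its elements with \<open>s\<close> a unit at the point.\<close>

lemma coordinate_ring:
  obtains R where "is_subring R" "noetherian R" "R \<subseteq> O\<^sub>x"
    "\<And>\<phi>. \<phi> \<in> O\<^sub>x \<Longrightarrow> \<exists>r\<in>R. \<exists>s\<in>R. s x \<noteq> 0 \<and> germ_eq Z x (\<lambda>p. s p * \<phi> p) r"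
proof -
  let ?X = "\<lambda>i :: 'n. ratio (\<lambda>v. v $ i) l0"
  let ?C = "range (\<lambda>c (_ :: 'n ppoint). c :: complex)"
  have "\<exists>R. is_subring R \<and> noetherian R \<and> R \<subseteq> O\<^sub>x \<and> ?C \<subseteq> R \<and> ?X ` S \<subseteq> R" if "finite S" for S
    using that
  proof (induction S)
    case empty
    then show ?case using noetherian_constants local_ring_const by (intro exI[of _ ?C]) auto
  next
    case (insert i S)
    then obtain R where R: "is_subring R" "noetherian R" "R \<subseteq> O\<^sub>x" "?C \<subseteq> R" "?X ` S \<subseteq> R" by blast
    have sub: "poly p a \<in> O\<^sub>x" if "\<And>i. coeff p i \<in> O\<^sub>x" "a \<in> O\<^sub>x" for p a
      using that(1)
    proof (induction p)
      case (pCons c p)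
      have "c \<in> O\<^sub>x" using pCons(3)[of 0] by simp
      moreover have "poly p a \<in> O\<^sub>x" using pCons.prems[of "Suc _"] by (intro pCons.IH) simp
      ultimately have "(\<lambda>q. c q + a q * poly p a q) \<in> O\<^sub>x"
        using that(2) by (intro local_ring_add local_ring_mult)
      then show ?case by (simp add: plus_fun_def times_fun_def)
    qed (use local_ring_const[of 0] in \<open>simp add: zero_fun_def\<close>)
    have "adjoin R (?X i) \<subseteq> O\<^sub>x"
      using sub R(3) ratio_l0_local[OF dual_V_coord] unfolding adjoin_def poly_over_def by blast
    then show ?case
      using adjoin_subring[OF R(1)] noetherian_adjoin[OF R(1,2)] adjoin_superset[OF R(1), of "?X i"]
        adjoin_mem[OF R(1)] R(4,5) by (intro exI[of _ "adjoin R (?X i)"]) auto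
  qed
  from this[of UNIV] obtain R where R: "is_subring R" "noetherian R" "R \<subseteq> O\<^sub>x" "?C \<subseteq> R" "range ?X \<subseteq> R" by auto
  have hom: "\<exists>r\<in>R. \<forall>v\<in>cone Z. l0 v \<noteq> 0 \<longrightarrow> r (line v) = f v / l0 v ^ d" if "homog_poly d f" for d f
    using that
  proof (induction rule: homog_poly.induct)
    case (const c)
    then show ?case using R(4) by (intro bexI[of _ "\<lambda>_. c"]) auto
  next
    case (coord i)
    then show ?case using R(5) ratio_l0_line[OF dual_V_coord]
      by (intro bexI[of _ "?X i"]) (auto simp: cone_def)
  next
    case (add d f g)
    then obtain r s where "r \<in> R" "s \<in> R" "\<forall>v\<in>cone Z. l0 v \<noteq> 0 \<longrightarrow> r (line v) = f v / l0 v ^ d"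
      "\<forall>v\<in>cone Z. l0 v \<noteq> 0 \<longrightarrow> s (line v) = g v / l0 v ^ d" by blast
    then show ?case using is_subringD(3)[OF R(1), of r s]
      by (intro bexI[of _ "r + s"]) (auto simp: add_divide_distrib)
  next
    case (mult d f e g)
    then obtain r s where "r \<in> R" "s \<in> R" "\<forall>v\<in>cone Z. l0 v \<noteq> 0 \<longrightarrow> r (line v) = f v / l0 v ^ d"
      "\<forall>v\<in>cone Z. l0 v \<noteq> 0 \<longrightarrow> s (line v) = g v / l0 v ^ e" by blast
    then show ?case using is_subringD(5)[OF R(1), of r s]
      by (intro bexI[of _ "r * s"]) (auto simp: power_add)
  qed
  have "\<exists>r\<in>R. \<exists>s\<in>R. s x \<noteq> 0 \<and> germ_eq Z x (\<lambda>p. s p * \<phi> p) r" if "\<phi> \<in> O\<^sub>x" for \<phi>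
  proof -
    obtain d f g where fg: "homog_poly d f" "homog_poly d g" "g v0 \<noteq> 0"
       "\<And>v. v \<in> cone Z \<Longrightarrow> g v \<noteq> 0 \<Longrightarrow> \<phi> (line v) = f v / g v" using \<open>\<phi> \<in> O\<^sub>x\<close> unfolding local_ring_iff by blast
    obtain r where r: "r \<in> R" "\<And>v. v \<in> cone Z \<Longrightarrow> l0 v \<noteq> 0 \<Longrightarrow> r (line v) = f v / l0 v ^ d"
      using hom[OF fg(1)] by blast
    obtain s where s: "s \<in> R" "\<And>v. v \<in> cone Z \<Longrightarrow> l0 v \<noteq> 0 \<Longrightarrow> s (line v) = g v / l0 v ^ d"
      using hom[OF fg(2)] by blast
    have "s x \<noteq> 0" using s(2)[OF base_in_cone] l0_base fg(3) by simp
    moreover have "germ_eq Z x (\<lambda>p. s p * \<phi> p) r"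
      unfolding germ_eq_def near_iff
    proof (intro exI conjI ballI impI)
      show "homog_poly (d + 1) (\<lambda>v. g v * l0 v)" using fg(2) dual_V_homog[OF l0_dual] by (intro homog_poly.mult)
      show "g v0 * l0 v0 \<noteq> 0" using fg(3) l0_base by simp
      show "s (line v) * \<phi> (line v) = r (line v)" if "v \<in> cone Z" "g v * l0 v \<noteq> 0" for v
        using that r(2) s(2) fg(4) by simp
    qed
    ultimately show ?thesis using r(1) s(1) by blast
  qed
  then show ?thesis using that R(1-3) by blast
qed

section \<open>Ideals of germs and Krull's intersection theorem\<close>

definition local_ideal :: "('n ppoint \<Rightarrow> complex) set \<Rightarrow> bool" where
  "local_ideal J \<longleftrightarrow> J \<subseteq> O\<^sub>x \<and> (\<lambda>_. 0) \<in> J \<and> (\<forall>\<phi>\<in>J. \<forall>\<psi>\<in>J. (\<lambda>p. \<phi> p + \<psi> p) \<in> J) \<and>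
     (\<forall>a\<in>O\<^sub>x. \<forall>\<phi>\<in>J. (\<lambda>p. a p * \<phi> p) \<in> J) \<and> (\<forall>\<phi>\<in>J. \<forall>\<psi>. germ_eq Z x \<phi> \<psi> \<longrightarrow> \<psi> \<in> J)"

lemma local_idealD:
  assumes "local_ideal J"
  shows "\<phi> \<in> J \<Longrightarrow> \<phi> \<in> O\<^sub>x" "(\<lambda>_. 0) \<in> J" "\<phi> \<in> J \<Longrightarrow> \<psi> \<in> J \<Longrightarrow> (\<lambda>p. \<phi> p + \<psi> p) \<in> J"
    "a \<in> O\<^sub>x \<Longrightarrow> \<phi> \<in> J \<Longrightarrow> (\<lambda>p. a p * \<phi> p) \<in> J" "\<phi> \<in> J \<Longrightarrow> germ_eq Z x \<phi> \<psi> \<Longrightarrow> \<psi> \<in> J"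
  using assms unfolding local_ideal_def by blast+

lemma local_idealI:
  assumes "\<And>\<phi>. \<phi> \<in> J \<Longrightarrow> \<phi> \<in> O\<^sub>x" "(\<lambda>_. 0) \<in> J" "\<And>\<phi> \<psi>. \<phi> \<in> J \<Longrightarrow> \<psi> \<in> J \<Longrightarrow> (\<lambda>p. \<phi> p + \<psi> p) \<in> J"
    "\<And>a \<phi>. a \<in> O\<^sub>x \<Longrightarrow> \<phi> \<in> J \<Longrightarrow> (\<lambda>p. a p * \<phi> p) \<in> J" "\<And>\<phi> \<psi>. \<phi> \<in> J \<Longrightarrow> germ_eq Z x \<phi> \<psi> \<Longrightarrow> \<psi> \<in> J"
  shows "local_ideal J"
  using assms unfolding local_ideal_def by blast

definition colon_ideal :: "('n ppoint \<Rightarrow> complex) set \<Rightarrow> ('n ppoint \<Rightarrow> complex) set \<Rightarrow> ('n ppoint \<Rightarrow> complex) set" where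
  "colon_ideal J S = {c \<in> O\<^sub>x. \<forall>\<phi>\<in>S. (\<lambda>p. c p * \<phi> p) \<in> J}"

lemma colon_ideal:
  assumes J: "local_ideal J" shows "local_ideal (colon_ideal J S)"
proof (rule local_idealI)
  show "(\<lambda>_. 0) \<in> colon_ideal J S"
    using local_ring_const local_idealD(2)[OF J] by (simp add: colon_ideal_def)
next
  fix \<phi> \<psi> assume "\<phi> \<in> colon_ideal J S" "\<psi> \<in> colon_ideal J S"
  then show "(\<lambda>p. \<phi> p + \<psi> p) \<in> colon_ideal J S"
    using local_ring_add local_idealD(3)[OF J] by (auto simp: colon_ideal_def distrib_right)
next
  fix a \<phi> assume "a \<in> O\<^sub>x" "\<phi> \<in> colon_ideal J S"
  then show "(\<lambda>p. a p * \<phi> p) \<in> colon_ideal J S"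
    using local_ring_mult local_idealD(4)[OF J] by (auto simp: colon_ideal_def mult.assoc)
next
  fix \<phi> \<psi> assume *: "\<phi> \<in> colon_ideal J S" "germ_eq Z x \<phi> \<psi>"
  then show "\<psi> \<in> colon_ideal J S"
    using local_ring_germ local_idealD(5)[OF J _ germ_eq_mult[OF *(2) germ_eq_refl]]
    by (auto simp: colon_ideal_def)
qed (simp add: colon_ideal_def)

lemma local_ideal_unit:
  assumes J: "local_ideal J" and s: "s \<in> O\<^sub>x" "s x \<noteq> 0" and "(\<lambda>p. s p * \<phi> p) \<in> J"
  shows "\<phi> \<in> J"
proof -
  have "(\<lambda>p. (1 / s p) * (s p * \<phi> p)) \<in> J"
    by (rule local_idealD(4)[OF J local_ring_inverse[OF s] assms(4)])
  moreover have "germ_eq Z x (\<lambda>p. (1 / s p) * (s p * \<phi> p)) \<phi>"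
    using local_ring_unit_near[OF s] unfolding germ_eq_def by (auto elim: eventually_mono)
  ultimately show ?thesis by (rule local_idealD(5)[OF J])
qed

lemma local_ideal_trace:
  assumes R: "is_subring R" "R \<subseteq> O\<^sub>x" and J: "local_ideal J"
  shows "ring_ideal R (J \<inter> R)"
  unfolding ring_ideal_def
proof (intro conjI ballI)
  show "0 \<in> J \<inter> R" using local_idealD(2)[OF J] is_subringD(1)[OF R(1)] by (simp add: zero_fun_def)
  show "a + b \<in> J \<inter> R" if "a \<in> J \<inter> R" "b \<in> J \<inter> R" for a b
    using local_idealD(3)[OF J, of a b] is_subringD(3)[OF R(1), of a b] that by (simp add: plus_fun_def)
  show "a * b \<in> J \<inter> R" if "a \<in> R" "b \<in> J \<inter> R" for a b
    using local_idealD(4)[OF J, of a b] is_subringD(5)[OF R(1), of a b] that R(2) by (auto simp: times_fun_def)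
qed auto

text \<open>An ideal of germs is determined by its trace on \<open>R\<close>: an element times a
  unit denominator is a germ from \<open>R\<close>. So a member whose trace is maximal is itself
  maximal.\<close>

lemma local_ideal_maximal:
  assumes ne: "\<J> \<noteq> {}" and J: "\<And>J. J \<in> \<J> \<Longrightarrow> local_ideal J"
  shows "\<exists>J\<in>\<J>. \<forall>J'\<in>\<J>. J \<subseteq> J' \<longrightarrow> J' = J"
proof -
  obtain R where R: "is_subring R" "noetherian R" "R \<subseteq> O\<^sub>x"
    and frac: "\<And>\<phi>. \<phi> \<in> O\<^sub>x \<Longrightarrow> \<exists>r\<in>R. \<exists>s\<in>R. s x \<noteq> 0 \<and> germ_eq Z x (\<lambda>p. s p * \<phi> p) r"
    using coordinate_ring by blast
  have "\<exists>I\<in>(\<lambda>J. J \<inter> R) ` \<J>. \<forall>I'\<in>(\<lambda>J. J \<inter> R) ` \<J>. I \<subseteq> I' \<longrightarrow> I' = I"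
    by (rule noetherian_maximal[OF R(1,2)]) (use ne local_ideal_trace[OF R(1,3)] J in auto)
  then obtain J0 where J0: "J0 \<in> \<J>" "\<And>J'. J' \<in> \<J> \<Longrightarrow> J0 \<inter> R \<subseteq> J' \<inter> R \<Longrightarrow> J' \<inter> R = J0 \<inter> R"
    by (auto simp: image_iff)
  have "J' = J0" if J': "J' \<in> \<J>" "J0 \<subseteq> J'" for J'
  proof -
    have "\<phi> \<in> J0" if \<phi>: "\<phi> \<in> J'" for \<phi>
    proof -
      have "\<phi> \<in> O\<^sub>x" using local_idealD(1)[OF J[OF J'(1)] \<phi>] .
      then obtain r s where rs: "r \<in> R" "s \<in> R" "s x \<noteq> 0" "germ_eq Z x (\<lambda>p. s p * \<phi> p) r"
        using frac by blast
      then have "s \<in> O\<^sub>x" using R(3) by blast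
      have "r \<in> J'" using local_idealD(5)[OF J[OF J'(1)] local_idealD(4)[OF J[OF J'(1)] \<open>s \<in> O\<^sub>x\<close> \<phi>] rs(4)] .
      moreover have "J' \<inter> R = J0 \<inter> R" using J0(2)[OF J'(1)] J'(2) by blast
      ultimately have "r \<in> J0" using rs(1) by blast
      then have "(\<lambda>p. s p * \<phi> p) \<in> J0"
        using local_idealD(5)[OF J[OF J0(1)] _ germ_eq_sym[OF rs(4)]] by blast
      then show ?thesis by (rule local_ideal_unit[OF J[OF J0(1)] \<open>s \<in> O\<^sub>x\<close> rs(3)])
    qed
    then show ?thesis using J'(2) by blast
  qed
  then show ?thesis using J0(1) by (intro bexI[of _ J0]) auto
qed

lemma max_ideal_local: "local_ideal (max_ideal Z x)"
proof (rule local_idealI)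
  fix \<phi> \<psi> assume "\<phi> \<in> max_ideal Z x" "germ_eq Z x \<phi> \<psi>"
  then show "\<psi> \<in> max_ideal Z x" using local_ring_germ germ_eq_x by (metis max_ideal_iff)
qed (auto simp: max_ideal_iff local_ring_const local_ring_add local_ring_mult)

text \<open>The trace of the maximal ideal on \<open>R\<close> is finitely generated, and
  denominators are units. The conclusion is stated as a test: to multiply \<open>c\<close> into
  \<open>C\<close> by the whole maximal ideal, finitely many \<open>y\<close> suffice.\<close>

lemma max_ideal_generators:
  obtains F where "finite F" "F \<subseteq> max_ideal Z x"
    "\<And>C c u. local_ideal C \<Longrightarrow> c \<in> O\<^sub>x \<Longrightarrow> (\<And>y. y \<in> F \<Longrightarrow> (\<lambda>p. y p * c p) \<in> C) \<Longrightarrow>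
       u \<in> max_ideal Z x \<Longrightarrow> (\<lambda>p. u p * c p) \<in> C"
proof -
  obtain R where R: "is_subring R" "noetherian R" "R \<subseteq> O\<^sub>x"
    and frac: "\<And>\<phi>. \<phi> \<in> O\<^sub>x \<Longrightarrow> \<exists>r\<in>R. \<exists>s\<in>R. s x \<noteq> 0 \<and> germ_eq Z x (\<lambda>p. s p * \<phi> p) r"
    using coordinate_ring by blast
  obtain F where F: "finite F" "F \<subseteq> max_ideal Z x \<inter> R" "max_ideal Z x \<inter> R = ideal_gen R F"
    using noetherianE[OF R(2) local_ideal_trace[OF R(1,3) max_ideal_local]] by blast
  have "(\<lambda>p. u p * c p) \<in> C" if C: "local_ideal C" "c \<in> O\<^sub>x" "\<And>y. y \<in> F \<Longrightarrow> (\<lambda>p. y p * c p) \<in> C"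
      "u \<in> max_ideal Z x" for C c u
  proof -
    have gen: "(\<lambda>p. r p * c p) \<in> C" if "r \<in> ideal_gen R F" for r
      using that
    proof (induction rule: ideal_gen.induct)
      case (step r f g)
      have "r \<in> O\<^sub>x" using step(1) R(3) by blast
      from local_idealD(3)[OF C(1) local_idealD(4)[OF C(1) this C(3)[OF step(2)]] step(4)]
      have "(\<lambda>p. r p * (f p * c p) + g p * c p) \<in> C" .
      then show ?case by (simp add: algebra_simps)
    qed (use local_idealD(2)[OF C(1)] in simp)
    have "u \<in> O\<^sub>x" using that(4) by (simp add: max_ideal_iff)
    then obtain r s where rs: "r \<in> R" "s \<in> R" "s x \<noteq> 0" "germ_eq Z x (\<lambda>p. s p * u p) r"
      using frac by blast
    then have s: "s \<in> O\<^sub>x" using R(3) by blast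
    have "r \<in> max_ideal Z x"
      using local_idealD(5)[OF max_ideal_local local_idealD(4)[OF max_ideal_local s C(4)] rs(4)] .
    then have "(\<lambda>p. r p * c p) \<in> C" using gen F(3) rs(1) by blast
    moreover have "germ_eq Z x (\<lambda>p. r p * c p) (\<lambda>p. s p * (u p * c p))"
      using rs(4) unfolding germ_eq_def by (auto elim: eventually_mono)
    ultimately have "(\<lambda>p. s p * (u p * c p)) \<in> C" by (rule local_idealD(5)[OF C(1)])
    then show ?thesis by (rule local_ideal_unit[OF C(1) s rs(3)])
  qed
  then show ?thesis using that F(1,2) by blast
qed

text \<open>Choosing \<open>c \<notin> C\<close> with \<open>m c \<subseteq> C\<close> in the stable colon ideal \<open>C = (J : m\<^sup>k)\<close> gives
  \<open>c m\<^sup>k\<^sup>+\<^sup>1 \<subseteq> J\<close>, against stability.\<close>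

lemma ideal_power_subset_of_radical:
  assumes J: "local_ideal J"
    and rad: "\<And>y. y \<in> max_ideal Z x \<Longrightarrow> \<exists>j. (\<lambda>p. y p ^ j) \<in> J"
  obtains k where "M k \<subseteq> J"
proof -
  define C where "C k = colon_ideal J (M k)" for k
  have C: "local_ideal (C k)" for k unfolding C_def by (rule colon_ideal[OF J])
  note C_def = C_def[unfolded colon_ideal_def]
  have "\<exists>B\<in>range C. \<forall>B'\<in>range C. B \<subseteq> B' \<longrightarrow> B' = B"
    by (rule local_ideal_maximal) (use C in auto)
  then obtain k where k: "\<And>k'. C k \<subseteq> C k' \<Longrightarrow> C k' = C k" by auto
  have "C k \<subseteq> C (Suc k)" using ideal_power_Suc_sub by (auto simp: C_def)
  then have stable: "C (Suc k) = C k" by (rule k)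
  obtain F where F: "finite F" "F \<subseteq> max_ideal Z x"
    "\<And>C c u. local_ideal C \<Longrightarrow> c \<in> O\<^sub>x \<Longrightarrow> (\<And>y. y \<in> F \<Longrightarrow> (\<lambda>p. y p * c p) \<in> C) \<Longrightarrow>
       u \<in> max_ideal Z x \<Longrightarrow> (\<lambda>p. u p * c p) \<in> C"
    using max_ideal_generators by blast
  have J_C: "J \<subseteq> C k"
  proof
    fix \<phi> assume "\<phi> \<in> J"
    then have "(\<lambda>p. \<psi> p * \<phi> p) \<in> J" if "\<psi> \<in> M k" for \<psi>
      using local_idealD(4)[OF J ideal_power_local[OF that]] by blast
    then show "\<phi> \<in> C k" using local_idealD(1)[OF J \<open>\<phi> \<in> J\<close>] by (simp add: C_def mult.commute)
  qed
  have "(\<lambda>_. 1) \<in> C k"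
  proof (rule ccontr)
    assume n1: "(\<lambda>_. 1) \<notin> C k"
    \<comment> \<open>One generator at a time: \<open>c\<close> is replaced by the last product
      \<open>y ^ i' * c\<close> still outside \<open>C k\<close>. There is a last one because some
      power of \<open>y\<close> lies in \<open>J\<close>, hence in \<open>C k\<close>.\<close>
    have "\<exists>c. c \<in> O\<^sub>x \<and> c \<notin> C k \<and> (\<forall>y\<in>G. (\<lambda>p. y p * c p) \<in> C k)" if "finite G" "G \<subseteq> max_ideal Z x" for G
      using that
    proof (induction G)
      case empty
      then show ?case using n1 local_ring_const by (intro exI[of _ "\<lambda>_. 1"]) auto
    next
      case (insert y G)
      then obtain c where c: "c \<in> O\<^sub>x" "c \<notin> C k" "\<forall>y\<in>G. (\<lambda>p. y p * c p) \<in> C k" by auto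
      have y: "y \<in> max_ideal Z x" "y \<in> O\<^sub>x" using insert.prems by (auto simp: max_ideal_iff)
      obtain j where j: "(\<lambda>p. y p ^ j) \<in> J" using rad[OF y(1)] by blast
      have yj: "(\<lambda>p. y p ^ i) \<in> O\<^sub>x" for i
        by (induction i) (auto simp: local_ring_const intro: local_ring_mult[OF y(2)])
      let ?P = "\<lambda>i. (\<lambda>p. y p ^ i * c p) \<in> C k"
      have "?P j" using local_idealD(4)[OF C c(1), of "\<lambda>p. y p ^ j" k] j J_C by (auto simp: mult.commute)
      then obtain i where i: "?P i" "\<And>i'. i' < i \<Longrightarrow> \<not> ?P i'"
        using exists_least_iff[of ?P] by blast
      have "i \<noteq> 0" using i(1) c(2) by (cases i) auto
      then obtain i' where i': "i = Suc i'" by (cases i) auto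
      let ?c = "\<lambda>p. y p ^ i' * c p"
      have "?c \<in> O\<^sub>x" "?c \<notin> C k" using local_ring_mult[OF yj c(1)] i(2)[of i'] i' by auto
      moreover have "(\<lambda>p. y p * ?c p) \<in> C k" using i(1) by (simp add: i' mult.assoc)
      moreover have "(\<lambda>p. y' p * ?c p) \<in> C k" if "y' \<in> G" for y'
        using local_idealD(4)[OF C yj[of i'], of "\<lambda>p. y' p * c p" k] c(3) that by (simp add: mult.left_commute)
      ultimately show ?case by (intro exI[of _ ?c]) auto
    qed
    from this[OF F(1,2)] obtain c where c: "c \<in> O\<^sub>x" "c \<notin> C k" "\<forall>y\<in>F. (\<lambda>p. y p * c p) \<in> C k" by blast
    have mc: "(\<lambda>p. u p * c p) \<in> C k" if "u \<in> max_ideal Z x" for u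
      using F(3)[OF C c(1) _ that] c(3) by blast
    have "(\<lambda>p. c p * \<phi> p) \<in> J" if "\<phi> \<in> M (Suc k)" for \<phi>
      using that
    proof (induction rule: ideal_power_induct)
      case (germ \<phi> \<psi>)
      show ?case by (rule local_idealD(5)[OF J germ(1) germ_eq_mult[OF germ_eq_refl germ(2)]])
    next
      case zero
      then show ?case using local_idealD(2)[OF J] by simp
    next
      case (add a us \<phi>)
      obtain u ws where us: "us = u # ws" using add(3) by (cases us) auto
      have "(\<lambda>p. a p * (\<Prod>u\<leftarrow>ws. u p)) \<in> M k" using ideal_power_gen[OF add(1), of ws] add(2,3) us by simp
      moreover have "(\<lambda>p. u p * c p) \<in> C k" using mc add(2) us by simp
      ultimately have "(\<lambda>p. (u p * c p) * (a p * (\<Prod>u\<leftarrow>ws. u p))) \<in> J" by (simp add: C_def)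
      from local_idealD(3)[OF J this add(5)] show ?case by (simp add: us algebra_simps)
    qed
    then have "c \<in> C (Suc k)" using c(1) by (simp add: C_def)
    then show False using stable c(2) by simp
  qed
  then have "M k \<subseteq> J" by (auto simp: C_def)
  then show ?thesis by (rule that)
qed

text \<open>Krull's intersection theorem: an ideal \<open>J\<close> maximal with \<open>J \<inter> (f) = m f\<close> contains a power of
  the maximal ideal \<open>m\<close>, hence \<open>f \<in> m f\<close>.\<close>

theorem krull_intersection:
  assumes f: "\<And>k. f \<in> M k"
  shows "germ_eq Z x f (\<lambda>_. 0)"
proof -
  have fO: "f \<in> O\<^sub>x" using f[of 0] by (simp add: ideal_power_0)
  \<comment> \<open>Up to equality of germs, the product of the maximal ideal with
    \<open>f\<close>.\<close>
  define J0 where "J0 = {\<phi> \<in> O\<^sub>x. \<exists>a\<in>max_ideal Z x. germ_eq Z x \<phi> (\<lambda>p. a p * f p)}"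
  note m = local_idealD[OF max_ideal_local]
  have J0I: "\<phi> \<in> J0" if "\<phi> \<in> O\<^sub>x" "a \<in> max_ideal Z x" "germ_eq Z x \<phi> (\<lambda>p. a p * f p)" for \<phi> a
    using that unfolding J0_def by blast
  have J0: "local_ideal J0"
  proof (rule local_idealI)
    show "(\<lambda>_. 0) \<in> J0" using local_ring_const m(2) germ_eq_refl[of "\<lambda>_. 0"]
      by (auto simp: J0_def intro!: bexI[of _ "\<lambda>_. 0"])
  next
    fix \<phi> \<psi> assume "\<phi> \<in> J0" "\<psi> \<in> J0"
    then obtain a b where ab: "a \<in> max_ideal Z x" "b \<in> max_ideal Z x" "\<phi> \<in> O\<^sub>x" "\<psi> \<in> O\<^sub>x"
      "germ_eq Z x \<phi> (\<lambda>p. a p * f p)" "germ_eq Z x \<psi> (\<lambda>p. b p * f p)" by (auto simp: J0_def)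
    have "germ_eq Z x (\<lambda>p. \<phi> p + \<psi> p) (\<lambda>p. (a p + b p) * f p)"
      using germ_eq_add[OF ab(5,6)] by (simp add: distrib_right)
    then show "(\<lambda>p. \<phi> p + \<psi> p) \<in> J0" by (rule J0I[OF local_ring_add[OF ab(3,4)] m(3)[OF ab(1,2)]])
  next
    fix a \<phi> assume "a \<in> O\<^sub>x" "\<phi> \<in> J0"
    then obtain b where b: "b \<in> max_ideal Z x" "\<phi> \<in> O\<^sub>x" "germ_eq Z x \<phi> (\<lambda>p. b p * f p)"
      by (auto simp: J0_def)
    have "germ_eq Z x (\<lambda>p. a p * \<phi> p) (\<lambda>p. (a p * b p) * f p)"
      using germ_eq_mult[OF germ_eq_refl[of a] b(3)] by (simp add: mult.assoc)
    then show "(\<lambda>p. a p * \<phi> p) \<in> J0"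
      by (rule J0I[OF local_ring_mult[OF \<open>a \<in> O\<^sub>x\<close> b(2)] m(4)[OF \<open>a \<in> O\<^sub>x\<close> b(1)]])
  next
    fix \<phi> \<psi> assume "\<phi> \<in> J0" "germ_eq Z x \<phi> \<psi>"
    then show "\<psi> \<in> J0" unfolding J0_def using local_ring_germ germ_eq_trans germ_eq_sym by blast
  qed (simp add: J0_def)
  define good where "good J \<longleftrightarrow> local_ideal J \<and> J0 \<subseteq> J \<and>
     (\<forall>\<phi>\<in>J. (\<exists>b\<in>O\<^sub>x. germ_eq Z x \<phi> (\<lambda>p. b p * f p)) \<longrightarrow> \<phi> \<in> J0)" for J
  have "good J0" using J0 by (simp add: good_def)
  then have "\<exists>J\<in>Collect good. \<forall>J'\<in>Collect good. J \<subseteq> J' \<longrightarrow> J' = J"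
    by (intro local_ideal_maximal) (auto simp: good_def)
  then obtain J where J: "good J" "\<And>J'. good J' \<Longrightarrow> J \<subseteq> J' \<Longrightarrow> J' = J" by auto
  have Jid: "local_ideal J" and J0J: "J0 \<subseteq> J" using J(1) by (auto simp: good_def)
  note JD = local_idealD[OF Jid]
  have "\<exists>j. (\<lambda>p. y p ^ j) \<in> J" if y: "y \<in> max_ideal Z x" for y
  proof -
    have yO: "y \<in> O\<^sub>x" using y by (simp add: max_ideal_iff)
    have yj: "(\<lambda>p. y p ^ i) \<in> O\<^sub>x" for i
      by (induction i) (auto simp: local_ring_const intro: local_ring_mult[OF yO])
    \<comment> \<open>The ideal of all \<open>c\<close> with \<open>y ^ i * c\<close> in
      \<open>J\<close>. Stability at \<open>j\<close> is what keeps the ideal \<open>J'\<close>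
      generated by \<open>J\<close> and \<open>y ^ j\<close> good, and maximality then puts
      \<open>y ^ j\<close> into \<open>J\<close>.\<close>
    define K where "K i = colon_ideal J {\<lambda>p. y p ^ i}" for i
    have K: "local_ideal (K i)" for i unfolding K_def by (rule colon_ideal[OF Jid])
    have K_def: "K i = {c \<in> O\<^sub>x. (\<lambda>p. y p ^ i * c p) \<in> J}" for i
      by (simp add: K_def colon_ideal_def mult.commute)
    have "\<exists>B\<in>range K. \<forall>B'\<in>range K. B \<subseteq> B' \<longrightarrow> B' = B"
    by (rule local_ideal_maximal) (use K in auto)
  then obtain j where j: "\<And>j'. K j \<subseteq> K j' \<Longrightarrow> K j' = K j" by auto
    have "K j \<subseteq> K (Suc j)"
    proof
      fix c assume "c \<in> K j"
      then show "c \<in> K (Suc j)" using JD(4)[OF yO, of "\<lambda>p. y p ^ j * c p"] by (simp add: K_def mult.assoc)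
    qed
    then have stable: "K (Suc j) = K j" by (rule j)
    define J' where "J' = {\<phi> \<in> O\<^sub>x. \<exists>g\<in>J. \<exists>c\<in>O\<^sub>x. germ_eq Z x \<phi> (\<lambda>p. g p + y p ^ j * c p)}"
    have J'I: "\<phi> \<in> J'" if "\<phi> \<in> O\<^sub>x" "g \<in> J" "c \<in> O\<^sub>x" "germ_eq Z x \<phi> (\<lambda>p. g p + y p ^ j * c p)" for \<phi> g c
      using that unfolding J'_def by blast
    have J': "local_ideal J'"
    proof (rule local_idealI)
      show "(\<lambda>_. 0) \<in> J'" using local_ring_const JD(2) germ_eq_refl[of "\<lambda>_. 0"]
        by (auto simp: J'_def intro!: bexI[of _ "\<lambda>_. 0"])
    next
      fix \<phi> \<psi> assume "\<phi> \<in> J'" "\<psi> \<in> J'"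
      then obtain g h c d where *: "g \<in> J" "h \<in> J" "c \<in> O\<^sub>x" "d \<in> O\<^sub>x" "\<phi> \<in> O\<^sub>x" "\<psi> \<in> O\<^sub>x"
        "germ_eq Z x \<phi> (\<lambda>p. g p + y p ^ j * c p)" "germ_eq Z x \<psi> (\<lambda>p. h p + y p ^ j * d p)" by (auto simp: J'_def)
      have "germ_eq Z x (\<lambda>p. \<phi> p + \<psi> p) (\<lambda>p. (g p + h p) + y p ^ j * (c p + d p))"
        using germ_eq_add[OF *(7,8)] by (simp add: algebra_simps)
      then show "(\<lambda>p. \<phi> p + \<psi> p) \<in> J'"
        by (rule J'I[OF local_ring_add[OF *(5,6)] JD(3)[OF *(1,2)] local_ring_add[OF *(3,4)]])
    next
      fix a \<phi> assume a: "a \<in> O\<^sub>x" and "\<phi> \<in> J'"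
      then obtain g c where *: "g \<in> J" "c \<in> O\<^sub>x" "\<phi> \<in> O\<^sub>x" "germ_eq Z x \<phi> (\<lambda>p. g p + y p ^ j * c p)"
        by (auto simp: J'_def)
      have "germ_eq Z x (\<lambda>p. a p * \<phi> p) (\<lambda>p. (a p * g p) + y p ^ j * (a p * c p))"
        using germ_eq_mult[OF germ_eq_refl[of a] *(4)] by (simp add: algebra_simps)
      then show "(\<lambda>p. a p * \<phi> p) \<in> J'"
        by (rule J'I[OF local_ring_mult[OF a *(3)] JD(4)[OF a *(1)] local_ring_mult[OF a *(2)]])
    next
      fix \<phi> \<psi> assume "\<phi> \<in> J'" "germ_eq Z x \<phi> \<psi>"
      then show "\<psi> \<in> J'" unfolding J'_def using local_ring_germ germ_eq_trans germ_eq_sym by blast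
    qed (simp add: J'_def)
    have JJ': "J \<subseteq> J'"
    proof
      fix \<phi> assume "\<phi> \<in> J"
      moreover have "germ_eq Z x \<phi> (\<lambda>p. \<phi> p + y p ^ j * 0)" by (simp add: germ_eq_refl)
      ultimately show "\<phi> \<in> J'" using JD(1) local_ring_const[of 0] by (intro J'I)
    qed
    \<comment> \<open>Let \<open>\<phi> = g + y ^ j * c\<close> be a multiple of \<open>f\<close>.
      Then \<open>y * \<phi>\<close> lies in \<open>J0\<close>, hence in \<open>J\<close>, so
      \<open>y ^ Suc j * c\<close> does too. Stability lowers the exponent to \<open>j\<close>, and
      \<open>\<phi>\<close> itself lies in \<open>J\<close>.\<close>
    have "good J'"
      unfolding good_def
    proof (intro conjI ballI impI)
      show "J0 \<subseteq> J'" using J0J JJ' by blast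
      fix \<phi> assume "\<phi> \<in> J'" and bf: "\<exists>b\<in>O\<^sub>x. germ_eq Z x \<phi> (\<lambda>p. b p * f p)"
      then obtain g c where *: "g \<in> J" "c \<in> O\<^sub>x" "\<phi> \<in> O\<^sub>x" "germ_eq Z x \<phi> (\<lambda>p. g p + y p ^ j * c p)"
        by (auto simp: J'_def)
      obtain b where b: "b \<in> O\<^sub>x" "germ_eq Z x \<phi> (\<lambda>p. b p * f p)" using bf by blast
      have "germ_eq Z x (\<lambda>p. y p * \<phi> p) (\<lambda>p. (b p * y p) * f p)"
        using germ_eq_mult[OF germ_eq_refl[of y] b(2)] by (simp add: algebra_simps)
      then have "(\<lambda>p. y p * \<phi> p) \<in> J0"
        by (rule J0I[OF local_ring_mult[OF yO *(3)] m(4)[OF b(1) y]])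
      then have y\<phi>: "(\<lambda>p. y p * \<phi> p) \<in> J" using J0J by blast
      have "(\<lambda>p. (- y p) * g p) \<in> J" using JD(4)[OF local_ring_cmult[OF yO, of "- 1"] *(1)] by simp
      from JD(3)[OF y\<phi> this] have "(\<lambda>p. y p * \<phi> p + (- y p) * g p) \<in> J" .
      moreover have "germ_eq Z x (\<lambda>p. y p * \<phi> p + (- y p) * g p) (\<lambda>p. y p ^ Suc j * c p)"
        using *(4) unfolding germ_eq_def by eventually_elim (simp add: algebra_simps)
      ultimately have "(\<lambda>p. y p ^ Suc j * c p) \<in> J" by (rule JD(5))
      then have "c \<in> K (Suc j)" using *(2) by (simp add: K_def)
      then have "c \<in> K j" unfolding stable .
      then have "(\<lambda>p. y p ^ j * c p) \<in> J" by (simp add: K_def)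
      from JD(5)[OF JD(3)[OF *(1) this] germ_eq_sym[OF *(4)]] have "\<phi> \<in> J" .
      then show "\<phi> \<in> J0" using J(1) bf by (simp add: good_def)
    qed (rule J')
    then have "J' = J" using J(2) JJ' by blast
    moreover have "(\<lambda>p. y p ^ j) \<in> J'"
    proof -
      have "germ_eq Z x (\<lambda>p. y p ^ j) (\<lambda>p. 0 + y p ^ j * 1)" by (simp add: germ_eq_refl)
      then show ?thesis by (rule J'I[OF yj JD(2) local_ring_const])
    qed
    ultimately show ?thesis by blast
  qed
  from ideal_power_subset_of_radical[OF Jid this] obtain k where "M k \<subseteq> J" by blast
  then have "f \<in> J" using f by blast
  moreover have "germ_eq Z x f (\<lambda>p. 1 * f p)" by (simp add: germ_eq_refl)
  then have "\<exists>b\<in>O\<^sub>x. germ_eq Z x f (\<lambda>p. b p * f p)" by (rule bexI[OF _ local_ring_const])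
  ultimately have "f \<in> J0" using J(1) by (simp add: good_def)
  then obtain a where a: "a \<in> max_ideal Z x" "germ_eq Z x f (\<lambda>p. a p * f p)" by (auto simp: J0_def)
  \<comment> \<open>From \<open>f = a * f\<close> follows \<open>(1 - a) * f = 0\<close>, where
    \<open>1 - a\<close> is a unit because \<open>a\<close> vanishes at the point.\<close>
  have "(\<lambda>p. 1 - a p) \<in> O\<^sub>x" "1 - a x \<noteq> 0"
    using a(1) local_ring_diff[OF local_ring_const] by (auto simp: max_ideal_iff)
  from local_ring_unit_near[OF this] a(2) show ?thesis
    unfolding germ_eq_def by eventually_elim (auto simp: algebra_simps)
qed

end

subsection \<open>Multiplicative one-parameter groups\<close>

lemma power_sum_eq_0:
  fixes a :: "nat \<Rightarrow> complex"
  assumes "\<And>t. t \<noteq> 0 \<Longrightarrow> (\<Sum>k\<le>M. a k * t ^ k) = 0" "k \<le> M"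
  shows "a k = 0"
proof (rule ccontr)
  assume "a k \<noteq> 0"
  then have "finite {z. (\<Sum>k\<le>M. a k * z ^ k) = 0}" using assms(2) polyfun_finite_roots by blast
  moreover have "- {0} \<subseteq> {z. (\<Sum>k\<le>M. a k * z ^ k) = 0}" using assms(1) by auto
  ultimately have "finite (- {0 :: complex})" using finite_subset by blast
  then have "finite (UNIV :: complex set)" by (metis finite.emptyI finite.insertI finite_Un Compl_partition)
  then show False using infinite_UNIV_char_0 by blast
qed

lemma power_sum_eqD:
  fixes a :: "nat \<Rightarrow> complex"
  assumes "\<And>t. t \<noteq> 0 \<Longrightarrow> (\<Sum>k\<le>M. a k * t ^ k) = (\<Sum>k\<le>M. b k * t ^ k)" "k \<le> M"
  shows "a k = b k"
  using power_sum_eq_0[where M = M and a = "\<lambda>k. a k - b k" and k = k] assms by (simp add: left_diff_distrib sum_subtractf)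

text \<open>The norm reduces this to the reals. It is the reason for acting with
  \<open>t = 2\<close>: distinct weights have distinct eigenvalues.\<close>

lemma two_power_inject:
  assumes "(2 :: complex) ^ j = 2 ^ k" shows "j = k"
proof -
  have "(2 :: real) ^ j = 2 ^ k" using arg_cong[OF assms, of norm] by (simp add: norm_power)
  then show ?thesis using power_inject_exp[of "2 :: real"] by simp
qed

lemma matrix_mult_component: "(A ** B) $ i $ j = (\<Sum>k\<in>UNIV. A $ i $ k * B $ k $ j)"
  by (simp add: matrix_matrix_mult_def)

text \<open>After clearing denominators by \<open>t ^ N\<close> the entries are polynomials, and
  \<open>E k\<close> collects the coefficients of \<open>t ^ k\<close>. Comparing coefficients of
  \<open>s ^ k * t ^ l\<close> in \<open>\<rho> (s * t) = \<rho> s ** \<rho> t\<close> makes the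
  \<open>E k\<close> orthogonal idempotents; \<open>\<rho> 1\<close> gives their sum. The true
  weight is \<open>k - N\<close>.\<close>

lemma one_parameter_decomposition:
  fixes \<rho> :: "complex \<Rightarrow> complex ^ 'n::finite ^ 'n"
  assumes "multiplicative_subgroup \<rho>"
  shows "\<exists>E M N. (\<forall>t v. t \<noteq> 0 \<longrightarrow> t ^ N *s (\<rho> t *v v) = (\<Sum>k\<le>M. t ^ k *s (E k *v v))) \<and>
    (\<forall>k l. E k ** E l = (if k = l then E k else 0)) \<and> (\<forall>v. (\<Sum>k\<le>M. E k *v v) = v) \<and> (\<forall>k>M. E k = 0)"
proof -
  have "\<forall>i j. \<exists>q N. \<forall>t. t \<noteq> 0 \<longrightarrow> \<rho> t $ i $ j = poly q t / t ^ N"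
    and one: "\<rho> 1 = mat 1" and mult: "\<And>s t. s \<noteq> 0 \<Longrightarrow> t \<noteq> 0 \<Longrightarrow> \<rho> (s * t) = \<rho> s ** \<rho> t"
    using assms unfolding multiplicative_subgroup_def by blast+
  then obtain q N' where q: "\<And>i j t. t \<noteq> 0 \<Longrightarrow> \<rho> t $ i $ j = poly (q i j) t / t ^ N' i j" by metis
  define N where "N = (\<Sum>i\<in>UNIV. \<Sum>j\<in>UNIV. N' i j)"
  have N: "N' i j \<le> N" for i j
  proof -
    have "N' i j \<le> (\<Sum>j\<in>UNIV. N' i j)" by (rule member_le_sum) auto
    also have "\<dots> \<le> N" unfolding N_def by (rule member_le_sum[of i UNIV "\<lambda>i. \<Sum>j\<in>UNIV. N' i j"]) auto
    finally show ?thesis .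
  qed
  define Q where "Q i j = q i j * monom 1 (N - N' i j)" for i j
  have Q: "t ^ N * \<rho> t $ i $ j = poly (Q i j) t" if "t \<noteq> 0" for t i j
  proof -
    have "t ^ N = t ^ (N - N' i j) * t ^ N' i j" using N[of i j] by (simp add: power_add[symmetric])
    then show ?thesis using that by (simp add: q Q_def poly_monom)
  qed
  define M where "M = (\<Sum>i\<in>UNIV. \<Sum>j\<in>UNIV. degree (Q i j))"
  have M: "degree (Q i j) \<le> M" for i j
  proof -
    have "degree (Q i j) \<le> (\<Sum>j\<in>UNIV. degree (Q i j))" by (rule member_le_sum) auto
    also have "\<dots> \<le> M" unfolding M_def by (rule member_le_sum[of i UNIV "\<lambda>i. \<Sum>j\<in>UNIV. degree (Q i j)"]) auto
    finally show ?thesis .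
  qed
  define E :: "nat \<Rightarrow> complex ^ 'n ^ 'n" where "E k = (\<chi> i j. coeff (Q i j) k)" for k
  have EM: "E k = 0" if "k > M" for k
  proof -
    have "coeff (Q i j) k = 0" for i j by (rule coeff_eq_0[OF le_less_trans[OF M that]])
    then show ?thesis by (simp add: E_def vec_eq_iff)
  qed
  have exp: "t ^ N * \<rho> t $ i $ j = (\<Sum>k\<le>M. E k $ i $ j * t ^ k)" if "t \<noteq> 0" for t i j
  proof -
    have "poly (Q i j) t = (\<Sum>k\<le>M. coeff (Q i j) k * t ^ k)"
      unfolding poly_altdef using M by (intro sum.mono_neutral_left) (auto simp: coeff_eq_0)
    then show ?thesis using Q[OF that] by (simp add: E_def)
  qed
  have expv: "t ^ N *s (\<rho> t *v v) = (\<Sum>k\<le>M. t ^ k *s (E k *v v))" if "t \<noteq> 0" for t v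
  proof (rule vec_eq_iff[THEN iffD2], rule allI)
    fix i
    have "(t ^ N *s (\<rho> t *v v)) $ i = (\<Sum>j\<in>UNIV. (t ^ N * \<rho> t $ i $ j) * v $ j)"
      by (simp add: matrix_vector_mult_def sum_distrib_left mult.assoc)
    also have "\<dots> = (\<Sum>j\<in>UNIV. \<Sum>k\<le>M. E k $ i $ j * t ^ k * v $ j)"
      by (simp add: exp[OF that] sum_distrib_right)
    also have "\<dots> = (\<Sum>k\<le>M. \<Sum>j\<in>UNIV. E k $ i $ j * t ^ k * v $ j)" by (rule sum.swap)
    also have "\<dots> = (\<Sum>k\<le>M. t ^ k *s (E k *v v)) $ i"
      by (simp add: matrix_vector_mult_def sum_distrib_left mult_ac)
    finally show "(t ^ N *s (\<rho> t *v v)) $ i = (\<Sum>k\<le>M. t ^ k *s (E k *v v)) $ i" .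
  qed
  have E1: "(\<Sum>k\<le>M. E k *v v) = v" for v using expv[of 1 v] by (simp add: one)
  have EE: "E k ** E l = (if k = l then E k else 0)" if "k \<le> M" "l \<le> M" for k l
  proof -
    have "(E k ** E l) $ i $ j = (if k = l then E k else 0) $ i $ j" for i j
    proof -
      \<comment> \<open>Coefficients are compared in \<open>s\<close> with \<open>t\<close> fixed;
        the resulting identity is then compared in \<open>t\<close>.\<close>
      have 1: "E k $ i $ j * t ^ k = (\<Sum>l\<le>M. (E k ** E l) $ i $ j * t ^ l)" if t: "t \<noteq> 0" for t
      proof (rule power_sum_eqD[OF _ \<open>k \<le> M\<close>])
        fix s :: complex assume s: "s \<noteq> 0"
        have "(s * t) ^ N * \<rho> (s * t) $ i $ j = (\<Sum>m\<in>UNIV. (s ^ N * \<rho> s $ i $ m) * (t ^ N * \<rho> t $ m $ j))"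
          using mult[OF s t] by (simp add: matrix_mult_component power_mult_distrib sum_distrib_left mult_ac)
        also have "\<dots> = (\<Sum>m\<in>UNIV. \<Sum>k\<le>M. \<Sum>l\<le>M. (E k $ i $ m * E l $ m $ j) * t ^ l * s ^ k)"
          by (simp add: exp[OF s] exp[OF t] sum_product mult_ac)
        also have "\<dots> = (\<Sum>k\<le>M. \<Sum>l\<le>M. \<Sum>m\<in>UNIV. (E k $ i $ m * E l $ m $ j) * t ^ l * s ^ k)"
          by (subst sum.swap, rule sum.cong[OF refl], rule sum.swap)
        also have "\<dots> = (\<Sum>k\<le>M. (\<Sum>l\<le>M. (E k ** E l) $ i $ j * t ^ l) * s ^ k)"
          by (simp add: matrix_mult_component sum_distrib_right)
        finally show "(\<Sum>k\<le>M. E k $ i $ j * t ^ k * s ^ k) = (\<Sum>k\<le>M. (\<Sum>l\<le>M. (E k ** E l) $ i $ j * t ^ l) * s ^ k)"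
          using exp[of "s * t" i j] s t by (simp add: power_mult_distrib mult_ac)
      qed
      have "(if l = k then E k $ i $ j else 0) = (E k ** E l) $ i $ j"
      proof (rule power_sum_eqD[OF _ \<open>l \<le> M\<close>])
        fix t :: complex assume "t \<noteq> 0"
        have "(\<Sum>l\<le>M. (if l = k then E k $ i $ j else 0) * t ^ l) = (\<Sum>l\<le>M. if l = k then E k $ i $ j * t ^ k else 0)"
          by (rule sum.cong) auto
        also have "\<dots> = E k $ i $ j * t ^ k" using \<open>k \<le> M\<close> by simp
        finally show "(\<Sum>l\<le>M. (if l = k then E k $ i $ j else 0) * t ^ l) = (\<Sum>l\<le>M. (E k ** E l) $ i $ j * t ^ l)"
          using 1[OF \<open>t \<noteq> 0\<close>] by simp
      qed
      then show ?thesis by auto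
    qed
    then show ?thesis by (simp add: vec_eq_iff)
  qed
  have "E k ** E l = (if k = l then E k else 0)" for k l
    using EE[of k l] EM[of k] EM[of l] by (cases "k \<le> M"; cases "l \<le> M") (auto simp: vec_eq_iff matrix_mult_component)
  then show ?thesis using expv E1 EM by (intro exI[of _ E] exI[of _ M] exI[of _ N]) simp
qed

text \<open>Applying \<open>E k\<close> to the eigenvalue equation gives \<open>2 ^ k = c\<close>
  for every nonzero component of \<open>v\<close>, so exactly one component is nonzero.\<close>

lemma fixed_line_weight:
  fixes E :: "nat \<Rightarrow> complex ^ 'n::finite ^ 'n"
  assumes E: "\<And>k l. E k ** E l = (if k = l then E k else 0)" "\<And>v. (\<Sum>k\<le>M. E k *v v) = v"
    and v: "v \<noteq> 0" "(\<Sum>k\<le>M. 2 ^ k *s (E k *v v)) = c *s v"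
  obtains a where "a \<le> M" "E a *v v = v"
proof -
  have EE: "E k *v (E l *v v) = (if k = l then E k *v v else 0)" for k l
    by (simp add: matrix_vector_mul_assoc E(1))
  have "\<exists>a\<le>M. E a *v v \<noteq> 0"
  proof (rule ccontr)
    assume "\<not> ?thesis"
    then have "(\<Sum>k\<le>M. E k *v v) = 0" by simp
    then show False using E(2) v(1) by simp
  qed
  then obtain a where a: "a \<le> M" "E a *v v \<noteq> 0" by blast
  have eig: "2 ^ k *s (E k *v v) = c *s (E k *v v)" if "k \<le> M" for k
  proof -
    have "c *s (E k *v v) = E k *v (\<Sum>l\<le>M. 2 ^ l *s (E l *v v))"
      by (simp add: v(2) vec.scale)
    also have "\<dots> = (\<Sum>l\<le>M. 2 ^ l *s (E k *v (E l *v v)))"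
      by (simp add: vec.sum vec.scale)
    also have "\<dots> = (\<Sum>l\<le>M. if l = k then 2 ^ k *s (E k *v v) else 0)"
      by (rule sum.cong) (auto simp: EE)
    also have "\<dots> = 2 ^ k *s (E k *v v)" using that by simp
    finally show ?thesis by (rule sym)
  qed
  have "c = 2 ^ a" using eig[OF a(1)] a(2) by simp
  then have "E k *v v = 0" if "k \<le> M" "k \<noteq> a" for k
    using eig[OF that(1)] that(2) by (auto dest: two_power_inject)
  then have "(\<Sum>k\<le>M. E k *v v) = (\<Sum>k\<le>M. if k = a then E a *v v else 0)" by (intro sum.cong) auto
  then have "E a *v v = v" using E(2)[of v] a(1) by simp
  then show ?thesis using that a(1) by blast
qed

subsection \<open>Weights of a dilation\<close>

text \<open>One element of the group, with eigenvalue \<open>\<mu>\<close> at \<open>v0\<close> and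
  scalar \<open>c\<close> on the tangent space. As \<open>l0\<close> is an eigenform for the same
  \<open>\<mu>\<close>, the chart is invariant and eigenforms divided by powers of \<open>l0\<close>
  stay eigenfunctions.\<close>

locale scaled_variety = charted_variety Z v0 l0
  for Z :: "('n::finite) ppoint set" and v0 :: "complex ^ 'n" and l0 +
  fixes S :: "complex ^ 'n ^ 'n" and \<mu> c :: complex
  assumes S_inj: "S *v v = 0 \<Longrightarrow> v = 0" and S_Z: "proj_map S ` Z = Z"
    and S_v0: "S *v v0 = \<mu> *s v0" and l0_S: "l0 (S *v v) = \<mu> * l0 v"
    and tangent_scale: "D \<in> T \<Longrightarrow> D (\<phi> \<circ> proj_map S) = c * D \<phi>"
    and nondegenerate: "nondegenerate Z"
begin

abbreviation "h \<equiv> proj_map S"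

lemma \<mu>_nonzero: "\<mu> \<noteq> 0"
  using S_v0 S_inj base(2) by force

lemma h_line: "h (line v) = line (S *v v)"
  by (auto simp: proj_map_def line_def vec.scale image_image)

lemma h_x: "h x = x"
  by (simp add: h_line S_v0 line_scale \<mu>_nonzero)

lemma S_cone: "v \<in> cone Z \<Longrightarrow> S *v v \<in> cone Z"
proof -
  assume "v \<in> cone Z"
  then have "S *v v \<noteq> 0" "h (line v) \<in> Z" using S_inj S_Z by (auto simp: cone_def)
  then show ?thesis by (simp add: cone_def h_line)
qed

lemma near_h: assumes "near P" shows "near (\<lambda>p. P (h p))"
proof -
  obtain d g where g: "homog_poly d g" "g v0 \<noteq> 0" "\<And>v. v \<in> cone Z \<Longrightarrow> g v \<noteq> 0 \<Longrightarrow> P (line v)"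
    using assms unfolding near_iff by blast
  have "g (S *v v0) \<noteq> 0" using g(2) homog_poly_scale[OF g(1)] by (simp add: S_v0 \<mu>_nonzero)
  moreover have "P (h (line v))" if "v \<in> cone Z" "g (S *v v) \<noteq> 0" for v
    using g(3)[OF S_cone[OF that(1)] that(2)] by (simp add: h_line)
  ultimately show ?thesis unfolding near_iff using homog_poly_comp_matrix[OF g(1), of S] by blast
qed

lemma germ_eq_h: "germ_eq Z x \<phi> \<psi> \<Longrightarrow> germ_eq Z x (\<phi> \<circ> h) (\<psi> \<circ> h)"
  unfolding germ_eq_def comp_def by (rule near_h)

lemma local_ring_h: assumes "\<phi> \<in> O\<^sub>x" shows "\<phi> \<circ> h \<in> O\<^sub>x"
proof -
  obtain d f g where fg: "homog_poly d f" "homog_poly d g" "g v0 \<noteq> 0"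
     "\<And>v. v \<in> cone Z \<Longrightarrow> g v \<noteq> 0 \<Longrightarrow> \<phi> (line v) = f v / g v" using assms unfolding local_ring_iff by blast
  have "g (S *v v0) \<noteq> 0" using fg(3) homog_poly_scale[OF fg(2)] by (simp add: S_v0 \<mu>_nonzero)
  moreover have "(\<phi> \<circ> h) (line v) = f (S *v v) / g (S *v v)" if "v \<in> cone Z" "g (S *v v) \<noteq> 0" for v
    using fg(4)[OF S_cone[OF that(1)] that(2)] by (simp add: h_line)
  ultimately show ?thesis
    unfolding local_ring_iff using homog_poly_comp_matrix[OF fg(1), of S] homog_poly_comp_matrix[OF fg(2), of S] by blast
qed

lemma max_ideal_h: "u \<in> max_ideal Z x \<Longrightarrow> u \<circ> h \<in> max_ideal Z x"
  using local_ring_h by (auto simp: max_ideal_iff h_x)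

text \<open>Every tangent vector is scaled by \<open>c\<close> and therefore kills the difference,
  so \<open>tangent_kernel\<close> applies.\<close>

lemma max_ideal_scale: assumes u: "u \<in> max_ideal Z x" shows "(\<lambda>p. u (h p) - c * u p) \<in> M 2"
proof (rule tangent_kernel)
  have O: "u \<in> O\<^sub>x" "u \<circ> h \<in> O\<^sub>x" using u max_ideal_h by (auto simp: max_ideal_iff)
  show "(\<lambda>p. u (h p) - c * u p) \<in> max_ideal Z x"
    using u local_ring_diff[OF O(2) local_ring_cmult[OF O(1), of c]] by (simp add: max_ideal_iff h_x)
  fix D assume D: "D \<in> T"
  have "D (\<lambda>p. (u \<circ> h) p - c * u p) = D (u \<circ> h) - D (\<lambda>p. c * u p)"
    by (rule tangent_D(5)[OF D O(2) local_ring_cmult[OF O(1)]])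
  also have "\<dots> = 0" using tangent_scale[OF D] tangent_D(3)[OF D O(1) O(1)] by simp
  finally show "D (\<lambda>p. u (h p) - c * u p) = 0" by simp
qed

lemma prod_list_power:
  "set us \<subseteq> max_ideal Z x \<Longrightarrow> (\<lambda>p. \<Prod>u\<leftarrow>us. u p) \<in> M (length us)"
  using ideal_power_gen[OF local_ring_const[of 1]] by simp

text \<open>Telescoping: exchanging one factor \<open>u (h p)\<close> for \<open>c * u p\<close>
  leaves an error in \<open>M 2\<close> times the other factors.\<close>

lemma prod_list_scale:
  "set us \<subseteq> max_ideal Z x \<Longrightarrow>
    (\<lambda>p. (\<Prod>u\<leftarrow>us. u (h p)) - c ^ length us * (\<Prod>u\<leftarrow>us. u p)) \<in> M (Suc (length us))"
proof (induction us)
  case (Cons u us)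
  then have u: "u \<in> max_ideal Z x" and us: "set us \<subseteq> max_ideal Z x" by auto
  have P: "(\<lambda>p. \<Prod>u\<leftarrow>us. u (h p)) \<in> M (length us)"
    using prod_list_power[of "map (\<lambda>u. u \<circ> h) us"] us max_ideal_h by (auto simp: comp_def)
  have 1: "(\<lambda>p. (u (h p) - c * u p) * (\<Prod>u\<leftarrow>us. u (h p))) \<in> M (Suc (length (u # us)))"
    using ideal_power_mult[OF max_ideal_scale[OF u] P] by simp
  have 2: "(\<lambda>p. c * (u p * ((\<Prod>u\<leftarrow>us. u (h p)) - c ^ length us * (\<Prod>u\<leftarrow>us. u p)))) \<in> M (Suc (length (u # us)))"
    using ideal_power_cmult[OF ideal_power_mult[OF max_ideal_power_1[OF u] Cons.IH[OF us]]] by simp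
  from ideal_power_add[OF 1 2] show ?case by (simp add: algebra_simps)
qed (simp add: ideal_power_zero)

text \<open>Besides the factors \<open>us\<close>, the coefficient \<open>a\<close> moves as well.
  Since \<open>h\<close> fixes the point, \<open>a (h p) - a p\<close> lies in the maximal ideal and
  is absorbed by the next power.\<close>

lemma ideal_power_scale: "\<phi> \<in> M k \<Longrightarrow> (\<lambda>p. \<phi> (h p) - c ^ k * \<phi> p) \<in> M (Suc k)"
proof (induction rule: ideal_power_induct)
  case (germ \<phi> \<psi>)
  have "germ_eq Z x (\<lambda>p. \<phi> (h p) - c ^ k * \<phi> p) (\<lambda>p. \<psi> (h p) - c ^ k * \<psi> p)"
    using germ(2) germ_eq_h[OF germ(2)] unfolding germ_eq_def by eventually_elim auto
  then show ?case by (rule ideal_power_germ[OF germ(1)])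
next
  case zero
  then show ?case by (simp add: ideal_power_zero)
next
  case (add a us \<phi>)
  have "(\<lambda>p. (a \<circ> h) p - a p) \<in> max_ideal Z x"
    using local_ring_diff[OF local_ring_h[OF add(1)] add(1)] by (simp add: max_ideal_iff h_x)
  then have a: "(\<lambda>p. a (h p) - a p) \<in> M 1" using max_ideal_power_1 by simp
  have 1: "(\<lambda>p. a (h p) * ((\<Prod>u\<leftarrow>us. u (h p)) - c ^ k * (\<Prod>u\<leftarrow>us. u p))) \<in> M (Suc k)"
    using ideal_power_mult_local[OF local_ring_h[OF add(1)] prod_list_scale[OF add(2)]] add(3) by simp
  have 2: "(\<lambda>p. c ^ k * ((a (h p) - a p) * (\<Prod>u\<leftarrow>us. u p))) \<in> M (Suc k)"
    using ideal_power_cmult[OF ideal_power_mult[OF a prod_list_power[OF add(2)]]] add(3) by simp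
  from ideal_power_add[OF ideal_power_add[OF 1 2] add(5)] show ?case by (simp add: algebra_simps)
qed

lemma eigen_step:
  assumes "\<phi> \<in> M k" "germ_eq Z x (\<phi> \<circ> h) (\<lambda>p. r * \<phi> p)" "r \<noteq> c ^ k"
  shows "\<phi> \<in> M (Suc k)"
proof -
  have "germ_eq Z x (\<lambda>p. \<phi> (h p) - c ^ k * \<phi> p) (\<lambda>p. (r - c ^ k) * \<phi> p)"
    using assms(2) unfolding germ_eq_def by eventually_elim (simp add: algebra_simps)
  then have "(\<lambda>p. (r - c ^ k) * \<phi> p) \<in> M (Suc k)" by (rule ideal_power_germ[OF ideal_power_scale[OF assms(1)]])
  from ideal_power_cmult[OF this, of "1 / (r - c ^ k)"] show ?thesis using assms(3) by simp
qed

lemma eigen_power: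
  assumes "germ_eq Z x (\<phi> \<circ> h) (\<lambda>p. r * \<phi> p)"
  shows "j \<le> k \<Longrightarrow> \<phi> \<in> M j \<Longrightarrow> (\<And>i. j \<le> i \<Longrightarrow> i < k \<Longrightarrow> r \<noteq> c ^ i) \<Longrightarrow> \<phi> \<in> M k"
  by (induction k rule: dec_induct) (auto intro: eigen_step[OF _ assms])

text \<open>Eigenvalues are counted relative to \<open>l0\<close>: each of the \<open>d\<close>
  factors in the denominator contributes one \<open>\<mu>\<close>.\<close>

lemma dehom_eigen:
  assumes f: "homog_poly d f" "\<And>v. f (S *v v) = r * f v"
  shows "germ_eq Z x (dehom d f \<circ> h) (\<lambda>p. r / \<mu> ^ d * dehom d f p)"
proof (rule germ_eqI_l0)
  fix v assume v: "v \<in> cone Z"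
  then have "v \<noteq> 0" "S *v v \<noteq> 0" using S_inj by (auto simp: cone_def)
  then show "(dehom d f \<circ> h) (line v) = r / \<mu> ^ d * dehom d f (line v)"
    using dehom_line[OF f(1)] by (simp add: h_line l0_S f(2) power_mult_distrib)
qed

lemma eigen_zero:
  assumes "germ_eq Z x (dehom d f \<circ> h) (\<lambda>p. r * dehom d f p)" "homog_poly d f"
    and "dehom d f \<in> M j" "\<And>k. j \<le> k \<Longrightarrow> r \<noteq> c ^ k" "v \<in> cone Z"
  shows "f v = 0"
proof -
  have "dehom d f \<in> M k" for k
  proof (cases "j \<le> k")
    case True
    then show ?thesis using eigen_power[OF assms(1)] assms(3,4) by blast
  next
    case False
    then show ?thesis using ideal_power_mono[of k j] assms(3) by simp
  qed
  then show ?thesis using dehom_germ_zero[OF assms(2) krull_intersection assms(5)] by blast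
qed

text \<open>This is where nondegeneracy enters: identities of linear forms on the cone become
  identities on \<open>V\<close>.\<close>

lemma dual_zero:
  assumes "l \<in> dual_V" "\<And>v. v \<in> cone Z \<Longrightarrow> l v = 0"
  shows "l v = 0"
proof -
  have "Z \<subseteq> {p \<in> proj_space. \<forall>v\<in>p. l v = 0}"
  proof
    fix p assume p: "p \<in> Z"
    then obtain u where u: "u \<noteq> 0" "p = line u" using Z_sub proj_space_line by blast
    then have "l u = 0" using p assms(2) by (simp add: cone_def)
    then have "\<forall>w\<in>line u. l w = 0" using zeros_line[OF dual_V_homog[OF assms(1)]] by blast
    then show "p \<in> {p \<in> proj_space. \<forall>v\<in>p. l v = 0}" using p u Z_sub by auto
  qed
  then have "l = 0" using nondegenerate assms(1) unfolding nondegenerate_def by blast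
  then show ?thesis by simp
qed

lemma dehom_1: "dehom 1 l = ratio l l0"
  by simp

end

subsection \<open>Dimension of parametrized varieties\<close>

text \<open>Upper bounds for the degree rather than degrees: the graph map mixes degrees, and the
  count of monomials needs only a bound.\<close>

inductive poly_deg :: "nat \<Rightarrow> (complex ^ 'n \<Rightarrow> complex) \<Rightarrow> bool" where
  const: "poly_deg d (\<lambda>_. c)"
| coord: "poly_deg (Suc d) (\<lambda>v. v $ i)"
| add: "poly_deg d f \<Longrightarrow> poly_deg d g \<Longrightarrow> poly_deg d (\<lambda>v. f v + g v)"
| mult: "poly_deg d f \<Longrightarrow> poly_deg e g \<Longrightarrow> poly_deg (d + e) (\<lambda>v. f v * g v)"

lemma poly_deg_mono: "poly_deg d f \<Longrightarrow> d \<le> e \<Longrightarrow> poly_deg e f"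
proof -
  assume "poly_deg d f" "d \<le> e"
  then have "poly_deg (d + (e - d)) (\<lambda>v. f v * 1)" by (intro poly_deg.mult poly_deg.const)
  then show "poly_deg e f" using \<open>d \<le> e\<close> by simp
qed

lemma homog_poly_deg: "homog_poly d f \<Longrightarrow> poly_deg d f"
  by (induction rule: homog_poly.induct) (auto intro: poly_deg.intros poly_deg.coord[of 0, simplified])

lemma poly_deg_sum: "(\<And>i. i \<in> I \<Longrightarrow> poly_deg d (f i)) \<Longrightarrow> poly_deg d (\<lambda>v. \<Sum>i\<in>I. f i v)"
  by (induction I rule: infinite_finite_induct) (auto intro: poly_deg.add poly_deg.const)

lemma poly_deg_cmult: "poly_deg d f \<Longrightarrow> poly_deg d (\<lambda>v. c * f v)"
  using poly_deg.mult[OF poly_deg.const[of 0 c], of d f] by simp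

lemma homog_comp_poly_deg:
  assumes "\<And>i. poly_deg r (\<lambda>w. \<gamma> w $ i)"
  shows "homog_poly d f \<Longrightarrow> poly_deg (d * r) (\<lambda>w. f (\<gamma> w))"
proof (induction rule: homog_poly.induct)
  case (mult d f e g)
  then show ?case by (simp add: add_mult_distrib poly_deg.mult)
qed (auto intro: poly_deg.intros assms)

text \<open>Restriction to a line reduces products of polynomial functions to one variable, where
  nonzero factors have a nonzero product.\<close>

lemma poly_deg_line:
  fixes u w :: "complex ^ 'n::finite"
  shows "poly_deg d f \<Longrightarrow> \<exists>P. \<forall>t. f (u + t *s w) = poly P t"
proof (induction rule: poly_deg.induct)
  case (const d c)
  show ?case by (rule exI[of _ "[:c:]"]) simp
next
  case (coord d i)
  show ?case by (rule exI[of _ "[:u $ i, w $ i:]"]) simp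
next
  case (add d f g)
  then show ?case by (metis poly_add)
next
  case (mult d f e g)
  then show ?case by (metis poly_mult)
qed

lemma fun_span_mult:
  fixes S S' :: "('a \<Rightarrow> complex) set"
  assumes "\<And>f g. f \<in> S \<Longrightarrow> g \<in> S' \<Longrightarrow> (\<lambda>w. f w * g w) \<in> U"
    and f: "f \<in> fun_space.span S" and g: "g \<in> fun_space.span S'"
  shows "(\<lambda>w. f w * g w) \<in> fun_space.span U"
  using f
proof (induction rule: fun_space.span_induct_alt)
  case base
  then show ?case using fun_space.span_zero[of U] by (simp add: zero_fun_def)
next
  case (step c f1 f2)
  have "(\<lambda>w. f1 w * g w) \<in> fun_space.span U" using g
  proof (induction rule: fun_space.span_induct_alt)
    case base
    then show ?case using fun_space.span_zero[of U] by (simp add: zero_fun_def)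
  next
    case (step d g1 g2)
    have "(\<lambda>w. f1 w * g1 w) \<in> fun_space.span U"
      using assms(1)[OF \<open>f1 \<in> S\<close> step(1)] by (rule fun_space.span_base)
    from fun_space.span_add[OF fun_space.span_scale[OF this, of d] step(2)]
    show ?case by (simp add: plus_fun_def algebra_simps)
  qed
  from fun_space.span_add[OF fun_space.span_scale[OF this, of c] step(2)]
  show ?case by (simp add: plus_fun_def algebra_simps)
qed

lemma sum_fun_apply: "(\<Sum>i\<in>I. f i) w = (\<Sum>i\<in>I. f i w :: complex)"
  by (induction I rule: infinite_finite_induct) auto

lemma fun_family_independent:
  fixes \<Phi> :: "'i \<Rightarrow> 'a \<Rightarrow> complex"
  assumes L: "finite L"
    and ind: "\<And>a. (\<And>w. (\<Sum>\<alpha>\<in>L. a \<alpha> * \<Phi> \<alpha> w) = 0) \<Longrightarrow> \<forall>\<alpha>\<in>L. a \<alpha> = 0"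
  shows "inj_on \<Phi> L" "fun_space.independent (\<Phi> ` L)"
proof -
  show inj: "inj_on \<Phi> L"
  proof (rule inj_onI, rule ccontr)
    fix \<alpha> \<beta> assume ab: "\<alpha> \<in> L" "\<beta> \<in> L" "\<Phi> \<alpha> = \<Phi> \<beta>" "\<alpha> \<noteq> \<beta>"
    have "(\<Sum>\<delta>\<in>L. (if \<delta> = \<alpha> then 1 else if \<delta> = \<beta> then - 1 else 0) * \<Phi> \<delta> w) = 0" for w
    proof -
      have "(\<Sum>\<delta>\<in>L. (if \<delta> = \<alpha> then 1 else if \<delta> = \<beta> then - 1 else 0) * \<Phi> \<delta> w)
        = (\<Sum>\<delta>\<in>L. (if \<delta> = \<alpha> then \<Phi> \<alpha> w else 0) + (if \<delta> = \<beta> then - \<Phi> \<beta> w else 0))"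
        using ab(4) by (intro sum.cong) auto
      also have "\<dots> = 0" using ab L by (simp add: sum.distrib)
      finally show ?thesis .
    qed
    from ind[OF this] show False using ab(1) by auto
  qed
  show "fun_space.independent (\<Phi> ` L)"
  proof (rule fun_space.independent_if_scalars_zero)
    fix a \<phi> assume *: "(\<Sum>\<phi>\<in>\<Phi> ` L. (\<lambda>w. a \<phi> * \<phi> w)) = 0" "\<phi> \<in> \<Phi> ` L"
    have "(\<Sum>\<alpha>\<in>L. a (\<Phi> \<alpha>) * \<Phi> \<alpha> w) = 0" for w
      using fun_cong[OF *(1), of w] by (simp add: sum.reindex[OF inj] sum_fun_apply)
    from ind[OF this] show "a \<phi> = 0" using *(2) by auto
  qed (use L in simp)
qed

lemma power_le_imp_exponent_le:
  fixes m n D :: nat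
  assumes "\<And>J. (J + 1) ^ m \<le> (D * J + 1) ^ n"
  shows "m \<le> n"
proof (rule ccontr)
  assume "\<not> m \<le> n"
  \<comment> \<open>Chosen so that the constant factor \<open>(D + 1) ^ n\<close> equals
    \<open>J\<close> itself, which is smaller than the extra factor \<open>J + 1\<close> on the
    left.\<close>
  define J where "J = (D + 1) ^ n"
  have "(J + 1) ^ Suc n \<le> (J + 1) ^ m" using \<open>\<not> m \<le> n\<close> by (intro power_increasing) auto
  also have "\<dots> \<le> (D * J + 1) ^ n" by (rule assms)
  also have "\<dots> \<le> ((D + 1) * (J + 1)) ^ n" by (intro power_mono) auto
  also have "\<dots> = J * (J + 1) ^ n" by (simp only: J_def power_mult_distrib)
  finally show False by simp
qed

text \<open>On \<open>X\<close> the form \<open>f\<close> vanishes, so only the term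
  \<open>j = 0\<close> survives there and \<open>G 0\<close> vanishes on \<open>X\<close>, hence on
  \<open>Y\<close> by hypothesis. What remains is divisible by \<open>f\<close>, which cancels on
  the irreducible \<open>Y\<close>, and the shorter sum is of the same shape. The powers of
  \<open>F\<close> keep the degrees equal.\<close>

lemma graded_sum_zero:
  fixes G :: "nat \<Rightarrow> complex ^ 'n::finite \<Rightarrow> complex"
  assumes X: "projective_variety X" and Y: "projective_variety Y" and XY: "X \<subseteq> Y"
    and f: "homog_poly e f" "\<And>v. v \<in> cone X \<Longrightarrow> f v = 0" "y \<in> cone Y" "f y \<noteq> 0"
    and F: "homog_poly e F" "z \<in> cone X" "F z \<noteq> 0"
  shows "(\<And>j. homog_poly d (G j)) \<Longrightarrow>
    (\<And>j. \<forall>v\<in>cone X. G j v = 0 \<Longrightarrow> \<forall>v\<in>cone Y. G j v = 0) \<Longrightarrow>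
    (\<And>v. v \<in> cone Y \<Longrightarrow> (\<Sum>j\<le>N. f v ^ j * F v ^ (N - j) * G j v) = 0) \<Longrightarrow>
    j \<le> N \<Longrightarrow> \<forall>v\<in>cone X. G j v = 0"
proof (induction N arbitrary: G j)
  case 0
  have "G 0 v = 0" if "v \<in> cone X" for v
    using 0(3)[of v] that XY by (auto simp: cone_def)
  then show ?case using 0(4) by simp
next
  case (Suc N)
  have cone_sub: "v \<in> cone Y" if "v \<in> cone X" for v using that XY by (auto simp: cone_def)
  let ?R = "\<lambda>v. \<Sum>j\<le>N. f v ^ j * F v ^ (N - j) * G (Suc j) v"
  have split: "(\<Sum>j\<le>Suc N. f v ^ j * F v ^ (Suc N - j) * G j v) = F v ^ Suc N * G 0 v + f v * ?R v" for v
    by (subst sum.atMost_Suc_shift) (simp add: sum_distrib_left mult.assoc)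
  have "F v ^ Suc N * G 0 v = 0" if "v \<in> cone X" for v
    using Suc.prems(3)[OF cone_sub[OF that]] split[of v] f(2)[OF that] by simp
  from variety_power_domain[OF X F(1) Suc.prems(1) this F(2,3)]
  have G0: "\<forall>v\<in>cone X. G 0 v = 0" .
  have "f v ^ 1 * ?R v = 0" if "v \<in> cone Y" for v
    using Suc.prems(2)[OF G0] Suc.prems(3)[OF that] split[of v] that by simp
  moreover have "homog_poly (e * N + d) ?R"
  proof (rule homog_poly_sum)
    fix j assume "j \<in> {..N}"
    then have "e * j + e * (N - j) + d = e * N + d" by (simp add: add_mult_distrib2[symmetric])
    moreover have "homog_poly (e * j + e * (N - j) + d) (\<lambda>v. f v ^ j * F v ^ (N - j) * G (Suc j) v)"
      using f(1) F(1) Suc.prems(1) by (intro homog_poly.mult homog_poly_power)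
    ultimately show "homog_poly (e * N + d) (\<lambda>v. f v ^ j * F v ^ (N - j) * G (Suc j) v)" by simp
  qed
  ultimately have R: "\<forall>v\<in>cone Y. ?R v = 0"
    by (intro variety_power_domain[OF Y f(1) _ _ f(3,4)])
  show ?case
  proof (cases j)
    case 0
    then show ?thesis using G0 by simp
  next
    case (Suc i)
    have "\<forall>v\<in>cone X. G (Suc i) v = 0"
      by (rule Suc.IH[of "\<lambda>j. G (Suc j)", OF Suc.prems(1) Suc.prems(2)]) (use Suc.prems(4) R Suc in simp_all)
    then show ?thesis using Suc by simp
  qed
qed

abbreviation words :: "nat \<Rightarrow> nat \<Rightarrow> nat list set" where
  "words m J \<equiv> {\<alpha>. set \<alpha> \<subseteq> {..J} \<and> length \<alpha> = m}"

lemma words_Suc: "words (Suc m) J = (\<lambda>(j, \<alpha>). j # \<alpha>) ` ({..J} \<times> words m J)"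
  by (auto simp: length_Suc_conv image_iff)

lemma sum_words_Suc: "(\<Sum>\<beta>\<in>words (Suc m) J. s \<beta>) = (\<Sum>j\<le>J. \<Sum>\<alpha>\<in>words m J. s (j # \<alpha>))"
proof -
  have "(\<Sum>\<beta>\<in>words (Suc m) J. s \<beta>) = (\<Sum>(j, \<alpha>)\<in>{..J} \<times> words m J. s (j # \<alpha>))"
    unfolding words_Suc by (subst sum.reindex) (auto simp: inj_on_def case_prod_unfold)
  also have "\<dots> = (\<Sum>j\<le>J. \<Sum>\<alpha>\<in>words m J. s (j # \<alpha>))" by (simp add: sum.cartesian_product)
  finally show ?thesis .
qed

text \<open>A lower bound for the Hilbert function of the last member of a chain. The form \<open>f\<close> separates
  \<open>C m\<close> from \<open>C (Suc m)\<close>, and \<open>F\<close> is a power of a coordinate.\<close>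

lemma chain_independent_forms:
  fixes C :: "nat \<Rightarrow> ('n::finite) ppoint set"
  assumes "\<And>i. i \<le> m \<Longrightarrow> projective_variety (C i)" "\<And>i. i < m \<Longrightarrow> C i \<subset> C (Suc i)"
  shows "\<exists>D. \<forall>J. \<exists>g. (\<forall>\<alpha>\<in>words m J. homog_poly (D * J) (g \<alpha>)) \<and>
    (\<forall>a. (\<forall>v\<in>cone (C m). (\<Sum>\<alpha>\<in>words m J. a \<alpha> * g \<alpha> v) = 0) \<longrightarrow> (\<forall>\<alpha>\<in>words m J. a \<alpha> = 0))"
  using assms
proof (induction m)
  case 0
  obtain v where v: "v \<in> cone (C 0)" using cone_nonempty 0(1) by blast
  have w: "words 0 J = {[]}" for J by auto
  show ?case
    unfolding w by (rule exI[of _ 0], rule allI, rule exI[of _ "\<lambda>_ _. 1"]) (use v in \<open>auto intro: homog_poly.const\<close>)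
next
  case (Suc m)
  have "\<exists>D. \<forall>J. \<exists>g. (\<forall>\<alpha>\<in>words m J. homog_poly (D * J) (g \<alpha>)) \<and>
    (\<forall>a. (\<forall>v\<in>cone (C m). (\<Sum>\<alpha>\<in>words m J. a \<alpha> * g \<alpha> v) = 0) \<longrightarrow> (\<forall>\<alpha>\<in>words m J. a \<alpha> = 0))"
    by (rule Suc.IH) (use Suc.prems in auto)
  then obtain D where D: "\<And>J. \<exists>g. (\<forall>\<alpha>\<in>words m J. homog_poly (D * J) (g \<alpha>)) \<and>
    (\<forall>a. (\<forall>v\<in>cone (C m). (\<Sum>\<alpha>\<in>words m J. a \<alpha> * g \<alpha> v) = 0) \<longrightarrow> (\<forall>\<alpha>\<in>words m J. a \<alpha> = 0))" by blast
  have X: "projective_variety (C m)" and Y: "projective_variety (C (Suc m))" and XY: "C m \<subset> C (Suc m)"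
    using Suc.prems by auto
  obtain e f y where f: "homog_poly e f" "\<And>v. v \<in> cone (C m) \<Longrightarrow> f v = 0" "y \<in> cone (C (Suc m))" "f y \<noteq> 0"
    using variety_separate[OF X Y XY] by blast
  obtain z where z: "z \<in> cone (C m)" using cone_nonempty X by blast
  then obtain i where "z $ i \<noteq> 0" by (auto simp: cone_def vec_eq_iff)
  define F where "F = (\<lambda>v :: complex ^ 'n. (v $ i) ^ e)"
  have F: "homog_poly e F" "F z \<noteq> 0"
    using homog_poly_power[OF homog_poly.coord, of e i] \<open>z $ i \<noteq> 0\<close> by (auto simp: F_def)
  show ?case
  proof (rule exI[of _ "e + D"], rule allI)
    fix J
    obtain g where g: "\<And>\<alpha>. \<alpha> \<in> words m J \<Longrightarrow> homog_poly (D * J) (g \<alpha>)"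
      "\<And>a. \<forall>v\<in>cone (C m). (\<Sum>\<alpha>\<in>words m J. a \<alpha> * g \<alpha> v) = 0 \<Longrightarrow> \<forall>\<alpha>\<in>words m J. a \<alpha> = 0"
      using D[of J] by blast
    \<comment> \<open>The head of the word is the exponent of \<open>f\<close>. The power of
      \<open>F\<close> fills up the degree to \<open>e * J\<close>, so all the new forms have degree
      \<open>(e + D) * J\<close>.\<close>
    define g' where "g' \<beta> = (\<lambda>v. f v ^ hd \<beta> * F v ^ (J - hd \<beta>) * g (tl \<beta>) v)" for \<beta>
    show "\<exists>g. (\<forall>\<alpha>\<in>words (Suc m) J. homog_poly ((e + D) * J) (g \<alpha>)) \<and>
      (\<forall>a. (\<forall>v\<in>cone (C (Suc m)). (\<Sum>\<alpha>\<in>words (Suc m) J. a \<alpha> * g \<alpha> v) = 0) \<longrightarrow> (\<forall>\<alpha>\<in>words (Suc m) J. a \<alpha> = 0))"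
    proof (intro exI[of _ g'] conjI allI impI)
      show "\<forall>\<beta>\<in>words (Suc m) J. homog_poly ((e + D) * J) (g' \<beta>)"
      proof
        fix \<beta> assume "\<beta> \<in> words (Suc m) J"
        then obtain j \<alpha> where \<beta>: "\<beta> = j # \<alpha>" "j \<le> J" "\<alpha> \<in> words m J" unfolding words_Suc by auto
        have "homog_poly (e * j + e * (J - j) + D * J) (g' \<beta>)"
          unfolding g'_def \<beta>(1) list.sel using f(1) F(1) g(1)[OF \<beta>(3)] by (intro homog_poly.mult homog_poly_power)
        moreover have "e * j + e * (J - j) + D * J = (e + D) * J"
          using \<beta>(2) by (simp add: add_mult_distrib2[symmetric] add_mult_distrib)
        ultimately show "homog_poly ((e + D) * J) (g' \<beta>)" by simp
      qed
    next
      fix a assume a: "\<forall>v\<in>cone (C (Suc m)). (\<Sum>\<alpha>\<in>words (Suc m) J. a \<alpha> * g' \<alpha> v) = 0"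
      define G where "G j = (\<lambda>v. \<Sum>\<alpha>\<in>words m J. a (j # \<alpha>) * g \<alpha> v)" for j
      have G: "homog_poly (D * J) (G j)" for j
        unfolding G_def using g(1) by (intro homog_poly_sum homog_poly_cmult)
      have GY: "\<forall>v\<in>cone (C (Suc m)). G j v = 0" if "\<forall>v\<in>cone (C m). G j v = 0" for j
      proof -
        have "\<forall>\<alpha>\<in>words m J. a (j # \<alpha>) = 0" using g(2)[of "\<lambda>\<alpha>. a (j # \<alpha>)"] that by (simp add: G_def)
        then show ?thesis by (simp add: G_def)
      qed
      have sum: "(\<Sum>j\<le>J. f v ^ j * F v ^ (J - j) * G j v) = 0" if "v \<in> cone (C (Suc m))" for v
      proof -
        have "(\<Sum>\<beta>\<in>words (Suc m) J. a \<beta> * g' \<beta> v) = (\<Sum>j\<le>J. f v ^ j * F v ^ (J - j) * G j v)"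
          unfolding sum_words_Suc G_def g'_def by (simp add: sum_distrib_left mult_ac)
        then show ?thesis using a that by simp
      qed
      show "\<forall>\<beta>\<in>words (Suc m) J. a \<beta> = 0"
      proof
        fix \<beta> assume "\<beta> \<in> words (Suc m) J"
        then obtain j \<alpha> where \<beta>: "\<beta> = j # \<alpha>" "j \<le> J" "\<alpha> \<in> words m J" unfolding words_Suc by auto
        have "\<forall>v\<in>cone (C m). G j v = 0"
          by (rule graded_sum_zero[OF X Y _ f F(1) z F(2) G GY sum \<beta>(2)]) (use XY in auto)
        then show "a \<beta> = 0" using g(2)[of "\<lambda>\<alpha>. a (j # \<alpha>)"] \<beta> by (simp add: G_def)
      qed
    qed
  qed
qed

text \<open>Monomials in the coordinates of \<open>E1 *v w\<close> with respect to \<open>B\<close>.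
  Each exponent separately is bounded by \<open>d\<close>; this box is larger than necessary, but it
  has the right order of growth.\<close>

lemma restricted_poly_span:
  fixes B :: "(complex ^ 'n::finite) set" and E1 :: "complex ^ 'n ^ 'n"
  assumes B: "vec.independent B" "\<And>v. E1 *v v \<in> vec.span B"
  defines "Mon \<equiv> \<lambda>d. (\<lambda>\<alpha> w. \<Prod>b\<in>B. vec.representation B (E1 *v w) b ^ \<alpha> b) ` (B \<rightarrow>\<^sub>E {..d})"
  shows "finite (Mon d)" "card (Mon d) \<le> Suc d ^ card B"
    "poly_deg d f \<Longrightarrow> (\<lambda>w. f (E1 *v w)) \<in> fun_space.span (Mon d)"
proof -
  have fin: "finite B" using B(1) by (rule vec.finiteI_independent)
  have finP: "finite (B \<rightarrow>\<^sub>E {..d})" by (intro finite_PiE fin) auto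
  show "finite (Mon d)" unfolding Mon_def using finP by (rule finite_imageI)
  show "card (Mon d) \<le> Suc d ^ card B"
    unfolding Mon_def using card_image_le[OF finP] by (simp add: card_PiE[OF fin])
  show "(\<lambda>w. f (E1 *v w)) \<in> fun_space.span (Mon d)" if "poly_deg d f"
    using that
  proof (induction rule: poly_deg.induct)
    case (const d c)
    have "(\<lambda>w. \<Prod>b\<in>B. vec.representation B (E1 *v w) b ^ (\<lambda>b\<in>B. 0) b) \<in> Mon d"
      unfolding Mon_def by (intro imageI) auto
    then have "(\<lambda>w. 1) \<in> Mon d" by simp
    from fun_space.span_scale[OF fun_space.span_base[OF this], of c] show ?case by simp
  next
    case (coord d i)
    have b: "(\<lambda>w. vec.representation B (E1 *v w) b) \<in> Mon (Suc d)" if "b \<in> B" for b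
    proof -
      have "(\<lambda>w. \<Prod>b'\<in>B. vec.representation B (E1 *v w) b' ^ (\<lambda>b'\<in>B. if b' = b then 1 else 0) b') \<in> Mon (Suc d)"
        unfolding Mon_def by (intro imageI) auto
      moreover have "(\<Prod>b'\<in>B. vec.representation B (E1 *v w) b' ^ (\<lambda>b'\<in>B. if b' = b then 1 else 0) b')
         = vec.representation B (E1 *v w) b" for w
      proof -
        have "(\<Prod>b'\<in>B. vec.representation B (E1 *v w) b' ^ (\<lambda>b'\<in>B. if b' = b then 1 else 0) b')
          = (\<Prod>b'\<in>B. if b' = b then vec.representation B (E1 *v w) b' else 1)"
          by (rule prod.cong) auto
        then show ?thesis using fin that by simp
      qed
      ultimately show ?thesis by simp
    qed
    have "(E1 *v w) $ i = (\<Sum>b\<in>B. b $ i * vec.representation B (E1 *v w) b)" for w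
    proof -
      have "E1 *v w = (\<Sum>b\<in>B. vec.representation B (E1 *v w) b *s b)"
        by (rule vec.sum_representation_eq[symmetric, OF B(1) B(2) fin subset_refl])
      from arg_cong[OF this, of "\<lambda>v. v $ i"] show ?thesis by (simp add: mult.commute)
    qed
    moreover have "(\<Sum>b\<in>B. (\<lambda>w. b $ i * vec.representation B (E1 *v w) b)) \<in> fun_space.span (Mon (Suc d))"
      by (intro fun_space.span_sum fun_space.span_scale fun_space.span_base b)
    moreover have "(\<Sum>b\<in>B. (\<lambda>w. b $ i * vec.representation B (E1 *v w) b)) = (\<lambda>w. \<Sum>b\<in>B. b $ i * vec.representation B (E1 *v w) b)"
      by (rule ext) (simp add: sum_fun_apply)
    ultimately show ?case by simp
  next
    case (add d f g)
    from fun_space.span_add[OF add(3,4)] show ?case by (simp add: plus_fun_def)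
  next
    case (mult d f e g)
    have "(\<lambda>w. p w * q w) \<in> Mon (d + e)" if p: "p \<in> Mon d" and q: "q \<in> Mon e" for p q
    proof -
      obtain \<alpha> where \<alpha>: "\<alpha> \<in> B \<rightarrow>\<^sub>E {..d}" "p = (\<lambda>w. \<Prod>b\<in>B. vec.representation B (E1 *v w) b ^ \<alpha> b)"
        using p unfolding Mon_def by blast
      obtain \<beta> where \<beta>: "\<beta> \<in> B \<rightarrow>\<^sub>E {..e}" "q = (\<lambda>w. \<Prod>b\<in>B. vec.representation B (E1 *v w) b ^ \<beta> b)"
        using q unfolding Mon_def by blast
      have "(\<lambda>b\<in>B. \<alpha> b + \<beta> b) \<in> B \<rightarrow>\<^sub>E {..d + e}"
      proof (rule PiE_I)
        fix b assume "b \<in> B"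
        then have "\<alpha> b \<in> {..d}" "\<beta> b \<in> {..e}" using \<alpha>(1) \<beta>(1) by (auto intro: PiE_mem)
        then show "(\<lambda>b\<in>B. \<alpha> b + \<beta> b) b \<in> {..d + e}" using \<open>b \<in> B\<close> by simp
      qed simp
      moreover have "(\<lambda>w. p w * q w) = (\<lambda>w. \<Prod>b\<in>B. vec.representation B (E1 *v w) b ^ (\<lambda>b\<in>B. \<alpha> b + \<beta> b) b)"
        unfolding \<alpha>(2) \<beta>(2) by (simp add: prod.distrib[symmetric] power_add)
      ultimately show ?thesis unfolding Mon_def by blast
    qed
    then show ?case using mult(3,4) by (rule fun_span_mult)
  qed
qed

text \<open>The parameters range over the image of the projection \<open>E1\<close>, a subspace of
  \<open>V\<close> itself, so the same kind of polynomial function serves parameters and ambient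
  space.\<close>

locale parametrization =
  fixes E1 :: "complex ^ 'n::finite ^ 'n" and \<gamma> :: "complex ^ 'n \<Rightarrow> complex ^ 'n" and r :: nat
  assumes idem: "E1 *v (E1 *v v) = E1 *v v"
    and poly: "poly_deg r (\<lambda>w. \<gamma> w $ i)"
    and nz: "\<gamma> (E1 *v w) \<noteq> 0"
begin

definition image_forms :: "(complex ^ 'n \<Rightarrow> complex) set" where
  "image_forms = {f. (\<exists>d. homog_poly d f) \<and> (\<forall>w. f (\<gamma> (E1 *v w)) = 0)}"

definition image_closure :: "'n ppoint set" where
  "image_closure = proj_zeros image_forms"

lemma image_forms_homog: "\<forall>f\<in>image_forms. \<exists>d. homog_poly d f"
  by (simp add: image_forms_def)

lemma line_in_image_closure: "v \<noteq> 0 \<Longrightarrow> line v \<in> image_closure \<longleftrightarrow> (\<forall>f\<in>image_forms. f v = 0)"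
  unfolding image_closure_def by (rule line_in_proj_zeros[OF image_forms_homog])

lemma \<gamma>_in_image_closure: "line (\<gamma> (E1 *v w)) \<in> image_closure"
  using line_in_image_closure[OF nz] by (simp add: image_forms_def)

text \<open>If both closed pieces were proper, a form \<open>f\<close> vanishing on one and a form
  \<open>g\<close> vanishing on the other would each be nonzero somewhere on the image, with product
  zero along it. On the line joining the two parameters these are two nonzero polynomials in one
  variable with product zero.\<close>

lemma image_closure_variety: "projective_variety image_closure"
  unfolding projective_variety_def
proof (intro conjI allI impI)
  show "closedin zariski image_closure"
    unfolding closedin_zariski image_closure_def using image_forms_homog by blast
  show "image_closure \<noteq> {}" using \<gamma>_in_image_closure by blast
  fix A B assume AB: "closedin zariski A \<and> closedin zariski B \<and> image_closure = A \<union> B"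
  show "image_closure = A \<or> image_closure = B"
  proof (rule ccontr)
    assume neq: "\<not> ?thesis"
    have ex: "\<exists>f d u. homog_poly d f \<and> (\<forall>v. v \<noteq> 0 \<longrightarrow> line v \<in> A \<longrightarrow> f v = 0) \<and> f (\<gamma> (E1 *v u)) \<noteq> 0"
      if A: "closedin zariski A" "A \<subseteq> image_closure" "A \<noteq> image_closure" for A
    proof -
      obtain SA where SA: "\<forall>f\<in>SA. \<exists>d. homog_poly d f" "A = proj_zeros SA"
        using A(1) unfolding closedin_zariski by blast
      obtain p where p: "p \<in> image_closure" "p \<notin> A" using A by blast
      have "p \<in> proj_space" using p(1) by (simp add: image_closure_def proj_zeros_def)
      then obtain v where v: "v \<noteq> 0" "p = line v" using proj_space_line by blast
      then obtain f where f: "f \<in> SA" "f v \<noteq> 0"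
        using p(2) line_in_proj_zeros[OF SA(1) v(1)] SA(2) by blast
      then obtain d where d: "homog_poly d f" using SA(1) by blast
      have "f \<notin> image_forms" using p(1) v f(2) line_in_image_closure by blast
      then obtain u where "f (\<gamma> (E1 *v u)) \<noteq> 0" using d unfolding image_forms_def by blast
      moreover have "f v = 0" if "v \<noteq> 0" "line v \<in> A" for v
        using that f(1) line_in_proj_zeros[OF SA(1)] SA(2) by blast
      ultimately show ?thesis using d by blast
    qed
    obtain f d u where f: "homog_poly d f" "\<And>v. v \<noteq> 0 \<Longrightarrow> line v \<in> A \<Longrightarrow> f v = 0" "f (\<gamma> (E1 *v u)) \<noteq> 0"
      using ex[of A] AB neq by blast
    obtain g e w where g: "homog_poly e g" "\<And>v. v \<noteq> 0 \<Longrightarrow> line v \<in> B \<Longrightarrow> g v = 0" "g (\<gamma> (E1 *v w)) \<noteq> 0"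
      using ex[of B] AB neq by blast
    have zero: "f (\<gamma> (E1 *v y)) * g (\<gamma> (E1 *v y)) = 0" for y
      using \<gamma>_in_image_closure[of y] AB f(2)[OF nz] g(2)[OF nz] by (metis Un_iff mult_eq_0_iff)
    obtain P where P: "\<And>t. f (\<gamma> (E1 *v u + t *s (E1 *v w - E1 *v u))) = poly P t"
      using poly_deg_line[OF homog_comp_poly_deg[OF poly f(1)]] by blast
    obtain Q where Q: "\<And>t. g (\<gamma> (E1 *v u + t *s (E1 *v w - E1 *v u))) = poly Q t"
      using poly_deg_line[OF homog_comp_poly_deg[OF poly g(1)]] by blast
    have "poly (P * Q) t = 0" for t
    proof -
      have "E1 *v u + t *s (E1 *v w - E1 *v u) = E1 *v (u + t *s (w - u))"
        by (simp add: vec.add vec.scale vec.diff)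
      then show ?thesis using zero[of "u + t *s (w - u)"] P[of t] Q[of t] by simp
    qed
    then have "P * Q = 0" using poly_all_0_iff_0 by blast
    moreover have "poly P 0 \<noteq> 0" using P[of 0] f(3) by simp
    moreover have "poly Q 1 \<noteq> 0" using Q[of 1] g(3) by simp
    ultimately show False by auto
  qed
qed

text \<open>A chain of length \<open>m\<close> yields \<open>(J + 1) ^ m\<close> forms of degree
  \<open>D * J\<close>, independent on \<open>C m\<close>. They stay independent after composition
  with \<open>\<gamma>\<close>, since a form vanishing on the image vanishes on its closure. Their
  number is thus at most the number of monomials of exponents up to \<open>D * J * r\<close>; growth
  in \<open>J\<close> compares the exponents.\<close>

lemma chain_length_le:
  assumes "\<And>i. i \<le> m \<Longrightarrow> projective_variety (C i)" "\<And>i. i < m \<Longrightarrow> C i \<subset> C (Suc i)"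
    and sub: "C m \<subseteq> image_closure"
  shows "m \<le> vec.dim (range ((*v) E1))"
proof -
  obtain B where B: "B \<subseteq> range ((*v) E1)" "vec.independent B" "range ((*v) E1) \<subseteq> vec.span B" "card B = vec.dim (range ((*v) E1))"
    using vec.basis_exists by blast
  have EB: "E1 *v v \<in> vec.span B" for v using B(3) by blast
  obtain D where D: "\<And>J. \<exists>g. (\<forall>\<alpha>\<in>words m J. homog_poly (D * J) (g \<alpha>)) \<and>
    (\<forall>a. (\<forall>v\<in>cone (C m). (\<Sum>\<alpha>\<in>words m J. a \<alpha> * g \<alpha> v) = 0) \<longrightarrow> (\<forall>\<alpha>\<in>words m J. a \<alpha> = 0))"
    using chain_independent_forms[of m C] assms(1,2) by blast
  have "(J + 1) ^ m \<le> (D * r * J + 1) ^ card B" for J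
  proof -
    obtain g where g: "\<And>\<alpha>. \<alpha> \<in> words m J \<Longrightarrow> homog_poly (D * J) (g \<alpha>)"
      "\<And>a. \<forall>v\<in>cone (C m). (\<Sum>\<alpha>\<in>words m J. a \<alpha> * g \<alpha> v) = 0 \<Longrightarrow> \<forall>\<alpha>\<in>words m J. a \<alpha> = 0"
      using D[of J] by blast
    let ?d = "D * J * r"
    let ?Mon = "(\<lambda>\<alpha> w. \<Prod>b\<in>B. vec.representation B (E1 *v w) b ^ \<alpha> b) ` (B \<rightarrow>\<^sub>E {..?d})"
    let ?\<Phi> = "\<lambda>\<alpha> w. g \<alpha> (\<gamma> (E1 *v w))"
    have fin: "finite (words m J)" by (rule finite_lists_length_eq) simp
    have ind: "\<forall>\<alpha>\<in>words m J. a \<alpha> = 0" if a: "\<And>w. (\<Sum>\<alpha>\<in>words m J. a \<alpha> * ?\<Phi> \<alpha> w) = 0" for a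
    proof (rule g(2), rule ballI)
      fix v assume v: "v \<in> cone (C m)"
      let ?f = "\<lambda>v. \<Sum>\<alpha>\<in>words m J. a \<alpha> * g \<alpha> v"
      have "homog_poly (D * J) ?f" using g(1) by (intro homog_poly_sum homog_poly_cmult)
      then have f: "?f \<in> image_forms" using a unfolding image_forms_def by blast
      have v: "v \<noteq> 0" "line v \<in> image_closure" using v sub by (auto simp: cone_def)
      show "?f v = 0" by (rule bspec[OF iffD1[OF line_in_image_closure[OF v(1)] v(2)] f])
    qed
    note indep = fun_family_independent[where \<Phi> = ?\<Phi>, OF fin ind]
    have "?\<Phi> ` words m J \<subseteq> fun_space.span ?Mon"
    proof
      fix \<phi> assume "\<phi> \<in> ?\<Phi> ` words m J"
      then obtain \<alpha> where \<alpha>: "\<alpha> \<in> words m J" "\<phi> = ?\<Phi> \<alpha>" by blast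
      show "\<phi> \<in> fun_space.span ?Mon" unfolding \<alpha>(2)
        by (rule restricted_poly_span(3)[OF B(2) EB homog_comp_poly_deg[OF poly g(1)[OF \<alpha>(1)]]])
    qed
    moreover have "finite ?Mon" by (rule restricted_poly_span(1)[OF B(2) EB])
    ultimately have "card (?\<Phi> ` words m J) \<le> card ?Mon"
      using fun_space.independent_span_bound[OF _ indep(2)] by blast
    also have "\<dots> \<le> Suc ?d ^ card B" by (rule restricted_poly_span(2)[OF B(2) EB])
    also have "card (?\<Phi> ` words m J) = card (words m J)" by (rule card_image[OF indep(1)])
    also have "card (words m J) = (J + 1) ^ m" using card_lists_length_eq[of "{..J}" m] by simp
    finally show ?thesis by (simp add: mult_ac)
  qed
  then have "m \<le> card B" by (rule power_le_imp_exponent_le)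
  then show ?thesis by (simp add: B(4))
qed

text \<open>If \<open>Z\<close> were smaller, appending the closure would lengthen every chain in
  \<open>Z\<close> by one, so chains in \<open>Z\<close> would be shorter than the assumed
  dimension.\<close>

lemma variety_eq_image_closure:
  assumes Z: "projective_variety Z" and sub: "Z \<subseteq> image_closure"
    and dim: "enat (vec.dim (range ((*v) E1))) \<le> variety_dim Z"
  shows "Z = image_closure"
proof (rule ccontr)
  assume "Z \<noteq> image_closure"
  then have psub: "Z \<subset> image_closure" using sub by blast
  let ?n = "vec.dim (range ((*v) E1))"
  let ?A = "{m. \<exists>C. (\<forall>i\<le>m. projective_variety (C i) \<and> C i \<subseteq> Z) \<and> (\<forall>i<m. C i \<subset> C (Suc i))}"
  have le: "Suc m \<le> ?n" if m: "m \<in> ?A" for m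
  proof -
    obtain C where "(\<forall>i\<le>m. projective_variety (C i) \<and> C i \<subseteq> Z) \<and> (\<forall>i<m. C i \<subset> C (Suc i))"
      using m by blast
    then have C: "\<And>i. i \<le> m \<Longrightarrow> projective_variety (C i)" "\<And>i. i \<le> m \<Longrightarrow> C i \<subseteq> Z"
      "\<And>i. i < m \<Longrightarrow> C i \<subset> C (Suc i)" by simp_all
    define C' where "C' i = (if i \<le> m then C i else image_closure)" for i
    show ?thesis
    proof (rule chain_length_le[of "Suc m" C'])
      show "projective_variety (C' i)" for i using C(1) image_closure_variety by (simp add: C'_def)
      show "C' i \<subset> C' (Suc i)" if "i < Suc m" for i
      proof (cases "i = m")
        case True
        then show ?thesis using C(2)[of m] psub by (auto simp: C'_def)
      next
        case False
        then show ?thesis using that C(3)[of i] by (simp add: C'_def)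
      qed
    qed (simp add: C'_def)
  qed
  \<comment> \<open>The chain consisting of \<open>Z\<close> alone gives \<open>?n > 0\<close>, so
    the truncated \<open>?n - 1\<close> below is a genuine predecessor.\<close>
  have "0 \<in> ?A" using Z by (auto intro!: exI[of _ "\<lambda>_. Z"])
  have "variety_dim Z \<le> enat (?n - 1)"
    unfolding variety_dim_def
  proof (rule SUP_least)
    fix m assume "m \<in> ?A"
    from le[OF this] show "enat m \<le> enat (?n - 1)" by simp
  qed
  from order_trans[OF dim this] have "?n \<le> ?n - 1" by (simp only: enat_ord_simps)
  then show False using le[OF \<open>0 \<in> ?A\<close>] by linarith
qed

end

subsection \<open>The graded normal form\<close>

lemma separating_form:
  fixes U :: "(complex ^ 'n::finite) set"
  assumes U: "vec.subspace U" and w: "w \<notin> U"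
  obtains l where "l \<in> dual_V" "\<And>u. u \<in> U \<Longrightarrow> l u = 0" "l w = 1"
proof -
  obtain l where "\<And>u v. l (u + v) = l u + l v" "\<And>a v. l (a *s v) = a * l v"
    "\<And>u. u \<in> U \<Longrightarrow> l u = 0" "l w = 1"
    using vec.separating_functional[OF U w] by blast
  then show ?thesis using that dual_V_I by blast
qed

context charted_variety
begin

text \<open>The velocity vector of \<open>D\<close> in the affine chart \<open>l0 = 1\<close>; it
  turns abstract derivations into vectors of \<open>V\<close>.\<close>

definition tvec :: "(('n ppoint \<Rightarrow> complex) \<Rightarrow> complex) \<Rightarrow> complex ^ 'n" where
  "tvec D = (\<chi> i. D (ratio (\<lambda>v. v $ i) l0))"

lemma tangent_sum:
  assumes "D \<in> T" "\<And>i. i \<in> I \<Longrightarrow> f i \<in> O\<^sub>x" "finite I"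
  shows "D (\<lambda>p. \<Sum>i\<in>I. f i p) = (\<Sum>i\<in>I. D (f i))"
  using assms(3,2)
proof (induction I)
  case empty
  then show ?case using tangent_const[OF assms(1), of 0] by simp
next
  case (insert i I)
  then show ?case
    using tangent_D(2)[OF assms(1), of "f i" "\<lambda>p. \<Sum>i\<in>I. f i p"] local_ring_sum[of I f] by simp
qed

lemma tvec_form:
  assumes D: "D \<in> T" and l: "l \<in> dual_V" shows "D (ratio l l0) = l (tvec D)"
proof -
  have X: "ratio (\<lambda>v. v $ i) l0 \<in> O\<^sub>x" for i by (rule ratio_l0_local[OF dual_V_coord])
  let ?s = "\<lambda>p. \<Sum>i\<in>UNIV. l (axis i 1) * ratio (\<lambda>v. v $ i) l0 p"
  have s: "?s \<in> O\<^sub>x" using X by (intro local_ring_sum local_ring_cmult)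
  have "germ_eq Z x (ratio l l0) ?s"
  proof (rule germ_eqI_l0)
    fix v assume "v \<in> cone Z"
    then have "v \<noteq> 0" by (simp add: cone_def)
    then show "ratio l l0 (line v) = ?s (line v)"
      by (simp add: ratio_l0_line[OF l] ratio_l0_line[OF dual_V_coord] dual_V_expand[OF l, of v] sum_divide_distrib)
  qed
  then have "D (ratio l l0) = D ?s" by (rule tangent_D(1)[OF D ratio_l0_local[OF l] s])
  also have "\<dots> = (\<Sum>i\<in>UNIV. l (axis i 1) * D (ratio (\<lambda>v. v $ i) l0))"
    using X tangent_D(3)[OF D X X] by (subst tangent_sum[OF D]) (auto intro: local_ring_cmult)
  also have "\<dots> = l (tvec D)" by (subst dual_V_expand[OF l]) (simp add: tvec_def)
  finally show ?thesis .
qed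

text \<open>The Leibniz rule determines a derivation on polynomials in the affine coordinates. A
  germ \<open>\<phi>\<close> satisfies \<open>g * \<phi> = f\<close> for such polynomials, and its
  derivative can be solved for because \<open>g\<close> is nonzero at the point.\<close>

lemma tvec_inj:
  assumes D: "D \<in> T" "D' \<in> T" and eq: "tvec D = tvec D'" shows "D = D'"
proof
  fix \<phi>
  have hom: "D (dehom d f) = D' (dehom d f)" if "homog_poly d f" for d f
    using that
  proof (induction rule: homog_poly.induct)
    case (const a)
    have "dehom 0 (\<lambda>_. a) = (\<lambda>_. a)" by (simp add: ratio_def fun_eq_iff)
    then show ?case using tangent_const[OF D(1), of a] tangent_const[OF D(2), of a] by simp
  next
    case (coord i)
    have "D (ratio (\<lambda>v. v $ i) l0) = D' (ratio (\<lambda>v. v $ i) l0)"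
      using arg_cong[OF eq, of "\<lambda>v. v $ i"] by (simp add: tvec_def)
    then show ?case by simp
  next
    case (add d f g)
    have "dehom d (\<lambda>v. f v + g v) = (\<lambda>p. dehom d f p + dehom d g p)"
      by (simp add: ratio_def fun_eq_iff Let_def add_divide_distrib)
    then show ?case using tangent_D(2)[OF D(1)] tangent_D(2)[OF D(2)] dehom_local add by simp
  next
    case (mult d f e g)
    have "dehom (d + e) (\<lambda>v. f v * g v) = (\<lambda>p. dehom d f p * dehom e g p)"
      by (simp add: ratio_def fun_eq_iff Let_def power_add)
    then show ?case using tangent_D(4)[OF D(1)] tangent_D(4)[OF D(2)] dehom_local mult by simp
  qed
  show "D \<phi> = D' \<phi>"
  proof (cases "\<phi> \<in> O\<^sub>x")
    case True
    then obtain d f g where fg: "homog_poly d f" "homog_poly d g" "g v0 \<noteq> 0"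
       "\<And>v. v \<in> cone Z \<Longrightarrow> g v \<noteq> 0 \<Longrightarrow> \<phi> (line v) = f v / g v" unfolding local_ring_iff by blast
    have "germ_eq Z x (\<lambda>p. dehom d g p * \<phi> p) (dehom d f)"
      unfolding germ_eq_def near_iff
    proof (intro exI conjI ballI impI)
      fix v assume "v \<in> cone Z" "g v \<noteq> 0"
      moreover from this have "v \<noteq> 0" by (simp add: cone_def)
      ultimately show "dehom d g (line v) * \<phi> (line v) = dehom d f (line v)"
        using fg(4)[of v] by (simp add: dehom_line fg(1,2))
    qed (use fg in auto)
    then have *: "D (\<lambda>p. dehom d g p * \<phi> p) = D (dehom d f)" if "D \<in> T" for D
      using tangent_D(1)[OF that local_ring_mult[OF dehom_local[OF fg(2)] True] dehom_local[OF fg(1)]] by blast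
    have "dehom d g x * D \<phi> = D (dehom d f) - \<phi> x * D (dehom d g)" if "D \<in> T" for D
      using *[OF that] tangent_D(4)[OF that dehom_local[OF fg(2)] True] by (simp add: eq_diff_eq)
    from this[OF D(1)] this[OF D(2)] have "dehom d g x * D \<phi> = dehom d g x * D' \<phi>"
      using hom fg(1,2) by simp
    moreover have "dehom d g x \<noteq> 0" using dehom_line[OF fg(2) base(2)] fg(3) by (simp add: l0_base)
    ultimately show ?thesis by simp
  qed (simp add: tangent_outside[OF D(1)] tangent_outside[OF D(2)])
qed

lemma tvec_add: "tvec (D + D') = tvec D + tvec D'"
  by (simp add: tvec_def vec_eq_iff)

lemma tvec_cmult: "tvec (\<lambda>\<phi>. a * D \<phi>) = a *s tvec D"
  by (simp add: tvec_def vec_eq_iff)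

lemma tangent_zero: "(\<lambda>_. 0) \<in> T"
  unfolding tangent_space_def by simp

end

text \<open>\<open>E i\<close> projects to relative weight \<open>i\<close>, numbered so that a
  linear form of this weight, divided by \<open>l0\<close>, has the eigenvalue \<open>c ^ i\<close>
  expected in order \<open>i\<close>. Injectivity of the powers says that \<open>c\<close> is
  neither 0 nor a root of unity.\<close>

locale graded_variety = scaled_variety Z v0 l0 S \<mu> c
  for Z :: "('n::finite) ppoint set" and v0 :: "complex ^ 'n" and l0 S \<mu> c +
  fixes E :: "nat \<Rightarrow> complex ^ 'n ^ 'n" and K :: nat
  assumes E_E: "E i *v (E j *v v) = (if i = j then E i *v v else 0)"
    and E_sum: "(\<Sum>i\<le>K. E i *v v) = v" and E_out: "i > K \<Longrightarrow> E i = 0"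
    and E_0: "E 0 *v v = l0 v *s v0"
    and E_S: "E i *v (S *v v) = (\<mu> * c ^ i) *s (E i *v v)"
    and c_inj: "c ^ i = c ^ j \<Longrightarrow> i = j"
    and nonsingular: "enat (fun_space.dim T) = variety_dim Z"
begin

lemma E_v0: "E i *v v0 = (if i = 0 then v0 else 0)"
proof -
  have "E 0 *v v0 = v0" using E_0[of v0] by (simp add: l0_base)
  then show ?thesis using E_E[of i 0 v0] by (cases "i = 0") auto
qed

lemma l0_E: "l0 (E i *v v) = (if i = 0 then l0 v else 0)"
proof -
  have "l0 (E i *v v) *s v0 = (if i = 0 then l0 v else 0) *s v0"
    using E_E[of 0 i v] E_0[of "E i *v v"] E_0[of v] by auto
  then show ?thesis using base(2) by (simp del: if_cancel)
qed

lemma weight_form_local: "l \<in> dual_V \<Longrightarrow> ratio (\<lambda>v. l (E i *v v)) l0 \<in> O\<^sub>x"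
  by (rule ratio_l0_local[OF dual_V_comp_matrix])

lemma weight_form_eigen:
  assumes "l \<in> dual_V"
  shows "germ_eq Z x (ratio (\<lambda>v. l (E i *v v)) l0 \<circ> h) (\<lambda>p. c ^ i * ratio (\<lambda>v. l (E i *v v)) l0 p)"
  using dehom_eigen[OF dual_V_homog[OF dual_V_comp_matrix[OF assms, of "E i"]], of "\<mu> * c ^ i"]
  by (simp add: E_S dual_V_D[OF assms] \<mu>_nonzero)

text \<open>The eigenvalue \<open>c ^ i\<close> differs from \<open>c ^ j\<close> for all
  \<open>j < i\<close>, so the function climbs from \<open>M 0\<close> up to
  \<open>M i\<close>.\<close>

lemma weight_form_power: "l \<in> dual_V \<Longrightarrow> ratio (\<lambda>v. l (E i *v v)) l0 \<in> M i"
  using eigen_power[OF weight_form_eigen, of l 0 i i] weight_form_local[of l i] c_inj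
  by (force simp: ideal_power_0)

text \<open>Under the dilation a derivation is multiplied by \<open>c\<close> and a linear form of
  weight \<open>i\<close> by \<open>c ^ i\<close>, so the derivative of the latter is zero unless
  \<open>i = 1\<close>.\<close>

lemma tvec_weight: assumes D: "D \<in> T" shows "E 1 *v tvec D = tvec D"
proof -
  have zero: "E i *v tvec D = 0" if "i \<noteq> 1" for i
  proof -
    have "(E i *v tvec D) $ j = 0" for j
    proof -
      let ?l = "\<lambda>v :: complex ^ 'n. v $ j" and ?f = "ratio (\<lambda>v. (E i *v v) $ j) l0"
      have f: "?f \<in> O\<^sub>x" by (rule weight_form_local[OF dual_V_coord])
      have "c * D ?f = D (?f \<circ> h)" by (rule tangent_scale[OF D, symmetric])
      also have "\<dots> = D (\<lambda>p. c ^ i * ?f p)"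
        by (rule tangent_D(1)[OF D local_ring_h[OF f] local_ring_cmult[OF f] weight_form_eigen[OF dual_V_coord]])
      also have "\<dots> = c ^ i * D ?f" by (rule tangent_D(3)[OF D f f])
      finally have "D ?f = 0" using c_inj[of 1 i] that by auto
      then show ?thesis using tvec_form[OF D dual_V_comp_matrix[OF dual_V_coord], of "E i" j] by simp
    qed
    then show ?thesis by (simp add: vec_eq_iff)
  qed
  have "tvec D = (\<Sum>i\<le>K. E i *v tvec D)" by (simp add: E_sum)
  also have "\<dots> = (\<Sum>i\<le>K. if i = 1 then E 1 *v tvec D else 0)" using zero by (intro sum.cong) auto
  also have "\<dots> = E 1 *v tvec D" using E_out[of 1] by auto
  finally show ?thesis by simp
qed

text \<open>Otherwise some linear form of weight 1 would vanish on all tangent vectors, hence lie in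
  \<open>M 2\<close>. Its eigenvalue \<open>c\<close> is none of \<open>c ^ 2, c ^ 3, ...\<close>,
  so it would vanish on \<open>Z\<close>, against nondegeneracy.\<close>

lemma tvec_surj: obtains D where "D \<in> T" "tvec D = E 1 *v w"
proof -
  have sub: "vec.subspace (tvec ` T)"
    unfolding vec.subspace_def
  proof (intro conjI ballI allI)
    show "0 \<in> tvec ` T" using tangent_zero by (force simp: tvec_def vec_eq_iff)
    show "u + v \<in> tvec ` T" if "u \<in> tvec ` T" "v \<in> tvec ` T" for u v
    proof -
      obtain D D' where "D \<in> T" "D' \<in> T" "u = tvec D" "v = tvec D'" using \<open>u \<in> _\<close> \<open>v \<in> _\<close> by blast
      then show ?thesis using imageI[OF tangent_space_add[of D Z x D'], of tvec] by (simp add: tvec_add)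
    qed
    show "a *s u \<in> tvec ` T" if "u \<in> tvec ` T" for a u
    proof -
      obtain D where "D \<in> T" "u = tvec D" using \<open>u \<in> _\<close> by blast
      then show ?thesis using imageI[OF tangent_space_cmult[of D Z x a], of tvec] by (simp add: tvec_cmult)
    qed
  qed
  have "E 1 *v w \<in> tvec ` T"
  proof (rule ccontr)
    assume "E 1 *v w \<notin> tvec ` T"
    from separating_form[OF sub this] obtain l where l: "l \<in> dual_V" "\<And>u. u \<in> tvec ` T \<Longrightarrow> l u = 0" "l (E 1 *v w) = 1" by blast
    let ?l = "\<lambda>v. l (E 1 *v v)"
    have ld: "?l \<in> dual_V" by (rule dual_V_comp_matrix[OF l(1)])
    have "ratio ?l l0 x = 0" using ratio_l0_line[OF ld base(2)] by (simp add: E_v0 dual_V_D[OF l(1)])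
    then have "ratio ?l l0 \<in> max_ideal Z x" using ratio_l0_local[OF ld] by (simp add: max_ideal_iff)
    moreover have "D (ratio ?l l0) = 0" if "D \<in> T" for D
      using tvec_form[OF that ld] tvec_weight[OF that] l(2) that by simp
    ultimately have "ratio ?l l0 \<in> M 2" by (rule tangent_kernel)
    then have M2: "dehom 1 ?l \<in> M 2" by simp
    have eig: "germ_eq Z x (dehom 1 ?l \<circ> h) (\<lambda>p. c ^ 1 * dehom 1 ?l p)"
      using weight_form_eigen[OF l(1), of 1] by (simp only: dehom_1)
    have "?l v = 0" if "v \<in> cone Z" for v
    proof (rule eigen_zero[OF eig dual_V_homog[OF ld] M2 _ that])
      show "c ^ 1 \<noteq> c ^ k" if "2 \<le> k" for k using c_inj[of 1 k] that by auto
    qed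
    then have "?l w = 0" by (rule dual_zero[OF ld])
    then show False using l(3) by simp
  qed
  then show ?thesis using that by (metis imageE)
qed

definition tangent_of :: "complex ^ 'n \<Rightarrow> (('n ppoint \<Rightarrow> complex) \<Rightarrow> complex)" where
  "tangent_of w = (SOME D. D \<in> T \<and> tvec D = E 1 *v w)"

lemma tangent_of: "tangent_of w \<in> T" "tvec (tangent_of w) = E 1 *v w"
proof -
  have "\<exists>D. D \<in> T \<and> tvec D = E 1 *v w" using tvec_surj by metis
  from someI_ex[OF this] show "tangent_of w \<in> T" "tvec (tangent_of w) = E 1 *v w"
    by (simp_all add: tangent_of_def)
qed

lemma tangent_of_tvec: "D \<in> T \<Longrightarrow> tangent_of (tvec D) = D"
  using tvec_inj tangent_of tvec_weight by metis

lemma tangent_of_add: "tangent_of (u + w) = tangent_of u + tangent_of w"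
  by (rule tvec_inj) (simp_all add: tangent_of tangent_space_add tvec_add vec.add)

lemma tangent_of_cmult: "tangent_of (a *s w) = (\<lambda>\<phi>. a * tangent_of w \<phi>)"
  by (rule tvec_inj) (simp_all add: tangent_of tangent_space_cmult tvec_cmult vec.scale)

lemma tangent_of_E: "tangent_of (E 1 *v w) = tangent_of w"
  by (rule tvec_inj) (simp_all add: tangent_of E_E)

lemma dim_tangent: "fun_space.dim T = vec.dim (range ((*v) (E 1)))"
proof -
  interpret P: finite_dimensional_vector_space_pair_1 "(*s) :: complex \<Rightarrow> complex ^ 'n \<Rightarrow> _" cart_basis
    "\<lambda>(c::complex) (f :: ('n ppoint \<Rightarrow> complex) \<Rightarrow> complex). (\<lambda>x. c * f x)" ..
  have lin: "Vector_Spaces.linear (*s) (\<lambda>c f. (\<lambda>x. c * f x)) tangent_of"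
    by unfold_locales (auto simp: tangent_of_add tangent_of_cmult)
  have sub: "vec.span (range ((*v) (E 1))) = range ((*v) (E 1))"
    by (simp add: vec.span_eq_iff vec.subspace_image)
  have inj: "inj_on tangent_of (vec.span (range ((*v) (E 1))))"
    unfolding sub by (rule inj_onI) (metis (no_types, lifting) tangent_of(2) E_E rangeE)
  have "tangent_of ` range ((*v) (E 1)) = T"
  proof (intro equalityI subsetI)
    fix D assume "D \<in> T"
    then have "D = tangent_of (E 1 *v tvec D)" by (simp only: tangent_of_E tangent_of_tvec)
    then show "D \<in> tangent_of ` range ((*v) (E 1))" by blast
  qed (auto simp: tangent_of)
  then show ?thesis using P.dim_image_eq[OF lin inj] by simp
qed

end

text \<open>For degrees 0 and 1, where the fundamental form is the whole symmetric power and its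
  elements must be recognized as linear forms on the chart.\<close>

lemma homog_poly_linear:
  assumes "homog_poly d f"
  shows "(d = 0 \<longrightarrow> (\<exists>a. f = (\<lambda>_. a))) \<and> (d = 1 \<longrightarrow> f \<in> dual_V)"
  using assms
proof (induction rule: homog_poly.induct)
  case (mult d f e g)
  show ?case
  proof (intro conjI impI)
    assume "d + e = 0"
    then show "\<exists>a. (\<lambda>v. f v * g v) = (\<lambda>_. a)" using mult by auto
  next
    assume "d + e = 1"
    then consider "d = 0" "e = 1" | "d = 1" "e = 0" by linarith
    then show "(\<lambda>v. f v * g v) \<in> dual_V"
    proof cases
      case 1
      then show ?thesis using mult.IH dual_V_cmult by auto
    next
      case 2
      then obtain a where "g = (\<lambda>_. a)" using mult.IH by auto
      then show ?thesis using 2 mult.IH dual_V_cmult[of f a] by (simp add: mult.commute)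
    qed
  qed
qed (auto intro: dual_V_coord dual_V_add)

section \<open>Symbols as polynomials on the weight 1 part\<close>

context graded_variety
begin

lemma functional_form:
  assumes "\<And>D D'. D \<in> T \<Longrightarrow> D' \<in> T \<Longrightarrow> \<xi> (D + D') = \<xi> D + \<xi> D'"
    and "\<And>a D. D \<in> T \<Longrightarrow> \<xi> (\<lambda>\<phi>. a * D \<phi>) = a * \<xi> D"
  obtains l where "l \<in> dual_V" "\<And>v. l (E 1 *v v) = l v" "\<And>D. D \<in> T \<Longrightarrow> \<xi> D = l (tvec D)"
proof
  show "(\<lambda>v. \<xi> (tangent_of v)) \<in> dual_V"
    by (rule dual_V_I) (simp_all add: tangent_of_add tangent_of_cmult assms tangent_of)
qed (simp_all only: tangent_of_E tangent_of_tvec)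

lemma max_ideal_form:
  assumes u: "u \<in> max_ideal Z x"
  obtains l where "l \<in> dual_V" "\<And>v. l (E 1 *v v) = l v" "\<And>D. D \<in> T \<Longrightarrow> D u = l (tvec D)"
    "(\<lambda>p. u p - ratio l l0 p) \<in> M 2" "ratio l l0 \<in> max_ideal Z x"
proof -
  obtain l where l: "l \<in> dual_V" "\<And>v. l (E 1 *v v) = l v" "\<And>D. D \<in> T \<Longrightarrow> D u = l (tvec D)"
    by (rule functional_form[of "\<lambda>D. D u"]) auto
  have O: "u \<in> O\<^sub>x" "ratio l l0 \<in> O\<^sub>x" using u ratio_l0_local[OF l(1)] by (auto simp: max_ideal_iff)
  have "l v0 = 0" using l(2)[of v0] by (simp add: E_v0 dual_V_D[OF l(1)])
  then have m: "ratio l l0 \<in> max_ideal Z x" using O ratio_l0_line[OF l(1) base(2)] by (simp add: max_ideal_iff)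
  have "(\<lambda>p. u p - ratio l l0 p) \<in> M 2"
  proof (rule tangent_kernel)
    show "(\<lambda>p. u p - ratio l l0 p) \<in> max_ideal Z x"
      using u m local_ring_diff[OF O] by (simp add: max_ideal_iff)
    show "D (\<lambda>p. u p - ratio l l0 p) = 0" if "D \<in> T" for D
      using tangent_D(5)[OF that O] l(3)[OF that] tvec_form[OF that l(1)] by simp
  qed
  then show ?thesis using that l m by blast
qed

lemma dehom_mult: "dehom (Suc n) (\<lambda>v. l v * q v) p = ratio l l0 p * dehom n q p"
  by (simp add: ratio_def Let_def)

text \<open>Each \<open>u\<close> is replaced by the linear form with the same differential; the
  error in \<open>M 2\<close> times the other factors falls into the next power.\<close>

lemma prod_form:
  assumes "set us \<subseteq> max_ideal Z x"
  shows "\<exists>q. homog_poly (length us) q \<and> (\<forall>v. q (E 1 *v v) = q v) \<and> (\<forall>D\<in>T. q (tvec D) = (\<Prod>u\<leftarrow>us. D u)) \<and>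
     (\<lambda>p. (\<Prod>u\<leftarrow>us. u p) - dehom (length us) q p) \<in> M (Suc (length us))"
  using assms
proof (induction us)
  case Nil
  show ?case
  proof (intro exI[of _ "\<lambda>_. 1"] conjI)
    have "(\<lambda>p. 0) \<in> M (Suc 0)" by (rule ideal_power_zero)
    then show "(\<lambda>p. (\<Prod>u\<leftarrow>[]. u p) - dehom (length []) (\<lambda>_. 1) p) \<in> M (Suc (length []))"
      by (simp add: ratio_def)
  qed (auto intro: homog_poly.const)
next
  case (Cons u us)
  then obtain q where q: "homog_poly (length us) q" "\<And>v. q (E 1 *v v) = q v"
    "\<And>D. D \<in> T \<Longrightarrow> q (tvec D) = (\<Prod>u\<leftarrow>us. D u)"
    "(\<lambda>p. (\<Prod>u\<leftarrow>us. u p) - dehom (length us) q p) \<in> M (Suc (length us))" by auto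
  have u: "u \<in> max_ideal Z x" and us: "set us \<subseteq> max_ideal Z x" using Cons.prems by auto
  obtain l where l: "l \<in> dual_V" "\<And>v. l (E 1 *v v) = l v" "\<And>D. D \<in> T \<Longrightarrow> D u = l (tvec D)"
    "(\<lambda>p. u p - ratio l l0 p) \<in> M 2" "ratio l l0 \<in> max_ideal Z x" using max_ideal_form[OF u] by blast
  show ?case
  proof (intro exI[of _ "\<lambda>v. l v * q v"] conjI)
    show "homog_poly (length (u # us)) (\<lambda>v. l v * q v)"
      using homog_poly.mult[OF dual_V_homog[OF l(1)] q(1)] by simp
    have 1: "(\<lambda>p. (u p - ratio l l0 p) * (\<Prod>u\<leftarrow>us. u p)) \<in> M (Suc (length (u # us)))"
      using ideal_power_mult[OF l(4) prod_list_power[OF us]] by simp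
    have 2: "(\<lambda>p. ratio l l0 p * ((\<Prod>u\<leftarrow>us. u p) - dehom (length us) q p)) \<in> M (Suc (length (u # us)))"
      using ideal_power_mult[OF max_ideal_power_1[OF l(5)] q(4)] by simp
    from ideal_power_add[OF 1 2]
    show "(\<lambda>p. (\<Prod>u\<leftarrow>u # us. u p) - dehom (length (u # us)) (\<lambda>v. l v * q v) p) \<in> M (Suc (length (u # us)))"
      by (simp only: length_Cons dehom_mult) (simp add: algebra_simps)
    show "\<forall>v. l (E 1 *v v) * q (E 1 *v v) = l v * q v" by (intro allI) (simp only: l(2) q(2))
    show "\<forall>D\<in>T. l (tvec D) * q (tvec D) = (\<Prod>u\<leftarrow>u # us. D u)"
      using l(3) q(3) by simp
  qed
qed

abbreviation symbol :: "(('n ppoint \<Rightarrow> complex) \<times> ('n ppoint \<Rightarrow> complex) list) list \<Rightarrow> 'n form" where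
  "symbol ts \<equiv> sym_value Z x (map (\<lambda>(a, us). (a x, map (germ_differential Z x) us)) ts)"

text \<open>The bridge from symbols to polynomials on \<open>V\<close>. A coefficient
  \<open>a\<close> may be replaced by its value at the point because the difference lies in the
  maximal ideal.\<close>

lemma ideal_terms_form:
  assumes "ts \<in> ideal_terms Z x k"
  shows "\<exists>q. homog_poly k q \<and> (\<forall>v. q (E 1 *v v) = q v) \<and> (\<forall>D\<in>T. q (tvec D) = symbol ts D) \<and>
     (\<lambda>p. ideal_value ts p - dehom k q p) \<in> M (Suc k)"
  using assms
proof (induction ts)
  case Nil
  show ?case
  proof (intro exI[of _ "\<lambda>_. 0"] conjI)
    show "(\<lambda>p. ideal_value [] p - dehom k (\<lambda>_. 0) p) \<in> M (Suc k)"
      using ideal_power_zero[of "Suc k"] by (simp add: ratio_def ideal_value_def)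
  qed (auto simp: sym_value_def homog_poly_zero)
next
  case (Cons t ts)
  obtain a us where t: "t = (a, us)" by (cases t)
  have *: "a \<in> O\<^sub>x" "set us \<subseteq> max_ideal Z x" "length us = k" "ts \<in> ideal_terms Z x k"
    using Cons.prems by (auto simp: ideal_terms_def t)
  obtain q where q: "homog_poly k q" "\<And>v. q (E 1 *v v) = q v" "\<And>D. D \<in> T \<Longrightarrow> q (tvec D) = symbol ts D"
    "(\<lambda>p. ideal_value ts p - dehom k q p) \<in> M (Suc k)" using Cons.IH[OF *(4)] by blast
  obtain r where r: "homog_poly k r" "\<And>v. r (E 1 *v v) = r v" "\<And>D. D \<in> T \<Longrightarrow> r (tvec D) = (\<Prod>u\<leftarrow>us. D u)"
    "(\<lambda>p. (\<Prod>u\<leftarrow>us. u p) - dehom k r p) \<in> M (Suc k)" using prod_form[OF *(2)] unfolding *(3) by blast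
  show ?case
  proof (intro exI[of _ "\<lambda>v. a x * r v + q v"] conjI ballI allI)
    show "homog_poly k (\<lambda>v. a x * r v + q v)" using q(1) r(1) by (intro homog_poly.add homog_poly_cmult)
    show "a x * r (E 1 *v v) + q (E 1 *v v) = a x * r v + q v" for v by (simp only: q(2) r(2))
    show "a x * r (tvec D) + q (tvec D) = symbol (t # ts) D" if "D \<in> T" for D
      using that by (simp add: q(3) r(3) t sym_value_def germ_differential_def comp_def)
    have 1: "(\<lambda>p. (a p - a x) * (\<Prod>u\<leftarrow>us. u p)) \<in> M (Suc k)"
      using ideal_power_mult[OF max_ideal_power_1[OF local_ring_minus_value[OF *(1)]] prod_list_power[OF *(2)]] *(3) by simp
    have 2: "(\<lambda>p. a x * ((\<Prod>u\<leftarrow>us. u p) - dehom k r p)) \<in> M (Suc k)" by (rule ideal_power_cmult[OF r(4)])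
    have 3: "dehom k (\<lambda>v. a x * r v + q v) p = a x * dehom k r p + dehom k q p" for p
      by (simp add: ratio_def Let_def add_divide_distrib)
    have 4: "ideal_value (t # ts) p = a p * (\<Prod>u\<leftarrow>us. u p) + ideal_value ts p" for p
      by (simp add: ideal_value_def t)
    from ideal_power_add[OF ideal_power_add[OF 1 2] q(4)]
    show "(\<lambda>p. ideal_value (t # ts) p - dehom k (\<lambda>v. a x * r v + q v) p) \<in> M (Suc k)"
      unfolding 3 4 by (simp add: algebra_simps)
  qed
qed

text \<open>Cleared of denominators, the difference has relative eigenvalue \<open>c ^ k\<close> but
  lies in \<open>M (Suc k)\<close>, so \<open>eigen_zero\<close> applies: congruence to the next
  order becomes equality.\<close>

lemma weight_form_eq:
  assumes l: "l \<in> dual_V" and q: "homog_poly k q" "\<And>v. q (E 1 *v v) = q v"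
    and M: "(\<lambda>p. ratio (\<lambda>v. l (E k *v v)) l0 p - dehom k q p) \<in> M (Suc k)"
    and v: "v \<in> cone Z" "l0 v = 1"
  shows "l (E k *v v) = q v"
proof -
  let ?l = "\<lambda>v. l (E k *v v)"
  define f where "f = (\<lambda>v. ?l v * l0 v ^ k - q v * l0 v)"
  have ld: "?l \<in> dual_V" by (rule dual_V_comp_matrix[OF l])
  have hom: "homog_poly (Suc k) f"
    using homog_poly_diff[of "1 + k" "\<lambda>v. ?l v * l0 v ^ k" "\<lambda>v. q v * l0 v"]
      homog_poly.mult[OF dual_V_homog[OF ld] l0_power[of k]] homog_poly.mult[OF q(1) dual_V_homog[OF l0_dual]]
    by (simp add: f_def)
  have "germ_eq Z x (\<lambda>p. ratio ?l l0 p - dehom k q p) (dehom (Suc k) f)"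
  proof (rule germ_eqI_l0)
    fix u assume u: "u \<in> cone Z" "l0 u \<noteq> 0"
    then have "u \<noteq> 0" by (simp add: cone_def)
    note lines = dehom_line[OF hom this] dehom_line[OF q(1) this] ratio_l0_line[OF ld this]
    show "ratio ?l l0 (line u) - dehom k q (line u) = dehom (Suc k) f (line u)"
      unfolding lines unfolding f_def using u(2) by (simp add: field_simps)
  qed
  then have f: "dehom (Suc k) f \<in> M (Suc k)" by (rule ideal_power_germ[OF M])
  \<comment> \<open>The polynomial \<open>q\<close> sees only the weight 1 part, on which
    \<open>S\<close> is multiplication by \<open>\<mu> * c\<close>.\<close>
  have qS: "q (S *v u) = (\<mu> * c) ^ k * q u" for u
  proof -
    have "q (S *v u) = q ((\<mu> * c) *s (E 1 *v u))" using q(2)[of "S *v u"] by (simp add: E_S)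
    also have "\<dots> = (\<mu> * c) ^ k * q (E 1 *v u)" by (rule homog_poly_scale[OF q(1)])
    finally show ?thesis by (simp only: q(2))
  qed
  have "f (S *v u) = (\<mu> ^ Suc k * c ^ k) * f u" for u
    by (simp add: f_def qS E_S l0_S dual_V_D[OF l] power_mult_distrib algebra_simps)
  from dehom_eigen[OF hom this]
  have eig: "germ_eq Z x (dehom (Suc k) f \<circ> h) (\<lambda>p. c ^ k * dehom (Suc k) f p)"
    by (simp add: \<mu>_nonzero)
  have "f v = 0"
  proof (rule eigen_zero[OF eig hom f _ v(1)])
    show "c ^ k \<noteq> c ^ j" if "Suc k \<le> j" for j using c_inj[of k j] that by auto
  qed
  then show ?thesis using v(2) by (simp add: f_def)
qed

text \<open>The polynomial \<open>q\<close> and the symbol \<open>P\<close> are read off from the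
  same expression \<open>ts\<close>, which ties the values of the linear form on the chart to the
  fundamental form.\<close>

lemma normal_form:
  assumes l: "l \<in> dual_V"
  shows "\<exists>q P. homog_poly k q \<and> (\<forall>v. q (E 1 *v v) = q v) \<and> (\<forall>v\<in>cone Z. l0 v = 1 \<longrightarrow> l (E k *v v) = q v) \<and>
    has_symbol Z x k (ratio (\<lambda>v. l (E k *v v)) l0) P \<and> (\<forall>D\<in>T. P D = q (tvec D))"
proof -
  obtain ts where ts: "ts \<in> ideal_terms Z x k" "germ_eq Z x (ratio (\<lambda>v. l (E k *v v)) l0) (ideal_value ts)"
    using weight_form_power[OF l, of k] by (auto simp: max_ideal_power_def)
  obtain q where q: "homog_poly k q" "\<And>v. q (E 1 *v v) = q v" "\<And>D. D \<in> T \<Longrightarrow> q (tvec D) = symbol ts D"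
    "(\<lambda>p. ideal_value ts p - dehom k q p) \<in> M (Suc k)" using ideal_terms_form[OF ts(1)] by blast
  have "germ_eq Z x (\<lambda>p. ideal_value ts p - dehom k q p) (\<lambda>p. ratio (\<lambda>v. l (E k *v v)) l0 p - dehom k q p)"
    using ts(2) unfolding germ_eq_def by eventually_elim simp
  then have "(\<lambda>p. ratio (\<lambda>v. l (E k *v v)) l0 p - dehom k q p) \<in> M (Suc k)" by (rule ideal_power_germ[OF q(4)])
  then have "\<forall>v\<in>cone Z. l0 v = 1 \<longrightarrow> l (E k *v v) = q v" by (intro ballI impI weight_form_eq[OF l q(1,2)])
  moreover have "has_symbol Z x k (ratio (\<lambda>v. l (E k *v v)) l0) (symbol ts)"
    unfolding has_symbol_def using ts by blast
  ultimately show ?thesis using q(1-3) by (intro exI[of _ q] exI[of _ "symbol ts"]) simp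
qed

subsubsection \<open>The variety as a graph over its tangent space\<close>

definition coord_poly :: "nat \<Rightarrow> 'n \<Rightarrow> complex ^ 'n \<Rightarrow> complex" where
  "coord_poly k i = (SOME q. homog_poly k q \<and> (\<forall>v. q (E 1 *v v) = q v) \<and>
     (\<forall>v\<in>cone Z. l0 v = 1 \<longrightarrow> (E k *v v) $ i = q v))"

lemma coord_poly: "homog_poly k (coord_poly k i)" "coord_poly k i (E 1 *v v) = coord_poly k i v"
  "v \<in> cone Z \<Longrightarrow> l0 v = 1 \<Longrightarrow> (E k *v v) $ i = coord_poly k i v"
proof -
  have "\<exists>q. homog_poly k q \<and> (\<forall>v. q (E 1 *v v) = q v) \<and> (\<forall>v\<in>cone Z. l0 v = 1 \<longrightarrow> (E k *v v) $ i = q v)"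
    using normal_form[OF dual_V_coord, of k i] by blast
  from someI_ex[OF this, folded coord_poly_def]
  show "homog_poly k (coord_poly k i)" "coord_poly k i (E 1 *v v) = coord_poly k i v"
    "v \<in> cone Z \<Longrightarrow> l0 v = 1 \<Longrightarrow> (E k *v v) $ i = coord_poly k i v" by auto
qed

text \<open>The weight 0 and weight 1 parts are \<open>v0\<close> and \<open>w\<close>, so the sum
  starts at 2. The chosen polynomials describe the weight \<open>k\<close> part only on
  \<open>Z\<close>; applying \<open>E k\<close> forces the correct weight for every
  \<open>w\<close>.\<close>

definition graph_map :: "complex ^ 'n \<Rightarrow> complex ^ 'n" where
  "graph_map w = v0 + w + (\<Sum>k\<in>{2..K}. E k *v (\<chi> i. coord_poly k i w))"

lemma l0_graph: "l0 (graph_map (E 1 *v w)) = 1"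
  by (simp add: graph_map_def dual_V_D[OF l0_dual] l0_base l0_E)

lemma E1_graph: "E 1 *v graph_map (E 1 *v w) = E 1 *v w"
  by (simp add: graph_map_def vec.add vec.sum E_v0 E_E)

lemma cone_graph:
  assumes v: "v \<in> cone Z" "l0 v = 1" shows "v = graph_map (E 1 *v v)"
proof -
  have E: "E k *v (\<chi> i. coord_poly k i (E 1 *v v)) = E k *v v" for k
  proof -
    have "(\<chi> i. coord_poly k i (E 1 *v v)) = E k *v v"
      using coord_poly(3)[OF v] by (simp only: coord_poly(2)) (simp add: vec_eq_iff)
    then show ?thesis by (simp add: E_E)
  qed
  have "v = (\<Sum>k\<le>K. E k *v v)" by (simp add: E_sum)
  also have "\<dots> = (\<Sum>k\<in>{0, 1} \<union> {2..K}. E k *v v)"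
    using E_out by (intro sum.mono_neutral_left) (auto simp: not_le)
  also have "\<dots> = (\<Sum>k\<in>{0, 1}. E k *v v) + (\<Sum>k\<in>{2..K}. E k *v v)"
    by (rule sum.union_disjoint) auto
  also have "\<dots> = graph_map (E 1 *v v)" unfolding graph_map_def E by (simp add: E_0 v(2))
  finally show ?thesis .
qed

lemma graph_poly: "\<exists>r. \<forall>i. poly_deg r (\<lambda>w. graph_map w $ i)"
proof -
  have "poly_deg (Suc K) (\<lambda>w. graph_map w $ i)" for i
  proof -
    have A: "poly_deg (Suc K) (\<lambda>w. \<Sum>j\<in>UNIV. E k $ i $ j * coord_poly k j w)" if "k \<in> {2..K}" for k
      using that by (intro poly_deg_sum poly_deg_cmult poly_deg_mono[OF homog_poly_deg[OF coord_poly(1)]]) auto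
    have "poly_deg (Suc K) (\<lambda>w. v0 $ i + w $ i + (\<Sum>k\<in>{2..K}. \<Sum>j\<in>UNIV. E k $ i $ j * coord_poly k j w))"
      by (intro poly_deg.add poly_deg_sum[OF A] poly_deg.const poly_deg.coord)
    then show ?thesis by (simp add: graph_map_def matrix_vector_mult_def)
  qed
  then show ?thesis by blast
qed

text \<open>By \<open>cone_graph\<close> the variety lies in the closure of the graph. The closure
  is irreducible and has dimension at most that of the tangent space, so \<open>Z\<close> fills
  it.\<close>

lemma graph_in_cone: "graph_map (E 1 *v w) \<in> cone Z"
proof -
  obtain r where r: "\<And>i. poly_deg r (\<lambda>w. graph_map w $ i)" using graph_poly by blast
  have nz: "graph_map (E 1 *v w) \<noteq> 0" for w
    using l0_graph[of w] by (auto simp: dual_V_D[OF l0_dual])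
  interpret P: parametrization "E 1" graph_map r
    by unfold_locales (simp_all add: E_E r nz[unfolded One_nat_def])
  have "Z \<subseteq> P.image_closure"
  proof
    fix p assume "p \<in> Z"
    then obtain v where v: "v \<noteq> 0" "p = line v" "v \<in> cone Z"
      using Z_sub proj_space_line unfolding cone_def by blast
    have "f v = 0" if f: "f \<in> P.image_forms" for f
    proof -
      obtain d where d: "homog_poly d f" using f P.image_forms_homog by blast
      \<comment> \<open>Vectors with \<open>l0 u\<close> nonzero are rescaled into the chart; on the
        hyperplane at infinity the factor \<open>l0\<close> supplies the zero.\<close>
      have zero: "l0 u ^ 1 * f u = 0" if u: "u \<in> cone Z" for u
      proof (cases "l0 u = 0")
        case False
        define u' where "u' = (1 / l0 u) *s u"
        have "u' \<in> cone Z" "l0 u' = 1" using False u cone_scale[of "1 / l0 u" u Z]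
          by (auto simp: u'_def dual_V_D[OF l0_dual])
        then have "u' = graph_map (E 1 *v u')" by (rule cone_graph)
        then have "f u' = f (graph_map (E 1 *v u'))" by (rule arg_cong)
        also have "\<dots> = 0" using f unfolding P.image_forms_def by blast
        finally have "f u' = 0" .
        then have "f u = 0" using homog_poly_scale[OF d, of "1 / l0 u" u] False by (simp add: u'_def)
        then show ?thesis by simp
      qed simp
      have "l0 v0 \<noteq> 0" by (simp add: l0_base)
      from variety_power_domain[OF variety dual_V_homog[OF l0_dual] d zero base_in_cone this]
      show ?thesis using v(3) by blast
    qed
    then show "p \<in> P.image_closure" using P.line_in_image_closure[OF v(1)] v(2) by blast
  qed
  moreover have "enat (vec.dim (range ((*v) (E 1)))) \<le> variety_dim Z"
    using nonsingular dim_tangent by simp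
  ultimately have "Z = P.image_closure" by (rule P.variety_eq_image_closure[OF variety])
  then show ?thesis using P.\<gamma>_in_image_closure[of w] nz unfolding cone_def by blast
qed

end

section \<open>Linear forms on the chart and the system of fundamental forms\<close>

context graded_variety
begin

definition chart_point :: "(('n ppoint \<Rightarrow> complex) \<Rightarrow> complex) \<Rightarrow> complex ^ 'n" where
  "chart_point D = graph_map (tvec D)"

lemma chart_point:
  assumes D: "D \<in> T"
  shows "chart_point D \<in> cone Z" "l0 (chart_point D) = 1" "E 1 *v chart_point D = tvec D"
  using graph_in_cone[of "tvec D"] l0_graph[of "tvec D"] E1_graph[of "tvec D"]
  by (simp_all only: chart_point_def tvec_weight[OF D])

lemma chart_point_image: "chart_point ` T = {v \<in> cone Z. l0 v = 1}"
proof (intro equalityI subsetI)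
  fix v assume v: "v \<in> {v \<in> cone Z. l0 v = 1}"
  then have "v = chart_point (tangent_of v)"
    using cone_graph[of v] by (simp only: chart_point_def tangent_of(2) mem_Collect_eq) 
  then show "v \<in> chart_point ` T" using tangent_of(1) by blast
qed (auto simp: chart_point)

lemma tangent_form_cotangent:
  assumes "l \<in> dual_V"
  shows "(\<lambda>D. if D \<in> T then l (tvec D) else 0) \<in> cotangent_space Z x"
  unfolding cotangent_space_def mem_Collect_eq
  using tangent_space_add[of _ Z x] tangent_space_cmult[of _ Z x] by (auto simp: tvec_add tvec_cmult dual_V_D[OF assms])

lemma cotangent_form:
  assumes "\<xi> \<in> cotangent_space Z x"
  obtains l where "l \<in> dual_V" "\<And>v. l (E 1 *v v) = l v" "\<And>D. D \<in> T \<Longrightarrow> \<xi> D = l (tvec D)"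
  by (rule functional_form[of \<xi>]) (use assms in \<open>auto simp: cotangent_space_def\<close>)

lemma ratio_change:
  assumes "l \<in> dual_V" "l1 \<in> dual_V" "l1 v0 \<noteq> 0" "l2 \<in> dual_V" "l2 v0 \<noteq> 0"
  shows "germ_eq Z x (\<lambda>p. ratio l1 l2 p * ratio l l1 p) (ratio l l2)"
  unfolding germ_eq_def near_iff
proof (intro exI conjI ballI impI)
  show "homog_poly (1 + 1) (\<lambda>v. l1 v * l2 v)"
    by (intro homog_poly.mult dual_V_homog assms)
  show "l1 v0 * l2 v0 \<noteq> 0" using assms by simp
  fix v assume v: "v \<in> cone Z" "l1 v * l2 v \<noteq> 0"
  then have "v \<noteq> 0" by (simp add: cone_def)
  then show "ratio l1 l2 (line v) * ratio l l1 (line v) = ratio l l2 (line v)"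
    using v(2) ratio_line[OF dual_V_homog dual_V_homog, of _ _ v] assms by simp
qed

lemma ratio_local: "l \<in> dual_V \<Longrightarrow> l1 \<in> dual_V \<Longrightarrow> l1 v0 \<noteq> 0 \<Longrightarrow> ratio l l1 \<in> O\<^sub>x"
  by (rule local_ring_ratio[OF dual_V_homog dual_V_homog])

lemma nonvanishing_dual: "l \<in> dual_V \<Longrightarrow> nonvanishing l x \<longleftrightarrow> l v0 \<noteq> 0"
  by (rule nonvanishing_line[OF dual_V_homog base(2)])

text \<open>In degrees 0 and 1 an expression is written down directly. From degree 2 on,
  \<open>normal_form\<close> provides a symbol whose polynomial equals the weight \<open>k\<close>
  part on the chart, evaluated at the weight 1 part \<open>tvec D\<close> of the chart
  point.\<close>

lemma weight_component_form:
  assumes l: "l \<in> dual_V"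
  shows "\<exists>P\<in>fundamental_form Z x k. (\<forall>D\<in>T. P D = l (E k *v chart_point D)) \<and> (\<forall>D. D \<notin> T \<longrightarrow> P D = 0)"
proof -
  consider "k = 0" | "k = 1" | "2 \<le> k" by linarith
  then show ?thesis
  proof cases
    case 1
    have "[(l v0, [])] \<in> sym_terms Z x 0" by (simp add: sym_terms_def)
    then have "sym_value Z x [(l v0, [])] \<in> fundamental_form Z x k"
      unfolding 1 fundamental_form_def sym_power_def by simp
    moreover have "sym_value Z x [(l v0, [])] D = l (E k *v chart_point D)" if "D \<in> T" for D
      using that by (simp add: sym_value_def 1 E_0 chart_point(2))
    ultimately show ?thesis by (intro bexI) (auto simp: sym_value_def)
  next
    case 2
    let ?\<xi> = "\<lambda>D. if D \<in> T then l (tvec D) else 0"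
    have "[(1, [?\<xi>])] \<in> sym_terms Z x 1" using tangent_form_cotangent[OF l] by (simp add: sym_terms_def)
    then have "sym_value Z x [(1, [?\<xi>])] \<in> fundamental_form Z x k"
      unfolding 2 fundamental_form_def sym_power_def by simp
    moreover have "sym_value Z x [(1, [?\<xi>])] D = l (E k *v chart_point D)" if "D \<in> T" for D
      using that chart_point(3)[OF that] by (simp add: sym_value_def 2)
    ultimately show ?thesis by (intro bexI) (auto simp: sym_value_def)
  next
    case 3
    let ?l = "\<lambda>v. l (E k *v v)"
    have ld: "?l \<in> dual_V" by (rule dual_V_comp_matrix[OF l])
    obtain q P where q: "\<And>v. q (E 1 *v v) = q v" "\<And>v. v \<in> cone Z \<Longrightarrow> l0 v = 1 \<Longrightarrow> l (E k *v v) = q v"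
      "has_symbol Z x k (ratio ?l l0) P" "\<And>D. D \<in> T \<Longrightarrow> P D = q (tvec D)"
      using normal_form[OF l, of k] by blast
    \<comment> \<open>Membership is required for every trivialization \<open>l1\<close>;
      multiplication by the unit \<open>l0 / l1\<close> carries the case of \<open>l0\<close> over.
      As \<open>2 \<le> k\<close>, the power \<open>Suc (k - 1)\<close> is \<open>k\<close>.\<close>
    have "?l \<in> jet_kernel Z x (k - 1)"
      unfolding jet_kernel_def mem_Collect_eq
    proof (intro conjI ballI impI ld)
      fix l1 assume l1: "l1 \<in> dual_V" "nonvanishing l1 x"
      then have "l1 v0 \<noteq> 0" by (simp add: nonvanishing_dual)
      then have "(\<lambda>p. ratio l0 l1 p * ratio ?l l0 p) \<in> M k"
        using ideal_power_mult_local[OF ratio_local[OF l0_dual l1(1)] weight_form_power[OF l]] by blast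
      moreover have "germ_eq Z x (\<lambda>p. ratio l0 l1 p * ratio ?l l0 p) (ratio ?l l1)"
        using ratio_change[OF ld l0_dual _ l1(1) \<open>l1 v0 \<noteq> 0\<close>] by (simp add: l0_base)
      ultimately show "ratio ?l l1 \<in> M (Suc (k - 1))" using ideal_power_germ 3 by simp
    qed
    moreover have "nonvanishing l0 x" by (simp add: nonvanishing_dual l0_dual l0_base)
    ultimately have "P \<in> fundamental_form Z x k"
      unfolding fundamental_form_def using 3 q(3) l0_dual by auto
    moreover have "P D = l (E k *v chart_point D)" if "D \<in> T" for D
      using q(4)[OF that] q(2)[OF chart_point(1,2)[OF that]] q(1)[of "chart_point D"] chart_point(3)[OF that] by simp
    moreover have "P D = 0" if "D \<notin> T" for D
      using q(3) that by (auto simp: has_symbol_def sym_value_def)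
    ultimately show ?thesis by blast
  qed
qed

lemma form_chart_sum:
  assumes l: "l \<in> dual_V"
  shows "\<exists>P\<in>fundamental_system Z x. \<forall>D\<in>T. l (chart_point D) = (\<Sum>k | P k \<noteq> 0. P k D)"
proof -
  have "\<forall>k. \<exists>P. P \<in> fundamental_form Z x k \<and> (\<forall>D\<in>T. P D = l (E k *v chart_point D)) \<and> (\<forall>D. D \<notin> T \<longrightarrow> P D = 0)"
    using weight_component_form[OF l] by blast
  then obtain P where P: "\<And>k. P k \<in> fundamental_form Z x k" "\<And>k D. D \<in> T \<Longrightarrow> P k D = l (E k *v chart_point D)"
    "\<And>k D. D \<notin> T \<Longrightarrow> P k D = 0" by metis
  have "P k = 0" if "k > K" for k
  proof
    fix D show "P k D = 0 D"
      using P(2)[of D k] P(3)[of D k] E_out[OF that] dual_V_D(4)[OF l] by (cases "D \<in> T") auto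
  qed
  then have sub: "{k. P k \<noteq> 0} \<subseteq> {..K}" using not_le by auto
  then have "P \<in> fundamental_system Z x"
    unfolding fundamental_system_def using P(1) finite_subset by blast
  moreover have "l (chart_point D) = (\<Sum>k | P k \<noteq> 0. P k D)" if "D \<in> T" for D
  proof -
    have "l (chart_point D) = l (\<Sum>k\<le>K. E k *v chart_point D)" by (simp add: E_sum)
    also have "\<dots> = (\<Sum>k\<le>K. P k D)" using P(2)[OF that] by (simp add: dual_V_D[OF l])
    also have "\<dots> = (\<Sum>k | P k \<noteq> 0. P k D)" using sub by (intro sum.mono_neutral_right) auto
    finally show ?thesis .
  qed
  ultimately show ?thesis by blast
qed

lemma sym_terms_form:
  assumes "ts \<in> sym_terms Z x k"
  shows "\<exists>q. homog_poly k q \<and> (\<forall>v. q (E 1 *v v) = q v) \<and> (\<forall>D\<in>T. q (tvec D) = sym_value Z x ts D)"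
  using assms
proof (induction ts)
  case Nil
  show ?case by (rule exI[of _ "\<lambda>_. 0"]) (simp add: homog_poly_zero sym_value_def)
next
  case (Cons t ts)
  obtain a \<xi>s where t: "t = (a, \<xi>s)" by (cases t)
  have *: "length \<xi>s = k" "set \<xi>s \<subseteq> cotangent_space Z x" "ts \<in> sym_terms Z x k"
    using Cons.prems by (auto simp: sym_terms_def t)
  obtain q where q: "homog_poly k q" "\<And>v. q (E 1 *v v) = q v" "\<And>D. D \<in> T \<Longrightarrow> q (tvec D) = sym_value Z x ts D"
    using Cons.IH[OF *(3)] by blast
  have "\<exists>r. homog_poly (length \<xi>s) r \<and> (\<forall>v. r (E 1 *v v) = r v) \<and> (\<forall>D\<in>T. r (tvec D) = (\<Prod>\<xi>\<leftarrow>\<xi>s. \<xi> D))"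
    using *(2)
  proof (induction \<xi>s)
    case Nil
    show ?case by (rule exI[of _ "\<lambda>_. 1"]) (simp add: homog_poly.const)
  next
    case (Cons \<xi> \<xi>s)
    then obtain r where r: "homog_poly (length \<xi>s) r" "\<And>v. r (E 1 *v v) = r v" "\<And>D. D \<in> T \<Longrightarrow> r (tvec D) = (\<Prod>\<xi>\<leftarrow>\<xi>s. \<xi> D)" by auto
    obtain l where l: "l \<in> dual_V" "\<And>v. l (E 1 *v v) = l v" "\<And>D. D \<in> T \<Longrightarrow> \<xi> D = l (tvec D)"
      using cotangent_form[of \<xi>] Cons.prems by auto
    show ?case
    proof (intro exI[of _ "\<lambda>v. l v * r v"] conjI allI ballI)
      show "homog_poly (length (\<xi> # \<xi>s)) (\<lambda>v. l v * r v)"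
        using homog_poly.mult[OF dual_V_homog[OF l(1)] r(1)] by simp
      show "l (E 1 *v v) * r (E 1 *v v) = l v * r v" for v by (simp only: l(2) r(2))
    qed (simp add: l(3) r(3))
  qed
  then obtain r where r: "homog_poly k r" "\<And>v. r (E 1 *v v) = r v" "\<And>D. D \<in> T \<Longrightarrow> r (tvec D) = (\<Prod>\<xi>\<leftarrow>\<xi>s. \<xi> D)"
    unfolding *(1) by blast
  show ?case
  proof (intro exI[of _ "\<lambda>v. a * r v + q v"] conjI allI ballI)
    show "homog_poly k (\<lambda>v. a * r v + q v)" using q(1) r(1) by (intro homog_poly.add homog_poly_cmult)
    show "a * r (E 1 *v v) + q (E 1 *v v) = a * r v + q v" for v by (simp only: q(2) r(2))
  qed (simp add: r(3) q(3) t sym_value_def)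
qed

lemma ratio_decompose:
  assumes "l \<in> dual_V" shows "ratio l l0 p = (\<Sum>i\<le>K. ratio (\<lambda>v. l (E i *v v)) l0 p)"
proof -
  have "l v = (\<Sum>i\<le>K. l (E i *v v))" for v
  proof -
    have "l v = l (\<Sum>i\<le>K. E i *v v)" by (simp add: E_sum)
    then show ?thesis by (simp only: dual_V_D(6)[OF assms])
  qed
  from arg_cong[OF this, of "\<lambda>a. a / l0 v" for v] show ?thesis
    unfolding ratio_def Let_def sum_divide_distrib .
qed

text \<open>When the weights below \<open>j\<close> vanish and those above lie in
  \<open>M (Suc j)\<close>, the weight \<open>j\<close> part is in \<open>M (Suc j)\<close> as well.
  Its eigenvalue \<open>c ^ j\<close> belongs to order \<open>j\<close> alone, so it
  vanishes.\<close>

lemma low_weight_zero: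
  assumes l: "l \<in> dual_V" and M: "ratio l l0 \<in> M k"
  shows "j < k \<Longrightarrow> l (E j *v v) = 0"
proof (induction j arbitrary: v rule: less_induct)
  case (less j)
  let ?r = "\<lambda>i. ratio (\<lambda>v. l (E i *v v)) l0"
  have zero: "?r i p = 0" if "i < j" for i p
    using less that by (simp add: ratio_def Let_def)
  have high: "?r i \<in> M (Suc j)" if "j < i" for i
    using ideal_power_mono[of "Suc j" i] weight_form_power[OF l, of i] that by simp
  have "(\<lambda>p. \<Sum>i\<in>{..K} - {j}. ?r i p) \<in> M (Suc j)"
  proof (rule ideal_power_sum)
    fix i assume "i \<in> {..K} - {j}"
    then consider "i < j" | "j < i" by fastforce
    then show "?r i \<in> M (Suc j)"
    proof cases
      case 1
      then have "?r i = (\<lambda>_. 0)" using zero by blast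
      then show ?thesis by (simp add: ideal_power_zero)
    qed (rule high)
  qed
  moreover have "ratio l l0 \<in> M (Suc j)" using ideal_power_mono[OF _ M] less.prems by simp
  ultimately have "(\<lambda>p. ratio l l0 p - (\<Sum>i\<in>{..K} - {j}. ?r i p)) \<in> M (Suc j)" by (intro ideal_power_diff)
  moreover have "ratio l l0 p - (\<Sum>i\<in>{..K} - {j}. ?r i p) = ?r j p" for p
  proof (cases "j \<le> K")
    case True
    then show ?thesis unfolding ratio_decompose[OF l] by (simp add: sum.remove[of "{..K}" j])
  next
    case False
    then have "?r j p = 0" using E_out[of j] dual_V_D(4)[OF l] by (simp add: ratio_def Let_def)
    then show ?thesis using False unfolding ratio_decompose[OF l] by simp
  qed
  ultimately have "dehom 1 (\<lambda>v. l (E j *v v)) \<in> M (Suc j)" by simp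
  have ld: "(\<lambda>v. l (E j *v v)) \<in> dual_V" by (rule dual_V_comp_matrix[OF l])
  have eig: "germ_eq Z x (dehom 1 (\<lambda>v. l (E j *v v)) \<circ> h) (\<lambda>p. c ^ j * dehom 1 (\<lambda>v. l (E j *v v)) p)"
    using weight_form_eigen[OF l, of j] by simp
  have "l (E j *v u) = 0" if "u \<in> cone Z" for u
  proof (rule eigen_zero[OF eig dual_V_homog[OF ld] \<open>dehom 1 _ \<in> _\<close> _ that])
    show "c ^ j \<noteq> c ^ i" if "Suc j \<le> i" for i using c_inj[of j i] that by auto
  qed
  then show ?case by (rule dual_zero[OF ld])
qed

text \<open>Converse to \<open>weight_component_form\<close>. For \<open>2 \<le> k\<close> the
  symbol refers to some trivialization \<open>l1\<close>; passing to \<open>l0\<close> multiplies it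
  by \<open>l1 v0\<close>. The weights below \<open>k\<close> vanish by
  \<open>low_weight_zero\<close>, those above lie in \<open>M (Suc k)\<close>, and
  \<open>weight_form_eq\<close> identifies the weight \<open>k\<close> part with the
  polynomial.\<close>

lemma component_chart_form:
  assumes P: "P \<in> fundamental_form Z x k"
  shows "\<exists>l\<in>dual_V. \<forall>D\<in>T. l (chart_point D) = P D"
proof (cases "k < 2")
  case True
  then obtain ts where ts: "ts \<in> sym_terms Z x k" "P = sym_value Z x ts"
    using P by (auto simp: fundamental_form_def sym_power_def)
  obtain q where q: "homog_poly k q" "\<And>v. q (E 1 *v v) = q v" "\<And>D. D \<in> T \<Longrightarrow> q (tvec D) = P D"
    using sym_terms_form[OF ts(1)] ts(2) by blast
  consider "k = 0" | "k = 1" using True by linarith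
  then show ?thesis
  proof cases
    case 1
    then obtain a where "q = (\<lambda>_. a)" using homog_poly_linear[OF q(1)] by blast
    then show ?thesis using q(3) chart_point(2) dual_V_cmult[OF l0_dual, of a]
      by (intro bexI[of _ "\<lambda>v. a * l0 v"]) auto
  next
    case 2
    then have "q \<in> dual_V" using homog_poly_linear[OF q(1)] by blast
    moreover have "q (chart_point D) = P D" if "D \<in> T" for D
      using q(2)[of "chart_point D"] chart_point(3)[OF that] q(3)[OF that] by simp
    ultimately show ?thesis by blast
  qed
next
  case False
  then obtain l l1 where l: "l \<in> jet_kernel Z x (k - 1)" "l1 \<in> dual_V" "nonvanishing l1 x"
    "has_symbol Z x k (ratio l l1) P" using P by (auto simp: fundamental_form_def)
  then have ld: "l \<in> dual_V" and b: "l1 v0 \<noteq> 0" by (auto simp: jet_kernel_def nonvanishing_dual)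
  obtain ts where ts: "ts \<in> ideal_terms Z x k" "germ_eq Z x (ratio l l1) (ideal_value ts)" "P = symbol ts"
    using l(4) by (auto simp: has_symbol_def)
  obtain q where q: "homog_poly k q" "\<And>v. q (E 1 *v v) = q v" "\<And>D. D \<in> T \<Longrightarrow> q (tvec D) = P D"
    "(\<lambda>p. ideal_value ts p - dehom k q p) \<in> M (Suc k)" using ideal_terms_form[OF ts(1)] ts(3) by blast
  have "ratio l l1 \<in> M k"
    unfolding max_ideal_power_def using ts(1,2) by blast
  have ivM: "ideal_value ts \<in> M k" by (rule ideal_power_germ[OF \<open>ratio l l1 \<in> M k\<close> ts(2)])
  have "(\<lambda>p. ideal_value ts p - (ideal_value ts p - dehom k q p)) \<in> M k"
    by (rule ideal_power_diff[OF ivM ideal_power_Suc_sub[OF q(4)]])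
  then have qM: "dehom k q \<in> M k" by simp
  let ?g = "ratio l1 l0"
  have gO: "?g \<in> O\<^sub>x" by (rule ratio_l0_local[OF l(2)])
  have gx: "?g x = l1 v0" using ratio_l0_line[OF l(2) base(2)] by (simp add: l0_base)
  have change: "germ_eq Z x (\<lambda>p. ?g p * ratio l l1 p) (ratio l l0)"
    by (rule ratio_change[OF ld l(2) b l0_dual]) (simp add: l0_base)
  have 1: "(\<lambda>p. ?g p * (ideal_value ts p - dehom k q p)) \<in> M (Suc k)" by (rule ideal_power_mult_local[OF gO q(4)])
  have 2: "(\<lambda>p. (?g p - ?g x) * dehom k q p) \<in> M (Suc k)"
    using ideal_power_mult[OF max_ideal_power_1[OF local_ring_minus_value[OF gO]] qM] by simp
  have "(\<lambda>p. ?g p * (ideal_value ts p - dehom k q p) + (?g p - ?g x) * dehom k q p) \<in> M (Suc k)"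
    by (rule ideal_power_add[OF 1 2])
  moreover have "germ_eq Z x (\<lambda>p. ?g p * (ideal_value ts p - dehom k q p) + (?g p - ?g x) * dehom k q p)
      (\<lambda>p. ratio l l0 p - l1 v0 * dehom k q p)"
    using change ts(2) unfolding germ_eq_def by eventually_elim (simp add: gx algebra_simps)
  ultimately have 3: "(\<lambda>p. ratio l l0 p - l1 v0 * dehom k q p) \<in> M (Suc k)" by (rule ideal_power_germ)
  \<comment> \<open>The factor undoes the change of trivialization, so that the symbol with respect
    to \<open>l0\<close> is represented by \<open>q\<close> itself.\<close>
  define l2 where "l2 = (\<lambda>v. (1 / l1 v0) * l v)"
  have l2: "l2 \<in> dual_V" unfolding l2_def by (rule dual_V_cmult[OF ld])
  have r2: "ratio l2 l0 p = (1 / l1 v0) * ratio l l0 p" for p by (simp add: ratio_def Let_def l2_def)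
  have "(\<lambda>p. (1 / l1 v0) * (ratio l l0 p - l1 v0 * dehom k q p)) \<in> M (Suc k)" by (rule ideal_power_cmult[OF 3])
  then have 4: "(\<lambda>p. ratio l2 l0 p - dehom k q p) \<in> M (Suc k)" using b by (simp add: r2 right_diff_distrib)
  from ideal_power_add[OF ideal_power_Suc_sub[OF this] qM] have l2M: "ratio l2 l0 \<in> M k" by simp
  let ?r = "\<lambda>i. ratio (\<lambda>v. l2 (E i *v v)) l0"
  have 5: "(\<lambda>p. \<Sum>i\<in>{..K} - {k}. ?r i p) \<in> M (Suc k)"
  proof (rule ideal_power_sum)
    fix i assume "i \<in> {..K} - {k}"
    then consider "i < k" | "k < i" by fastforce
    then show "?r i \<in> M (Suc k)"
    proof cases
      case 1
      then have "?r i = (\<lambda>_. 0)" using low_weight_zero[OF l2 l2M 1] by (simp add: ratio_def Let_def fun_eq_iff)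
      then show ?thesis by (simp add: ideal_power_zero)
    next
      case 2
      then show ?thesis using ideal_power_mono[of "Suc k" i] weight_form_power[OF l2, of i] by simp
    qed
  qed
  have 6: "(ratio l2 l0 p - dehom k q p) - (\<Sum>i\<in>{..K} - {k}. ?r i p) = ?r k p - dehom k q p" for p
  proof (cases "k \<le> K")
    case True
    then show ?thesis unfolding ratio_decompose[OF l2] by (simp add: sum.remove[of "{..K}" k])
  next
    case False
    then have "?r k p = 0" using E_out[of k] dual_V_D(4)[OF l2] by (simp add: ratio_def Let_def)
    then show ?thesis using False unfolding ratio_decompose[OF l2] by simp
  qed
  from ideal_power_diff[OF 4 5] have 7: "(\<lambda>p. ?r k p - dehom k q p) \<in> M (Suc k)" unfolding 6 .
  have "l2 (E k *v chart_point D) = P D" if "D \<in> T" for D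
    using weight_form_eq[OF l2 q(1,2) 7 chart_point(1,2)[OF that]] q(2)[of "chart_point D"]
      chart_point(3)[OF that] q(3)[OF that] by simp
  then show ?thesis using dual_V_comp_matrix[OF l2, of "E k"] by (intro bexI[of _ "\<lambda>v. l2 (E k *v v)"]) auto
qed

lemma chart_sum_form:
  assumes P: "P \<in> fundamental_system Z x"
  shows "\<exists>l\<in>dual_V. \<forall>D\<in>T. l (chart_point D) = (\<Sum>k | P k \<noteq> 0. P k D)"
proof -
  have "\<forall>k. \<exists>l. l \<in> dual_V \<and> (\<forall>D\<in>T. l (chart_point D) = P k D)"
    using P component_chart_form unfolding fundamental_system_def by blast
  then obtain l where l: "\<And>k. l k \<in> dual_V" "\<And>k D. D \<in> T \<Longrightarrow> l k (chart_point D) = P k D" by metis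
  have "(\<lambda>v. \<Sum>k | P k \<noteq> 0. l k v) \<in> dual_V" using l(1) by (rule dual_V_sum)
  then show ?thesis using l(2) by (intro bexI[of _ "\<lambda>v. \<Sum>k | P k \<noteq> 0. l k v"]) auto
qed

text \<open>Reflexivity of the tangent space. The coordinate covectors \<open>?e i\<close> span,
  though they need not be independent; the vector of the values of \<open>\<Lambda>\<close> on them
  is projected by \<open>E 1\<close> to a tangent vector, which covectors do not notice.\<close>

lemma cotangent_bidual:
  assumes add: "\<And>\<xi> \<eta>. \<xi> \<in> cotangent_space Z x \<Longrightarrow> \<eta> \<in> cotangent_space Z x \<Longrightarrow> \<Lambda> (\<xi> + \<eta>) = \<Lambda> \<xi> + \<Lambda> \<eta>"
    and scale: "\<And>a \<xi>. \<xi> \<in> cotangent_space Z x \<Longrightarrow> \<Lambda> (\<lambda>D. a * \<xi> D) = a * \<Lambda> \<xi>"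
  obtains D where "D \<in> T" "\<And>\<xi>. \<xi> \<in> cotangent_space Z x \<Longrightarrow> \<Lambda> \<xi> = \<xi> D"
proof -
  let ?e = "\<lambda>i D. if D \<in> T then tvec D $ i else 0"
  have e: "?e i \<in> cotangent_space Z x" for i by (rule tangent_form_cotangent[OF dual_V_coord])
  have cot_zero: "(\<lambda>D. 0) \<in> cotangent_space Z x" unfolding cotangent_space_def by simp
  have \<Lambda>0: "\<Lambda> (\<lambda>D. 0) = 0" using scale[OF cot_zero, of 0] by simp
  have sum: "(\<lambda>D. \<Sum>i\<in>I. a i * ?e i D) \<in> cotangent_space Z x \<and>
      \<Lambda> (\<lambda>D. \<Sum>i\<in>I. a i * ?e i D) = (\<Sum>i\<in>I. a i * \<Lambda> (?e i))" if "finite I" for I :: "'n set" and a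
    using that
  proof (induction I)
    case empty
    then show ?case using cot_zero \<Lambda>0 by simp
  next
    case (insert i I)
    have eq: "(\<lambda>D. \<Sum>j\<in>insert i I. a j * ?e j D) = (\<lambda>D. a i * ?e i D) + (\<lambda>D. \<Sum>j\<in>I. a j * ?e j D)"
      using insert.hyps by (auto simp: plus_fun_def)
    show ?case unfolding eq
      using add[OF cotangent_space_cmult[OF e[of i], of "a i"], of "\<lambda>D. \<Sum>j\<in>I. a j * ?e j D"] scale[OF e[of i], of "a i"]
        cotangent_space_add[OF cotangent_space_cmult[OF e[of i], of "a i"], of "\<lambda>D. \<Sum>j\<in>I. a j * ?e j D"] insert by simp
  qed
  define w where "w = (\<chi> i. \<Lambda> (?e i))"
  show ?thesis
  proof (rule that[of "tangent_of w"])
    fix \<xi> assume \<xi>: "\<xi> \<in> cotangent_space Z x"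
    obtain l where l: "l \<in> dual_V" "\<And>v. l (E 1 *v v) = l v" "\<And>D. D \<in> T \<Longrightarrow> \<xi> D = l (tvec D)"
      using cotangent_form[OF \<xi>] by blast
    have "\<xi> = (\<lambda>D. \<Sum>i\<in>UNIV. l (axis i 1) * ?e i D)"
    proof
      fix D
      show "\<xi> D = (\<Sum>i\<in>UNIV. l (axis i 1) * ?e i D)"
      proof (cases "D \<in> T")
        case True
        then show ?thesis using l(3)[OF True] dual_V_expand[OF l(1), of "tvec D"] by simp
      next
        case False
        then show ?thesis using \<xi> unfolding cotangent_space_def by simp
      qed
    qed
    then have "\<Lambda> \<xi> = (\<Sum>i\<in>UNIV. l (axis i 1) * \<Lambda> (?e i))" using sum[of UNIV "\<lambda>i. l (axis i 1)"] by simp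
    also have "\<dots> = l w" by (subst dual_V_expand[OF l(1)]) (simp add: w_def)
    also have "\<dots> = \<xi> (tangent_of w)" using l(3)[OF tangent_of(1)] l(2)[of w] tangent_of(2)[of w] by simp
    finally show "\<Lambda> \<xi> = \<xi> (tangent_of w)" .
  qed (rule tangent_of)
qed

end

subsection \<open>Actions of Euler type are graded\<close>

text \<open>This is \<open>k = a + i * (b - a)\<close> with the subtractions moved across, as
  \<open>b\<close> may be smaller than \<open>a\<close>.\<close>

lemma two_power_ratio:
  "(2 ^ b / 2 ^ a) ^ i * (2 :: complex) ^ a = 2 ^ k \<longleftrightarrow> k + a * i = a + b * i"
proof -
  have "(2 ^ b / 2 ^ a) ^ i * (2 :: complex) ^ a = 2 ^ k \<longleftrightarrow> (2 :: complex) ^ (a + b * i) = 2 ^ (k + a * i)"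
    by (simp add: power_divide power_mult power_add field_simps)
  also have "\<dots> \<longleftrightarrow> k + a * i = a + b * i" using two_power_inject by metis
  finally show ?thesis .
qed

text \<open>The weights as the group gives them, before comparison with the scalar on the tangent
  space: \<open>F k\<close> belongs to the eigenvalue \<open>2 ^ k / 2 ^ N\<close>, and
  \<open>l0\<close> is taken in the weight \<open>a\<close> of \<open>v0\<close>.\<close>

locale weighted_variety = charted_variety Z v0 l0
  for Z :: "('n::finite) ppoint set" and v0 :: "complex ^ 'n" and l0 +
  fixes S :: "complex ^ 'n ^ 'n" and F :: "nat \<Rightarrow> complex ^ 'n ^ 'n" and M N a :: nat
  assumes F_F: "F k *v (F l *v v) = (if k = l then F k *v v else 0)"
    and F_sum: "(\<Sum>k\<le>M. F k *v v) = v" and F_out: "k > M \<Longrightarrow> F k = 0"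
    and S_F: "2 ^ N *s (S *v v) = (\<Sum>k\<le>M. 2 ^ k *s (F k *v v))"
    and S_inj': "S *v v = 0 \<Longrightarrow> v = 0" and S_Z': "proj_map S ` Z = Z"
    and a: "a \<le> M" "F a *v v0 = v0" and l0_F: "l0 (F a *v v) = l0 v"
    and nondegenerate': "nondegenerate Z"
begin

lemma F_S: "F k *v (S *v v) = (2 ^ k / 2 ^ N) *s (F k *v v)"
proof (cases "k \<le> M")
  case True
  have "2 ^ N *s (F k *v (S *v v)) = F k *v (\<Sum>l\<le>M. 2 ^ l *s (F l *v v))"
    by (simp add: S_F[symmetric] vec.scale)
  also have "\<dots> = (\<Sum>l\<le>M. if l = k then 2 ^ k *s (F k *v v) else 0)"
    unfolding vec.sum by (rule sum.cong) (auto simp: vec.scale F_F)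
  also have "\<dots> = 2 ^ k *s (F k *v v)" using True by simp
  finally have "(1 / 2 ^ N) *s (2 ^ N *s (F k *v (S *v v))) = (1 / 2 ^ N) *s (2 ^ k *s (F k *v v))" by simp
  then show ?thesis by (simp add: vector_smult_assoc)
qed (use F_out in simp)

lemma F_v0: "F k *v v0 = (if k = a then v0 else 0)"
  using F_F[of k a v0] a(2) by (cases "k = a") auto

lemma S_v0': "S *v v0 = (2 ^ a / 2 ^ N) *s v0"
proof -
  have "S *v v0 = (\<Sum>k\<le>M. F k *v (S *v v0))" by (simp add: F_sum)
  also have "\<dots> = (\<Sum>k\<le>M. if k = a then (2 ^ a / 2 ^ N) *s v0 else 0)"
    by (rule sum.cong) (auto simp: F_S F_v0)
  finally show ?thesis using a(1) by simp
qed

lemma l0_S': "l0 (S *v v) = (2 ^ a / 2 ^ N) * l0 v"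
  using l0_F[of "S *v v"] l0_F[of v] by (simp add: F_S dual_V_D[OF l0_dual])

lemma scaled:
  assumes "\<And>D \<phi>. D \<in> T \<Longrightarrow> D (\<phi> \<circ> proj_map S) = c * D \<phi>"
  shows "scaled_variety Z v0 l0 S (2 ^ a / 2 ^ N) c"
  by unfold_locales (use S_inj' S_Z' S_v0' l0_S' nondegenerate' assms in auto)

lemma weight_eigen:
  assumes sc: "scaled_variety Z v0 l0 S (2 ^ a / 2 ^ N) c" and l: "l \<in> dual_V"
  shows "germ_eq Z x (ratio (\<lambda>v. l (F k *v v)) l0 \<circ> proj_map S)
    (\<lambda>p. 2 ^ k / 2 ^ a * ratio (\<lambda>v. l (F k *v v)) l0 p)"
proof -
  interpret S: scaled_variety Z v0 l0 S "2 ^ a / 2 ^ N" c by (rule sc)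
  show ?thesis
    using S.dehom_eigen[OF dual_V_homog[OF dual_V_comp_matrix[OF l, of "F k"]], of "2 ^ k / 2 ^ N"]
    by (simp add: F_S dual_V_D[OF l])
qed

text \<open>Linear forms of this weight have an eigenvalue that is no power of \<open>c\<close>, so
  they lie in all powers of the maximal ideal and vanish on \<open>Z\<close>.\<close>

lemma F_zero:
  assumes sc: "scaled_variety Z v0 l0 S (2 ^ a / 2 ^ N) c" and k: "\<And>i. 2 ^ k / 2 ^ a \<noteq> c ^ i"
  shows "F k *v v = 0"
proof -
  interpret S: scaled_variety Z v0 l0 S "2 ^ a / 2 ^ N" c by (rule sc)
  have "(F k *v v) $ j = 0" for j
  proof -
    let ?l = "\<lambda>v. (F k *v v) $ j"
    have ld: "?l \<in> dual_V" by (rule dual_V_comp_matrix[OF dual_V_coord])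
    have eig: "germ_eq Z x (dehom 1 ?l \<circ> proj_map S) (\<lambda>p. 2 ^ k / 2 ^ a * dehom 1 ?l p)"
      using weight_eigen[OF sc dual_V_coord, of k j] by simp
    have M0: "dehom 1 ?l \<in> max_ideal_power Z x 0"
      unfolding ideal_power_0 by (rule dehom_local[OF dual_V_homog[OF ld]])
    have "?l u = 0" if "u \<in> cone Z" for u
      by (rule S.eigen_zero[OF eig dual_V_homog[OF ld] M0 k that])
    then show ?thesis by (rule S.dual_zero[OF ld])
  qed
  then show ?thesis by (simp add: vec_eq_iff)
qed

text \<open>The difference of a coordinate of the two sides has relative eigenvalue 1 and vanishes
  at \<open>v0\<close>, so it starts in order 1, where no \<open>c ^ i\<close> equals 1. The weight
  \<open>a\<close> part of \<open>V\<close> is thereby a line.\<close>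

lemma F_a:
  assumes sc: "scaled_variety Z v0 l0 S (2 ^ a / 2 ^ N) c" and c: "\<And>i. c ^ i = 1 \<Longrightarrow> i = 0"
  shows "F a *v v = l0 v *s v0"
proof -
  interpret S: scaled_variety Z v0 l0 S "2 ^ a / 2 ^ N" c by (rule sc)
  have "(F a *v v) $ j - v0 $ j * l0 v = 0" for j
  proof -
    let ?l = "\<lambda>v. (F a *v v) $ j - v0 $ j * l0 v"
    have ld: "?l \<in> dual_V"
      using dual_V_add[OF dual_V_comp_matrix[OF dual_V_coord, of "F a" j] dual_V_cmult[OF l0_dual, of "- (v0 $ j)"]] by simp
    have "?l (S *v u) = 2 ^ a / 2 ^ N * ?l u" for u
      by (simp add: F_S l0_S' algebra_simps)
    from S.dehom_eigen[OF dual_V_homog[OF ld] this]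
    have eig: "germ_eq Z x (dehom 1 ?l \<circ> proj_map S) (\<lambda>p. 1 * dehom 1 ?l p)" by simp
    have "dehom 1 ?l x = 0" using dehom_line[OF dual_V_homog[OF ld] base(2)] by (simp add: F_v0 l0_base)
    then have "dehom 1 ?l \<in> max_ideal Z x" using dehom_local[OF dual_V_homog[OF ld]] by (simp add: max_ideal_iff)
    then have M1: "dehom 1 ?l \<in> max_ideal_power Z x 1" by (rule max_ideal_power_1)
    have "?l u = 0" if "u \<in> cone Z" for u
      by (rule S.eigen_zero[OF eig dual_V_homog[OF ld] M1 _ that]) (use c in force)
    then show ?thesis by (rule S.dual_zero[OF ld])
  qed
  then show ?thesis by (simp add: vec_eq_iff mult.commute)
qed

lemma graded:
  assumes sc: "scaled_variety Z v0 l0 S (2 ^ a / 2 ^ N) (2 ^ b / 2 ^ a)" and ab: "b \<noteq> a"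
    and ns: "enat (fun_space.dim T) = variety_dim Z"
  shows "\<exists>E K. graded_variety Z v0 l0 S (2 ^ a / 2 ^ N) (2 ^ b / 2 ^ a) E K"
proof -
  interpret S: scaled_variety Z v0 l0 S "2 ^ a / 2 ^ N" "2 ^ b / 2 ^ a" by (rule sc)
  let ?c = "2 ^ b / 2 ^ a :: complex"
  \<comment> \<open>The weight with eigenvalue \<open>c ^ i\<close> relative to \<open>l0\<close>.
    It is an integer because it may leave the natural numbers when \<open>b < a\<close>; such
    indices get \<open>E i = 0\<close>.\<close>
  define m where "m i = int a + int i * (int b - int a)" for i :: nat
  define E where "E i = (if m i \<ge> 0 then F (nat (m i)) else 0)" for i
  have m: "?c ^ i * 2 ^ a = 2 ^ k \<longleftrightarrow> m i = int k" for i k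
    unfolding two_power_ratio m_def by (auto simp: of_nat_eq_iff[where ?'a = int, symmetric] algebra_simps)
  have m_inj: "i = j" if "m i = m j" for i j using that ab by (simp add: m_def)
  \<comment> \<open>For \<open>i > a + M\<close> this pushes \<open>m i\<close> out of the range
    from 0 to \<open>M\<close>, so \<open>a + M\<close> bounds the new indices.\<close>
  have far: "\<bar>m i - int a\<bar> \<ge> int i" for i
  proof -
    have "\<bar>m i - int a\<bar> = int i * \<bar>int b - int a\<bar>" by (simp add: m_def abs_mult)
    moreover have "1 \<le> \<bar>int b - int a\<bar>" using ab by linarith
    ultimately show ?thesis using mult_left_mono[of 1 "\<bar>int b - int a\<bar>" "int i"] by simp
  qed
  have c_inj: "i = j" if "?c ^ i = ?c ^ j" for i j
  proof -
    have "(2 :: complex) ^ (a + b * i + a * j) = 2 ^ (a + b * j + a * i)"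
      using that by (simp add: power_divide power_mult power_add field_simps)
    then have "a + b * i + a * j = a + b * j + a * i" by (rule two_power_inject)
    then have "(int b - int a) * (int i - int j) = 0"
      by (simp add: of_nat_eq_iff[where ?'a = int, symmetric] algebra_simps)
    then show ?thesis using ab by simp
  qed
  have Fz: "F k *v v = 0" if "\<And>i. m i \<noteq> int k" for k v
  proof (rule F_zero[OF sc])
    fix i show "2 ^ k / 2 ^ a \<noteq> ?c ^ i"
    proof
      assume "2 ^ k / 2 ^ a = ?c ^ i"
      then have "?c ^ i * 2 ^ a = 2 ^ k" by (metis nonzero_eq_divide_eq power_not_zero zero_neq_numeral)
      then show False using m that by blast
    qed
  qed
  have "graded_variety Z v0 l0 S (2 ^ a / 2 ^ N) ?c E (a + M)"
  proof unfold_locales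
    show "E i *v (E j *v v) = (if i = j then E i *v v else 0)" for i j v
      using m_inj[of i j] by (auto simp: E_def F_F nat_eq_iff)
    show "E i = 0" if "i > a + M" for i
    proof -
      have "m i < 0 \<or> nat (m i) > M" using far[of i] that by linarith
      then show ?thesis using F_out by (auto simp: E_def)
    qed
    show "(\<Sum>i\<le>a + M. E i *v v) = v" for v
    proof -
      let ?I = "{i. i \<le> a + M \<and> m i \<ge> 0}"
      have "(\<Sum>i\<le>a + M. E i *v v) = (\<Sum>i\<in>?I. F (nat (m i)) *v v)"
        by (rule sum.mono_neutral_cong_right) (auto simp: E_def)
      also have "\<dots> = (\<Sum>k\<in>(\<lambda>i. nat (m i)) ` ?I. F k *v v)"
        by (rule sum.reindex_cong[symmetric, of "\<lambda>i. nat (m i)"]) (auto simp: inj_on_def intro: m_inj)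
      also have "\<dots> = (\<Sum>k\<le>M. F k *v v)"
      proof (rule sum.mono_neutral_cong)
        fix k assume k: "k \<in> {..M} - (\<lambda>i. nat (m i)) ` ?I"
        show "F k *v v = 0"
        proof (rule Fz)
          fix i show "m i \<noteq> int k"
          proof
            assume mi: "m i = int k"
            then have "i \<le> a + M" using far[of i] k by auto
            then have "i \<in> ?I" using mi by simp
            then have "nat (m i) \<in> (\<lambda>i. nat (m i)) ` ?I" by (rule imageI)
            then show False using k mi by simp
          qed
        qed
      qed (use F_out in auto)
      finally show ?thesis by (simp add: F_sum)
    qed
    show "E 0 *v v = l0 v *s v0" for v
    proof -
      have "F a *v v = l0 v *s v0" by (rule F_a[OF sc]) (use c_inj[of _ 0] in auto)
      then show ?thesis by (simp add: E_def m_def)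
    qed
    show "E i *v (S *v v) = (2 ^ a / 2 ^ N * ?c ^ i) *s (E i *v v)" for i v
    proof (cases "m i \<ge> 0")
      case True
      then have "?c ^ i * 2 ^ a = 2 ^ nat (m i)" using m[of i "nat (m i)"] by simp
      then show ?thesis using True by (simp add: E_def F_S mult.commute)
    qed (simp add: E_def)
  qed (use c_inj ns in auto)
  then show ?thesis by blast
qed

end

text \<open>The fixed line has a weight \<open>a\<close>. A nonzero tangent vector is nonzero on the
  weight \<open>b\<close> part of some coordinate, and comparing the two scalings of its value there
  yields \<open>c = 2 ^ b / 2 ^ a\<close>.\<close>

lemma euler_type_graded:
  assumes Z: "projective_variety Z" "nondegenerate Z" and eu: "euler_type_at Z p \<rho>"
  obtains v0 l0 S \<mu> c E K where "graded_variety Z v0 l0 S \<mu> c E K" "p = line v0"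
proof -
  note e = eu[unfolded euler_type_at_def nonsingular_at_def]
  have ns: "p \<in> Z" "enat (fun_space.dim (tangent_space Z p)) = variety_dim Z"
    using e[THEN conjunct1] by simp_all
  note ms = e[THEN conjunct2, THEN conjunct1]
  note inv = e[THEN conjunct2, THEN conjunct2, THEN conjunct1, rule_format]
  obtain U where U: "openin (zariski_on Z) U" "U \<inter> {z \<in> Z. \<forall>t. t \<noteq> 0 \<longrightarrow> proj_map (\<rho> t) z = z} = {p}"
    using e[THEN conjunct2, THEN conjunct2, THEN conjunct2, THEN conjunct1] by (elim exE conjE)
  note tan = e[THEN conjunct2, THEN conjunct2, THEN conjunct2, THEN conjunct2, rule_format]
  obtain v0 where v0: "v0 \<noteq> 0" "p = line v0" using ns(1) variety_subset[OF Z(1)] proj_space_line by blast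
  obtain F M N where F0: "(\<forall>t v. t \<noteq> 0 \<longrightarrow> t ^ N *s (\<rho> t *v v) = (\<Sum>k\<le>M. t ^ k *s (F k *v v))) \<and>
    (\<forall>k l. F k ** F l = (if k = l then F k else 0)) \<and> (\<forall>v. (\<Sum>k\<le>M. F k *v v) = v) \<and> (\<forall>k>M. F k = 0)"
    using one_parameter_decomposition[OF ms] by (elim exE)
  then have F: "\<And>t v. t \<noteq> 0 \<Longrightarrow> t ^ N *s (\<rho> t *v v) = (\<Sum>k\<le>M. t ^ k *s (F k *v v))"
    "\<And>k l. F k ** F l = (if k = l then F k else 0)" "\<And>v. (\<Sum>k\<le>M. F k *v v) = v" "\<And>k. k > M \<Longrightarrow> F k = 0"
    by blast+
  have FF: "F k *v (F l *v v) = (if k = l then F k *v v else 0)" for k l v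
    by (simp add: matrix_vector_mul_assoc F(2))
  let ?S = "\<rho> 2"
  have "p \<in> U \<inter> {z \<in> Z. \<forall>t. t \<noteq> 0 \<longrightarrow> proj_map (\<rho> t) z = z}" unfolding U(2) by simp
  then have "proj_map ?S p = p" by simp
  then have "?S *v v0 \<in> line v0" using imageI[OF mem_line[of v0], of "(*v) ?S"] v0(2) unfolding proj_map_def by simp
  then obtain d where "?S *v v0 = d *s v0" by (auto simp: line_def)
  then have "(\<Sum>k\<le>M. 2 ^ k *s (F k *v v0)) = (2 ^ N * d) *s v0"
    using F(1)[of 2 v0] by (simp add: vector_smult_assoc)
  then obtain a where a: "a \<le> M" "F a *v v0 = v0" by (rule fixed_line_weight[OF F(2,3) v0(1)])
  have "v0 \<notin> {0}" using v0(1) by simp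
  from separating_form[OF vec.subspace_single_0 this] obtain l where l: "l \<in> dual_V" "l v0 = 1" by blast
  \<comment> \<open>Composition with \<open>F a\<close> makes the form an eigenform without changing
    its value at \<open>v0\<close>.\<close>
  define l0 where "l0 = (\<lambda>v. l (F a *v v))"
  have inj: "v = 0" if "?S *v v = 0" for v
  proof -
    have "\<rho> 1 = mat 1" using ms by (simp add: multiplicative_subgroup_def)
    moreover have "\<rho> (1 / 2 * 2) = \<rho> (1 / 2) ** \<rho> 2"
      using ms[unfolded multiplicative_subgroup_def, THEN conjunct2, THEN conjunct1, rule_format, of "1 / 2" 2] by simp
    ultimately have "\<rho> (1 / 2) ** \<rho> 2 = mat 1" by simp
    then have "v = \<rho> (1 / 2) *v (\<rho> 2 *v v)" by (simp add: matrix_vector_mul_assoc)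
    then show ?thesis using that by simp
  qed
  interpret W: weighted_variety Z v0 l0 ?S F M N a
  proof unfold_locales
    show "l0 \<in> dual_V" unfolding l0_def by (rule dual_V_comp_matrix[OF l(1)])
    show "v0 \<in> cone Z" using v0 ns(1) by (simp add: cone_def)
    show "l0 (F a *v v) = l0 v" for v by (simp add: l0_def FF)
  qed (use Z FF F a l v0 inv inj in \<open>auto simp: l0_def\<close>)
  obtain c where "\<forall>D\<in>tangent_space Z p. tangent_map (proj_map ?S) D = (\<lambda>\<phi>. c * D \<phi>)"
    using tan[of 2] by auto
  then have c: "D (\<phi> \<circ> proj_map ?S) = c * D \<phi>" if "D \<in> tangent_space Z (line v0)" for D \<phi>
    using that v0(2) by (simp add: tangent_map_def fun_eq_iff)
  have ns': "enat (fun_space.dim W.T) = variety_dim Z" using ns(2) v0(2) by simp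
  have "\<exists>b. b \<noteq> a \<and> scaled_variety Z v0 l0 ?S (2 ^ a / 2 ^ N) (2 ^ b / 2 ^ a)"
  proof (cases "\<forall>D\<in>W.T. \<forall>\<phi>. D \<phi> = 0")
    case True
    \<comment> \<open>With a zero tangent space every scalar satisfies the condition;
      \<open>Suc a\<close> is chosen only to have \<open>b \<noteq> a\<close>, that is
      \<open>c = 2\<close>.\<close>
    have "scaled_variety Z v0 l0 ?S (2 ^ a / 2 ^ N) (2 ^ Suc a / 2 ^ a)"
    proof (rule W.scaled)
      fix D \<phi> assume "D \<in> W.T"
      then have "D \<psi> = 0" for \<psi> using True by blast
      then show "D (\<phi> \<circ> proj_map ?S) = 2 ^ Suc a / 2 ^ a * D \<phi>" by simp
    qed
    then show ?thesis by (intro exI[of _ "Suc a"]) simp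
  next
    case False
    then obtain D where D: "D \<in> W.T" "D \<noteq> (\<lambda>_. 0)" by (auto simp: fun_eq_iff)
    then have "W.tvec D \<noteq> W.tvec (\<lambda>_. 0)" using W.tvec_inj W.tangent_zero by blast
    then obtain i where i: "D (ratio (\<lambda>v. v $ i) l0) \<noteq> 0" by (auto simp: W.tvec_def vec_eq_iff)
    have "ratio (\<lambda>v. v $ i) l0 = (\<lambda>p. \<Sum>k\<le>M. ratio (\<lambda>v. (F k *v v) $ i) l0 p)"
    proof
      fix p
      have "v $ i = (\<Sum>k\<le>M. (F k *v v) $ i)" for v
        using arg_cong[OF F(3)[of v], of "\<lambda>v. v $ i"] by simp
      from arg_cong[OF this, of "\<lambda>a. a / l0 v" for v]
      show "ratio (\<lambda>v. v $ i) l0 p = (\<Sum>k\<le>M. ratio (\<lambda>v. (F k *v v) $ i) l0 p)"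
        unfolding ratio_def Let_def sum_divide_distrib .
    qed
    moreover have loc: "ratio (\<lambda>v. (F k *v v) $ i) l0 \<in> local_ring Z (line v0)" for k
      by (rule W.ratio_l0_local[OF dual_V_comp_matrix[OF dual_V_coord]])
    ultimately have "D (ratio (\<lambda>v. v $ i) l0) = (\<Sum>k\<le>M. D (ratio (\<lambda>v. (F k *v v) $ i) l0))"
      using W.tangent_sum[OF D(1), of "{..M}" "\<lambda>k. ratio (\<lambda>v. (F k *v v) $ i) l0"] by simp
    then obtain b where b: "D (ratio (\<lambda>v. (F b *v v) $ i) l0) \<noteq> 0"
      using i by (metis (no_types, lifting) sum.neutral)
    let ?f = "ratio (\<lambda>v. (F b *v v) $ i) l0"
    have sc: "scaled_variety Z v0 l0 ?S (2 ^ a / 2 ^ N) c" by (rule W.scaled[OF c])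
    interpret S: scaled_variety Z v0 l0 ?S "2 ^ a / 2 ^ N" c by (rule sc)
    have "c * D ?f = D (?f \<circ> proj_map ?S)" by (rule c[OF D(1), symmetric])
    also have "\<dots> = D (\<lambda>p. 2 ^ b / 2 ^ a * ?f p)"
      by (rule W.tangent_D(1)[OF D(1) S.local_ring_h[OF loc] W.local_ring_cmult[OF loc] W.weight_eigen[OF sc dual_V_coord]])
    also have "\<dots> = 2 ^ b / 2 ^ a * D ?f" by (rule W.tangent_D(3)[OF D(1) loc loc])
    finally have cb: "c = 2 ^ b / 2 ^ a" unfolding mult_right_cancel[OF b] .
    have "b \<noteq> a"
    proof
      assume "b = a"
      then have "c = 1" using cb by simp
      \<comment> \<open>For \<open>c = 1\<close> the weights other than \<open>a\<close> are absent,
        so each \<open>\<rho> t\<close> with \<open>t \<noteq> 0\<close> is a scalar matrix and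
        fixes every point of \<open>Z\<close>.\<close>
      have F0: "F k *v v = 0" if "k \<noteq> a" for k v
      proof (rule W.F_zero[OF sc])
        have "(2 :: complex) ^ k \<noteq> 2 ^ a" using two_power_inject that by blast
        then show "2 ^ k / 2 ^ a \<noteq> c ^ j" for j by (simp add: \<open>c = 1\<close>)
      qed
      have sumF: "(\<Sum>k\<le>M. s k *s (F k *v v)) = s a *s (F a *v v)" for s v
      proof -
        have "(\<Sum>k\<le>M. s k *s (F k *v v)) = (\<Sum>k\<le>M. if k = a then s a *s (F a *v v) else 0)"
          by (rule sum.cong) (auto simp: F0)
        then show ?thesis using a(1) by simp
      qed
      have Fa: "F a *v v = v" for v using sumF[of "\<lambda>_. 1" v] F(3)[of v] by simp
      have fixed: "proj_map (\<rho> t) z = z" if z: "z \<in> Z" and t: "t \<noteq> 0" for z t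
      proof -
        obtain v where v: "v \<noteq> 0" "z = line v" using z variety_subset[OF Z(1)] proj_space_line by blast
        have "t ^ N *s (\<rho> t *v u) = t ^ a *s u" for u
          using F(1)[OF t, of u] sumF[of "\<lambda>k. t ^ k" u] by (simp add: Fa)
        then have "(1 / t ^ N) *s (t ^ N *s (\<rho> t *v u)) = (1 / t ^ N) *s (t ^ a *s u)" for u by simp
        then have "\<rho> t *v u = (t ^ a / t ^ N) *s u" for u using t by (simp add: vector_smult_assoc)
        then have "proj_map (\<rho> t) (line v) = line ((t ^ a / t ^ N) *s v)"
          by (auto simp: proj_map_def line_def image_image vector_smult_assoc mult.commute)
        then show ?thesis using t v(2) by (simp add: line_scale)
      qed
      have "U \<subseteq> Z" using U(1) openin_subset by fastforce
      \<comment> \<open>The point is then open in \<open>Z\<close>, every germ is constant, and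
        derivations kill constants, against the choice of \<open>b\<close>.\<close>
      then have "U = {p}" using U(2) fixed by blast
      then have "W.near (\<lambda>z. z = line v0)"
        unfolding eventually_nhdsin using U(1) v0(2) by blast
      then have "germ_eq Z (line v0) ?f (\<lambda>_. ?f (line v0))"
        unfolding germ_eq_def by (auto elim: eventually_mono)
      then have "D ?f = D (\<lambda>_. ?f (line v0))" by (rule W.tangent_D(1)[OF D(1) loc W.local_ring_const])
      then show False using W.tangent_const[OF D(1)] b by simp
    qed
    then show ?thesis using sc unfolding cb by blast
  qed
  then obtain b where b: "b \<noteq> a" "scaled_variety Z v0 l0 ?S (2 ^ a / 2 ^ N) (2 ^ b / 2 ^ a)" by blast
  from W.graded[OF b(2,1) ns'] show ?thesis using that v0(2) by blast
qed

subsection \<open>Reconstruction from the fundamental forms\<close>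

text \<open>The map on symmetric powers is given as a relation between values of expressions. At
  tangent vectors corresponding under the transpose of \<open>\<phi>\<close>, the two expressions
  agree term by term, whichever expression is chosen.\<close>

lemma sym_power_map_related:
  assumes "(P, Q) \<in> sym_power_map Z1 x1 Z2 x2 \<phi> k"
    and D: "D1 \<in> tangent_space Z1 x1" "D2 \<in> tangent_space Z2 x2"
      "\<And>\<xi>. \<xi> \<in> cotangent_space Z1 x1 \<Longrightarrow> \<phi> \<xi> D2 = \<xi> D1"
  shows "P D1 = Q D2"
proof -
  obtain ts where ts: "ts \<in> sym_terms Z1 x1 k" "P = sym_value Z1 x1 ts"
    "Q = sym_value Z2 x2 (map (\<lambda>(c, \<xi>s). (c, map \<phi> \<xi>s)) ts)"
    using assms(1) by (auto simp: sym_power_map_def)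
  have "(\<Sum>(c, \<xi>s)\<leftarrow>ts. c * (\<Prod>\<xi>\<leftarrow>\<xi>s. \<xi> D1)) = (\<Sum>(c, \<xi>s)\<leftarrow>map (\<lambda>(c, \<xi>s). (c, map \<phi> \<xi>s)) ts. c * (\<Prod>\<xi>\<leftarrow>\<xi>s. \<xi> D2))"
    using ts(1)
  proof (induction ts)
    case (Cons t ts)
    obtain c \<xi>s where t: "t = (c, \<xi>s)" by (cases t)
    have *: "set \<xi>s \<subseteq> cotangent_space Z1 x1" "ts \<in> sym_terms Z1 x1 k"
      using Cons.prems by (auto simp: sym_terms_def t)
    have "map (\<lambda>\<xi>. \<xi> D1) \<xi>s = map (\<lambda>\<xi>. \<xi> D2) (map \<phi> \<xi>s)" using *(1) D(3) by auto
    then have "(\<Prod>\<xi>\<leftarrow>\<xi>s. \<xi> D1) = (\<Prod>\<xi>\<leftarrow>map \<phi> \<xi>s. \<xi> D2)" by (rule arg_cong)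
    with Cons.IH[OF *(2)] show ?case
      by (simp only: t list.map sum_list.Cons case_prod_conv)
  qed simp
  then show ?thesis using D(1,2) by (simp add: ts(2,3) sym_value_def)
qed

lemma sym_algebra_map_related:
  assumes PQ: "(P, Q) \<in> sym_algebra_map Z1 x1 Z2 x2 \<phi>" and fin: "finite {k. Q k \<noteq> 0}"
    and D: "D1 \<in> tangent_space Z1 x1" "D2 \<in> tangent_space Z2 x2"
      "\<And>\<xi>. \<xi> \<in> cotangent_space Z1 x1 \<Longrightarrow> \<phi> \<xi> D2 = \<xi> D1"
  shows "(\<Sum>k | P k \<noteq> 0. P k D1) = (\<Sum>k | Q k \<noteq> 0. Q k D2)"
proof -
  let ?I = "{k. P k \<noteq> 0} \<union> {k. Q k \<noteq> 0}"
  have I: "finite ?I" using PQ fin by (auto simp: sym_algebra_map_def)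
  have "(\<Sum>k | P k \<noteq> 0. P k D1) = (\<Sum>k\<in>?I. P k D1)" using I by (intro sum.mono_neutral_left) auto
  also have "\<dots> = (\<Sum>k\<in>?I. Q k D2)"
  proof (rule sum.cong[OF refl])
    fix k
    have "(P k, Q k) \<in> sym_power_map Z1 x1 Z2 x2 \<phi> k" using PQ by (simp add: sym_algebra_map_def)
    from sym_power_map_related[of "P k" "Q k" Z1 x1 Z2 x2 \<phi> k D1 D2, OF this D]
    show "P k D1 = Q k D2" .
  qed
  also have "\<dots> = (\<Sum>k | Q k \<noteq> 0. Q k D2)" using I by (intro sum.mono_neutral_right) auto
  finally show ?thesis .
qed

lemma germ_differential_cotangent:
  "germ_differential Z x u \<in> cotangent_space Z x"
  unfolding cotangent_space_def germ_differential_def mem_Collect_eq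
proof (intro conjI ballI allI impI)
  fix D E assume D: "D \<in> tangent_space Z x" "E \<in> tangent_space Z x"
  then have "D + E \<in> tangent_space Z x" by (rule tangent_space_add)
  then show "(if D + E \<in> tangent_space Z x then (D + E) u else 0) =
    (if D \<in> tangent_space Z x then D u else 0) + (if E \<in> tangent_space Z x then E u else 0)"
    using D by simp
next
  fix a D assume D: "D \<in> tangent_space Z x"
  then have "(\<lambda>\<phi>. a * D \<phi>) \<in> tangent_space Z x" by (rule tangent_space_cmult)
  then show "(if (\<lambda>\<phi>. a * D \<phi>) \<in> tangent_space Z x then a * D u else 0) =
    a * (if D \<in> tangent_space Z x then D u else 0)" using D by simp
qed simp

text \<open>\<open>sym_algebra_map\<close> starts from expressions in covectors; the differentials
  of the factors provide one for every element of the system.\<close>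

lemma fundamental_form_sym_power: "fundamental_form Z x k \<subseteq> sym_power Z x k"
proof
  fix P assume P: "P \<in> fundamental_form Z x k"
  show "P \<in> sym_power Z x k"
  proof (cases "k < 2")
    case False
    then obtain ts where ts: "ts \<in> ideal_terms Z x k"
      "P = sym_value Z x (map (\<lambda>(a, us). (a x, map (germ_differential Z x) us)) ts)"
      using P by (auto simp: fundamental_form_def has_symbol_def)
    have "map (\<lambda>(a, us). (a x, map (germ_differential Z x) us)) ts \<in> sym_terms Z x k"
      using ts(1) germ_differential_cotangent by (auto simp: sym_terms_def ideal_terms_def)
    then show ?thesis unfolding ts(2) sym_power_def by (rule imageI)
  qed (use P in \<open>simp add: fundamental_form_def\<close>)
qed

lemma sym_algebra_map_total:
  assumes "P \<in> fundamental_system Z1 x1"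
  shows "\<exists>Q. (P, Q) \<in> sym_algebra_map Z1 x1 Z2 x2 \<phi>"
proof -
  have "\<forall>k. \<exists>Q. (P k, Q) \<in> sym_power_map Z1 x1 Z2 x2 \<phi> k"
  proof
    fix k
    have "P k \<in> fundamental_form Z1 x1 k" using assms by (simp add: fundamental_system_def)
    then have "P k \<in> sym_power Z1 x1 k" by (rule subsetD[OF fundamental_form_sym_power])
    then show "\<exists>Q. (P k, Q) \<in> sym_power_map Z1 x1 Z2 x2 \<phi> k" by (auto simp: sym_power_def sym_power_map_def)
  qed
  then obtain Q where "\<And>k. (P k, Q k) \<in> sym_power_map Z1 x1 Z2 x2 \<phi> k" by metis
  then have "(P, Q) \<in> sym_algebra_map Z1 x1 Z2 x2 \<phi>"
    using assms by (simp add: sym_algebra_map_def fundamental_system_def)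
  then show ?thesis by blast
qed

text \<open>Each equation of \<open>Z'\<close>, pulled back along the matrix and multiplied by
  \<open>l0\<close>, vanishes on the cone of \<open>Z\<close>, and \<open>l0\<close> cancels by
  irreducibility.\<close>

lemma (in charted_variety) chart_maps_into:
  fixes A :: "complex ^ 'n ^ 'n"
  assumes Z': "projective_variety Z'" and inj: "\<And>v. A *v v = 0 \<Longrightarrow> v = 0"
    and chart: "\<And>v. v \<in> cone Z \<Longrightarrow> l0 v = 1 \<Longrightarrow> A *v v \<in> cone Z'" and v: "v \<in> cone Z"
  shows "A *v v \<in> cone Z'"
proof -
  obtain S' where S': "\<forall>f\<in>S'. \<exists>d. homog_poly d f" "Z' = proj_zeros S'"
    using Z' by (auto simp: projective_variety_def closedin_zariski)
  have nz: "A *v v \<noteq> 0" using inj v by (auto simp: cone_def)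
  have "f (A *v v) = 0" if f: "f \<in> S'" for f
  proof -
    obtain d where "homog_poly d f" using S' f by blast
    then have d: "homog_poly d (\<lambda>v. f (A *v v))" by (rule homog_poly_comp_matrix)
    have "l0 u ^ 1 * f (A *v u) = 0" if u: "u \<in> cone Z" for u
    proof (cases "l0 u = 0")
      case False
      let ?u = "(1 / l0 u) *s u"
      have "A *v ?u \<in> cone Z'"
        using False u by (intro chart) (auto simp: cone_scale dual_V_D[OF l0_dual])
      then have "f (A *v ?u) = 0" using f line_in_proj_zeros[OF S'(1)] S'(2) by (auto simp: cone_def)
      then show ?thesis using homog_poly_scale[OF d, of "1 / l0 u" u] False by simp
    qed simp
    from variety_power_domain[OF variety dual_V_homog[OF l0_dual] d this base_in_cone] v show ?thesis
      by (simp add: l0_base)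
  qed
  then show ?thesis using line_in_proj_zeros[OF S'(1) nz] nz S'(2) by (simp add: cone_def)
qed

lemma rows_matrix:
  fixes l :: "'n::finite \<Rightarrow> complex ^ 'n \<Rightarrow> complex"
  assumes "\<And>i. l i \<in> dual_V"
  shows "((\<chi> i j. l i (axis j 1)) *v v) $ i = l i v"
  by (simp add: matrix_vector_mult_def dual_V_expand[OF assms, of _ v])

lemma proj_map_line: "proj_map A (line v) = line (A *v v)"
  by (auto simp: proj_map_def line_def vec.scale image_image)

lemma euler_symmetric_reconstruction:
  fixes Z1 Z2 :: "('n::finite) ppoint set"
  assumes G1: "graded_variety Z1 v1 l1 S1 \<mu>1 c1 E1 K1" and G2: "graded_variety Z2 v2 l2 S2 \<mu>2 c2 E2 K2"
    and iso: "fundamental_systems_isomorphic Z1 (line v1) Z2 (line v2)"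
  shows "projectively_isomorphic Z1 Z2"
proof -
  interpret G1: graded_variety Z1 v1 l1 S1 \<mu>1 c1 E1 K1 by (rule G1)
  interpret G2: graded_variety Z2 v2 l2 S2 \<mu>2 c2 E2 K2 by (rule G2)
  let ?C1 = "cotangent_space Z1 (line v1)" and ?C2 = "cotangent_space Z2 (line v2)"
  let ?F1 = "fundamental_system Z1 (line v1)" and ?F2 = "fundamental_system Z2 (line v2)"
  obtain \<phi> where \<phi>: "cotangent_iso Z1 (line v1) Z2 (line v2) \<phi>"
    and F: "sym_algebra_map Z1 (line v1) Z2 (line v2) \<phi> `` ?F1 = ?F2"
    using iso unfolding fundamental_systems_isomorphic_def by (elim exE conjE)
  have bij: "bij_betw \<phi> ?C1 ?C2" and \<phi>_add: "\<And>\<xi> \<eta>. \<xi> \<in> ?C1 \<Longrightarrow> \<eta> \<in> ?C1 \<Longrightarrow> \<phi> (\<xi> + \<eta>) = \<phi> \<xi> + \<phi> \<eta>"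
    and \<phi>_scale: "\<And>a \<xi>. \<xi> \<in> ?C1 \<Longrightarrow> \<phi> (\<lambda>D. a * \<xi> D) = (\<lambda>D. a * \<phi> \<xi> D)"
    using \<phi> unfolding cotangent_iso_def by simp_all
  \<comment> \<open>The transpose of \<open>\<phi>\<close> between the tangent spaces, as a
    relation. Totality on both sides is reflexivity, applied to \<open>\<phi>\<close> and to its
    inverse.\<close>
  define rel where "rel D1 D2 \<longleftrightarrow> D1 \<in> G1.T \<and> D2 \<in> G2.T \<and> (\<forall>\<xi>\<in>?C1. \<phi> \<xi> D2 = \<xi> D1)" for D1 D2
  have total2: "\<exists>D1. rel D1 D2" if D2: "D2 \<in> G2.T" for D2
  proof -
    obtain D1 where "D1 \<in> G1.T" "\<And>\<xi>. \<xi> \<in> ?C1 \<Longrightarrow> \<phi> \<xi> D2 = \<xi> D1"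
      by (rule G1.cotangent_bidual[of "\<lambda>\<xi>. \<phi> \<xi> D2"]) (auto simp: \<phi>_add \<phi>_scale)
    then show ?thesis using D2 by (auto simp: rel_def)
  qed
  have total1: "\<exists>D2. rel D1 D2" if D1: "D1 \<in> G1.T" for D1
  proof -
    define \<psi> where "\<psi> = inv_into ?C1 \<phi>"
    have \<psi>: "\<psi> \<eta> \<in> ?C1" "\<phi> (\<psi> \<eta>) = \<eta>" if "\<eta> \<in> ?C2" for \<eta>
    proof -
      have "\<eta> \<in> \<phi> ` ?C1" using that bij by (simp add: bij_betw_def)
      then show "\<psi> \<eta> \<in> ?C1" "\<phi> (\<psi> \<eta>) = \<eta>" unfolding \<psi>_def by (rule inv_into_into, rule f_inv_into_f)
    qed
    have \<psi>\<phi>: "\<psi> (\<phi> \<xi>) = \<xi>" if "\<xi> \<in> ?C1" for \<xi>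
      using that bij by (simp add: \<psi>_def bij_betw_def)
    have \<psi>_add: "\<psi> (\<xi> + \<eta>) = \<psi> \<xi> + \<psi> \<eta>" if "\<xi> \<in> ?C2" "\<eta> \<in> ?C2" for \<xi> \<eta>
      using \<psi>\<phi>[OF cotangent_space_add[OF \<psi>(1)[OF that(1)] \<psi>(1)[OF that(2)]]] \<phi>_add[OF \<psi>(1)[OF that(1)] \<psi>(1)[OF that(2)]]
      by (simp add: \<psi>(2) that)
    have \<psi>_scale: "\<psi> (\<lambda>D. a * \<xi> D) = (\<lambda>D. a * \<psi> \<xi> D)" if "\<xi> \<in> ?C2" for a \<xi>
      using \<psi>\<phi>[OF cotangent_space_cmult[OF \<psi>(1)[OF that]], of a] \<phi>_scale[OF \<psi>(1)[OF that], of a] by (simp add: \<psi>(2) that)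
    obtain D2 where D2: "D2 \<in> G2.T" "\<And>\<eta>. \<eta> \<in> ?C2 \<Longrightarrow> \<psi> \<eta> D1 = \<eta> D2"
      by (rule G2.cotangent_bidual[of "\<lambda>\<eta>. \<psi> \<eta> D1"]) (auto simp: \<psi>_add \<psi>_scale)
    have "\<phi> \<xi> D2 = \<xi> D1" if "\<xi> \<in> ?C1" for \<xi>
    proof -
      have "\<phi> \<xi> \<in> ?C2" using bij that by (auto simp: bij_betw_def)
      from D2(2)[OF this] show ?thesis unfolding \<psi>\<phi>[OF that] by (rule sym)
    qed
    then show ?thesis using D1 D2(1) by (auto simp: rel_def)
  qed
  have transfer: "(\<Sum>k | P k \<noteq> 0. P k D1) = (\<Sum>k | Q k \<noteq> 0. Q k D2)"
    if "(P, Q) \<in> sym_algebra_map Z1 (line v1) Z2 (line v2) \<phi>" "Q \<in> ?F2" "rel D1 D2" for P Q D1 D2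
  proof (rule sym_algebra_map_related[of P Q Z1 "line v1" Z2 "line v2" \<phi> D1 D2])
    show "finite {k. Q k \<noteq> 0}" using that(2) by (simp add: fundamental_system_def)
  qed (use that in \<open>simp_all add: rel_def\<close>)
  have forward: "\<exists>l'\<in>dual_V. \<forall>D1 D2. rel D1 D2 \<longrightarrow> l' (G2.chart_point D2) = l (G1.chart_point D1)" if l: "l \<in> dual_V" for l
  proof -
    obtain P where P: "P \<in> ?F1" "\<forall>D\<in>G1.T. l (G1.chart_point D) = (\<Sum>k | P k \<noteq> 0. P k D)"
      using G1.form_chart_sum[OF l] by blast
    obtain Q where PQ: "(P, Q) \<in> sym_algebra_map Z1 (line v1) Z2 (line v2) \<phi>"
      using sym_algebra_map_total[OF P(1)] by blast
    then have Q: "Q \<in> ?F2" using F P(1) by blast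
    obtain l' where l': "l' \<in> dual_V" "\<forall>D\<in>G2.T. l' (G2.chart_point D) = (\<Sum>k | Q k \<noteq> 0. Q k D)"
      using G2.chart_sum_form[OF Q] by blast
    have "l' (G2.chart_point D2) = l (G1.chart_point D1)" if "rel D1 D2" for D1 D2
      using transfer[OF PQ Q that] that P(2) l'(2) by (simp add: rel_def)
    then show ?thesis using l'(1) by blast
  qed
  have backward: "\<exists>l'\<in>dual_V. \<forall>D1 D2. rel D1 D2 \<longrightarrow> l' (G1.chart_point D1) = l (G2.chart_point D2)" if l: "l \<in> dual_V" for l
  proof -
    obtain Q where Q: "Q \<in> ?F2" "\<forall>D\<in>G2.T. l (G2.chart_point D) = (\<Sum>k | Q k \<noteq> 0. Q k D)"
      using G2.form_chart_sum[OF l] by blast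
    \<comment> \<open>The relation is read backwards: a preimage exists because the image of the
      first system is all of the second.\<close>
    then obtain P where P: "P \<in> ?F1" "(P, Q) \<in> sym_algebra_map Z1 (line v1) Z2 (line v2) \<phi>"
      using F by blast
    obtain l' where l': "l' \<in> dual_V" "\<forall>D\<in>G1.T. l' (G1.chart_point D) = (\<Sum>k | P k \<noteq> 0. P k D)"
      using G1.chart_sum_form[OF P(1)] by blast
    have "l' (G1.chart_point D1) = l (G2.chart_point D2)" if "rel D1 D2" for D1 D2
      using transfer[OF P(2) Q(1) that] that Q(2) l'(2) by (simp add: rel_def)
    then show ?thesis using l'(1) by blast
  qed
  \<comment> \<open>The coordinates of a chart point of \<open>Z2\<close>, rewritten as linear forms
    at the related chart point of \<open>Z1\<close>, become the rows of \<open>A\<close>; the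
    opposite direction gives the rows of \<open>B\<close>.\<close>
  have "\<forall>i :: 'n. \<exists>l. l \<in> dual_V \<and> (\<forall>D1 D2. rel D1 D2 \<longrightarrow> l (G1.chart_point D1) = G2.chart_point D2 $ i)"
    using backward[OF dual_V_coord] by blast
  then obtain a where a: "\<And>i. a i \<in> dual_V"
    "\<And>i D1 D2. rel D1 D2 \<Longrightarrow> a i (G1.chart_point D1) = G2.chart_point D2 $ i" by metis
  have "\<forall>i :: 'n. \<exists>l. l \<in> dual_V \<and> (\<forall>D1 D2. rel D1 D2 \<longrightarrow> l (G2.chart_point D2) = G1.chart_point D1 $ i)"
    using forward[OF dual_V_coord] by blast
  then obtain b where b: "\<And>i. b i \<in> dual_V"
    "\<And>i D1 D2. rel D1 D2 \<Longrightarrow> b i (G2.chart_point D2) = G1.chart_point D1 $ i" by metis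
  define A where "A = (\<chi> i j. a i (axis j 1))"
  define B where "B = (\<chi> i j. b i (axis j 1))"
  have A: "A *v G1.chart_point D1 = G2.chart_point D2" if "rel D1 D2" for D1 D2
    by (simp add: vec_eq_iff A_def rows_matrix[OF a(1)] a(2)[OF that])
  have B: "B *v G2.chart_point D2 = G1.chart_point D1" if "rel D1 D2" for D1 D2
    by (simp add: vec_eq_iff B_def rows_matrix[OF b(1)] b(2)[OF that])
  \<comment> \<open>The matrices are known to be inverse to each other only on chart points. The
    difference is a linear form vanishing there, hence on the cone, hence on \<open>V\<close> by
    nondegeneracy.\<close>
  have "(B *v (A *v v)) $ i - v $ i = 0" for v i
  proof (rule G1.dual_zero)
    have "(\<lambda>v. ((B ** A) *v v) $ i) \<in> dual_V" by (rule dual_V_comp_matrix[OF dual_V_coord])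
    from dual_V_add[OF this dual_V_cmult[OF dual_V_coord, of "- 1" i]]
    show dual: "(\<lambda>v. (B *v (A *v v)) $ i - v $ i) \<in> dual_V" by (simp add: matrix_vector_mul_assoc)
    fix u assume u: "u \<in> cone Z1"
    have "l1 u' ^ 1 * ((B *v (A *v u')) $ i - u' $ i) = 0" if u': "u' \<in> cone Z1" for u'
    proof (cases "l1 u' = 0")
      case False
      let ?u = "(1 / l1 u') *s u'"
      have "?u \<in> cone Z1" "l1 ?u = 1" using False u' by (auto simp: cone_scale dual_V_D[OF G1.l0_dual])
      then obtain D1 where D1: "D1 \<in> G1.T" "?u = G1.chart_point D1" using G1.chart_point_image by blast
      then obtain D2 where "rel D1 D2" using total1 by blast
      then have "B *v (A *v ?u) = ?u" using A B D1(2) by metis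
      then have "(1 / l1 u') *s (B *v (A *v u')) = (1 / l1 u') *s u'" by (simp only: vec.scale)
      then show ?thesis using False by simp
    qed simp
    from variety_power_domain[OF G1.variety dual_V_homog[OF G1.l0_dual] dual_V_homog[OF dual] this G1.base_in_cone] u
    show "(B *v (A *v u)) $ i - u $ i = 0" by (simp add: G1.l0_base)
  qed
  then have BA: "B *v (A *v v) = v" for v by (simp add: vec_eq_iff)
  then have "B ** A = mat 1" by (simp add: matrix_eq matrix_vector_mul_assoc[symmetric])
  then have AB: "A ** B = mat 1" by (simp only: matrix_left_right_inverse)
  have AB': "A *v (B *v v) = v" for v by (simp add: matrix_vector_mul_assoc AB)
  have inv: "invertible A" unfolding invertible_def using \<open>B ** A = mat 1\<close> AB by blast
  have mapA: "A *v v \<in> cone Z2" if "v \<in> cone Z1" for v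
  proof (rule G1.chart_maps_into[OF G2.variety _ _ that])
    show "v = 0" if "A *v v = 0" for v using BA[of v] that by simp
    fix u assume "u \<in> cone Z1" "l1 u = 1"
    then obtain D1 where D1: "D1 \<in> G1.T" "u = G1.chart_point D1" using G1.chart_point_image by blast
    then obtain D2 where D2: "rel D1 D2" using total1 by blast
    then show "A *v u \<in> cone Z2" using A[OF D2] D1(2) G2.chart_point(1) by (simp add: rel_def)
  qed
  have mapB: "B *v v \<in> cone Z1" if "v \<in> cone Z2" for v
  proof (rule G2.chart_maps_into[OF G1.variety _ _ that])
    show "v = 0" if "B *v v = 0" for v using AB'[of v] that by simp
    fix u assume "u \<in> cone Z2" "l2 u = 1"
    then obtain D2 where D2: "D2 \<in> G2.T" "u = G2.chart_point D2" using G2.chart_point_image by blast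
    then obtain D1 where D1: "rel D1 D2" using total2 by blast
    then show "B *v u \<in> cone Z1" using B[OF D1] D2(2) G1.chart_point(1) by (simp add: rel_def)
  qed
  have "proj_map A ` Z1 = Z2"
  proof (intro equalityI subsetI)
    fix p assume "p \<in> proj_map A ` Z1"
    then obtain z where z: "z \<in> Z1" "p = proj_map A z" by blast
    then obtain v where v: "v \<noteq> 0" "z = line v" using G1.Z_sub proj_space_line by blast
    then have "A *v v \<in> cone Z2" using z(1) by (intro mapA) (simp add: cone_def)
    then show "p \<in> Z2" by (simp add: z(2) v(2) proj_map_line cone_def)
  next
    fix p assume p: "p \<in> Z2"
    then obtain v where v: "v \<noteq> 0" "p = line v" using G2.Z_sub proj_space_line by blast
    then have "B *v v \<in> cone Z1" using p by (intro mapB) (simp add: cone_def)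
    then have "proj_map A (line (B *v v)) \<in> proj_map A ` Z1" by (simp add: cone_def)
    then show "p \<in> proj_map A ` Z1" by (simp add: proj_map_line AB' v(2))
  qed
  then show ?thesis using inv unfolding projectively_isomorphic_def by blast
qed

theorem proposition2p7:
  fixes Z1 Z2 :: "('n::finite) ppoint set"
  assumes "projective_variety Z1" and "projective_variety Z2"
    and "nondegenerate Z1" and "nondegenerate Z2"
    and "euler_symmetric Z1" and "euler_symmetric Z2"
    and "variety_dim Z1 = variety_dim Z2"
  shows "\<exists>U1 U2. general_set Z1 U1 \<and> general_set Z2 U2 \<and>
           (\<forall>x1\<in>U1. \<forall>x2\<in>U2. fundamental_systems_isomorphic Z1 x1 Z2 x2 \<longrightarrow>
              projectively_isomorphic Z1 Z2)"
proof -
  \<comment> \<open>The general points are those for which Euler symmetry supplies an action of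
    Euler type.\<close>
  obtain U1 U2 where U: "general_set Z1 U1" "\<forall>x\<in>U1. \<exists>\<rho>. euler_type_at Z1 x \<rho>"
    "general_set Z2 U2" "\<forall>x\<in>U2. \<exists>\<rho>. euler_type_at Z2 x \<rho>"
    using assms(5,6) unfolding euler_symmetric_def by blast
  have "projectively_isomorphic Z1 Z2"
    if x: "x1 \<in> U1" "x2 \<in> U2" and iso: "fundamental_systems_isomorphic Z1 x1 Z2 x2" for x1 x2
  proof -
    obtain \<rho>1 \<rho>2 where \<rho>: "euler_type_at Z1 x1 \<rho>1" "euler_type_at Z2 x2 \<rho>2" using U x by blast
    obtain v1 l1 S1 \<mu>1 c1 E1 K1 where G1: "graded_variety Z1 v1 l1 S1 \<mu>1 c1 E1 K1" "x1 = line v1"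
      by (rule euler_type_graded[OF assms(1,3) \<rho>(1)])
    obtain v2 l2 S2 \<mu>2 c2 E2 K2 where G2: "graded_variety Z2 v2 l2 S2 \<mu>2 c2 E2 K2" "x2 = line v2"
      by (rule euler_type_graded[OF assms(2,4) \<rho>(2)])
    show ?thesis using euler_symmetric_reconstruction[OF G1(1) G2(1)] iso G1(2) G2(2) by simp
  qed
  then show ?thesis using U(1,3) by blast
qed

end
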